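(* Let $F,A\in\mathbb{R}^{m\times n}$, $H\in\mathbb{R}^{p\times n}$, let $Q_0,Q\in\mathbb{R}^{m\times m}$ and $R\in\mathbb{R}^{p\times p}$ be symmetric positive definite, and let $\ell\in\mathbb{R}^m$. The following statements are equivalent: (i) $(F,A,H)$ is $\ell$-detectable; (ii) there exists an infinite horizon minimax observer $\check U\in\mathscr{F}$ such that $\check U(t_1,s)=\delta_{t_1}(u^* )(s)=u^*(t_1-s)$ for $t_1>0$, $0\le s\le t_1$, and $\sigma(\check U,\ell)=J^*_\infty$, where $(q^*,u^* )\in\mathscr{D}_\ell([0,+\infty))$ satisfies $$J^*_\infty:=\limsup_{\tau\to\infty}J(q^*,u^*,\tau)=\limsup_{\tau\to\infty}\ \inf_{(q,u)\in\mathscr{D}_\ell([0,\tau])}J(q,u,\tau)<+\infty.$$ (Here $\check U$ denotes the observer; it is an element of $\mathscr{F}$.)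
   Context: Notation. $M^+$ is the Moore-Penrose pseudoinverse of a matrix $M$; $\mathcal{I}_m$ is the $m\times m$ identity; the infimum of an empty set is $+\infty$. $L^2_{loc}(I)$ denotes functions on an interval $I$ that are square integrable on every compact subinterval. $\check U$ is just a symbol for a particular observer. On $[0,+\infty)$, absolutely continuous means absolutely continuous on every compact subinterval. When $Fx$ (resp. $F^\top q$) is absolutely continuous, $Fx(t)$ (resp. $F^\top q(t)$) denotes the value at $t$ of the absolutely continuous function. DAE. For $I=[0,t_1]$, $0<t_1\in\mathbb{R}$, a solution on $I$ of the DAE $\frac{d(Fx)}{dt}=Ax+f$, $y=Hx+\eta$ is a tuple $(x,f,y,\eta)\in L^2_{loc}(I,\mathbb{R}^n)\times L^2_{loc}(I,\mathbb{R}^m)\times L^2_{loc}(I,\mathbb{R}^p)\times L^2_{loc}(I,\mathbb{R}^p)$ such that $Fx$ is absolutely continuous, $Fx(t)=Fx(0)+\int_0^t(Ax(s)+f(s))ds$ for all $t\in I$, and $y(t)=Hx(t)+\eta(t)$ a.e. on $I$. It is admissible if $(Fx(0))^\top Q_0Fx(0)+\int_0^{\tau}(f^\top Qf+\eta^\top R\eta)dt\le1$ for all $\tau\in I$. The set of admissible solutions on $I$ is $\mathscr{EE}(I)$. Observers. For $U\in L^2([0,t],\mathbb{R}^p)$, $$\sigma(U,\ell,t):=\sup_{(x,f,y,\eta)\in\mathscr{EE}([0,t])}\Big(\ell^\top Fx(t)-\int_0^ty^\top(s)U(s)ds\Big)^2.$$ $\mathscr{F}$ is the set of all maps $U:\{(\tau,s)\mid\tau>0,\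 s\in[0,\tau]\}\to\mathbb{R}^p$ such that for every $\tau>0$ the function $U(\tau,\cdot):s\mapsto U(\tau,s)$ belongs to $L^2([0,\tau],\mathbb{R}^p)$. For $U\in\mathscr{F}$, $\sigma(U,\ell):=\limsup_{t\to\infty}\sigma(U(t,\cdot),\ell,t)$. $\check U\in\mathscr{F}$ is an infinite horizon minimax observer if $\sigma(\check U,\ell)=\inf_{U\in\mathscr{F}}\sigma(U,\ell)<+\infty$. Dual DAE. For $I=[0,\tau]$, $0<\tau\in\mathbb{R}$, or $I=[0,+\infty)$, a solution on $I$ of the dual DAE $\frac{d(F^\top q)}{dt}=A^\top q-H^\top u$ is a pair $(q,u)\in L^2_{loc}(I,\mathbb{R}^m)\times L^2_{loc}(I,\mathbb{R}^p)$ such that $F^\top q$ is absolutely continuous and $F^\top q(t)=F^\top q(0)+\int_0^t(A^\top q(s)-H^\top u(s))ds$ for all $t\in I$. $\mathscr{D}_\ell(I)$ is the set of all solutions $(q,u)$ on $I$ with $F^\top q(0)=F^\top\ell$. The tuple $(F,A,H)$ is $\ell$-detectable if there exists $(q,u)\in\mathscr{D}_\ell([0,+\infty))$ such that $\lim_{t\to\infty}F^\top q(t)=0$. Dual cost. For $\tau>0$ and $(q,u)\in\mathscr{D}_\ell(I)$ with $I\supseteq[0,\tau]$, $$J(q,u,\tau):=q(\tau)^\top\bar Q_0q(\tau)+\int_0^{\tau}\big(q^\top(t)Q^{-1}q(t)+u^\top(t)R^{-1}u(t)\big)dt,$$ where $\bar Q_0=F\big((F^\top)^+-\mathcal{M}_{opt}\big)^\top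 Q_0^{-1}\big((F^\top)^+-\mathcal{M}_{opt}\big)F^\top$, $\mathcal{M}_{opt}=P(PQ_0^{-1}P)^+PQ_0^{-1}(F^\top)^+$, $P=\mathcal{I}_m-(F^\top)^+F^\top$. (The first term depends only on $F^\top q(\tau)$ and is understood in that sense.) *)

theory Defs
  imports "HOL-Analysis.Analysis"
begin

subsection \<open>Matrices\<close>

definition sym_pos_def :: "real^'k^'k \<Rightarrow> bool" where
  "sym_pos_def M \<longleftrightarrow> transpose M = M \<and> (\<forall>x. x \<noteq> 0 \<longrightarrow> x \<bullet> (M *v x) > 0)"

text \<open>The Moore-Penrose pseudoinverse, characterised by the four Penrose equations.\<close>

definition is_pinv :: "real^'n^'m \<Rightarrow> real^'m^'n \<Rightarrow> bool" where
  "is_pinv M X \<longleftrightarrow> M ** X ** M = M \<and> X ** M ** X = X \<and>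
     transpose (M ** X) = M ** X \<and> transpose (X ** M) = X ** M"

definition pinv :: "real^'n^'m \<Rightarrow> real^'m^'n" where
  "pinv M = (THE X. is_pinv M X)"

lemma is_pinv_unique:
  assumes X: "is_pinv M X" and Y: "is_pinv M Y"
  shows "X = Y"
proof -
  have MX: "M ** X = M ** Y"
  proof -
    have "M ** X = transpose (M ** X)" using X by (simp add: is_pinv_def)
    also have "\<dots> = transpose (M ** Y ** M ** X)" using Y by (simp add: is_pinv_def)
    also have "\<dots> = transpose (M ** X) ** transpose (M ** Y)"
      by (simp add: matrix_mul_assoc flip: matrix_transpose_mul)
    also have "\<dots> = M ** X ** M ** Y" using X Y by (simp add: is_pinv_def matrix_mul_assoc)
    also have "\<dots> = M ** Y" using X by (simp add: is_pinv_def)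
    finally show ?thesis .
  qed
  have XM: "X ** M = Y ** M"
  proof -
    have "X ** M = transpose (X ** M)" using X by (simp add: is_pinv_def)
    also have "\<dots> = transpose (X ** (M ** Y ** M))" using Y by (simp add: is_pinv_def)
    also have "\<dots> = transpose (Y ** M) ** transpose (X ** M)"
      by (simp add: matrix_mul_assoc flip: matrix_transpose_mul)
    also have "\<dots> = Y ** (M ** X ** M)" using X Y unfolding is_pinv_def by (metis matrix_mul_assoc)
    also have "\<dots> = Y ** M" using X by (simp add: is_pinv_def)
    finally show ?thesis .
  qed
  have "X = X ** M ** X" using X by (simp add: is_pinv_def)
  also have "\<dots> = Y ** M ** Y" by (metis MX XM matrix_mul_assoc)
  also have "\<dots> = Y" using Y by (simp add: is_pinv_def)
  finally show ?thesis .
qed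

subsection \<open>Locally square integrable and absolutely continuous functions\<close>

text \<open>
  Elements of \<open>L2_loc\<close> are represented by functions on the whole real line, of which only
  the values on the interval under consideration matter.
\<close>

definition L2_on :: "real set \<Rightarrow> (real \<Rightarrow> 'a::euclidean_space) set" where
  "L2_on S = {f. f \<in> borel_measurable (lebesgue_on S) \<and>
                 integrable (lebesgue_on S) (\<lambda>t. (norm (f t))\<^sup>2)}"

definition L2_loc :: "real set \<Rightarrow> (real \<Rightarrow> 'a::euclidean_space) set" where
  "L2_loc I = {f. \<forall>a b. a \<le> b \<longrightarrow> {a..b} \<subseteq> I \<longrightarrow> f \<in> L2_on {a..b}}"

definition abs_cont_on :: "real set \<Rightarrow> (real \<Rightarrow> 'a::real_normed_vector) \<Rightarrow> bool" where
  "abs_cont_on S w \<longleftrightarrow>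
     (\<forall>\<epsilon>>0. \<exists>\<delta>>0. \<forall>D::(real \<times> real) set.
        finite D \<longrightarrow>
        (\<forall>(a, b)\<in>D. a \<le> b \<and> {a..b} \<subseteq> S) \<longrightarrow>
        pairwise (\<lambda>(a, b) (c, d). disjnt {a<..<b} {c<..<d}) D \<longrightarrow>
        (\<Sum>(a, b)\<in>D. b - a) < \<delta> \<longrightarrow>
        (\<Sum>(a, b)\<in>D. norm (w b - w a)) < \<epsilon>)"

definition loc_abs_cont_on :: "real set \<Rightarrow> (real \<Rightarrow> 'a::real_normed_vector) \<Rightarrow> bool" where
  "loc_abs_cont_on I w \<longleftrightarrow> (\<forall>a b. a \<le> b \<longrightarrow> {a..b} \<subseteq> I \<longrightarrow> abs_cont_on {a..b} w)"

text \<open>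
  An \<open>L2_loc\<close> function is absolutely continuous if it agrees almost everywhere with an
  absolutely continuous function \<open>w\<close>; its value at \<open>t\<close> is then the value of \<open>w\<close> at \<open>t\<close>.
  On an interval with non-empty interior, \<open>w\<close> is determined at every point (lemma
  \<open>ac_value_eq\<close> below).
\<close>

definition ac_version :: "real set \<Rightarrow> (real \<Rightarrow> 'a::real_normed_vector) \<Rightarrow> (real \<Rightarrow> 'a) \<Rightarrow> bool" where
  "ac_version I g w \<longleftrightarrow> loc_abs_cont_on I w \<and> (AE t in lebesgue_on I. w t = g t)"

definition ac_value :: "real set \<Rightarrow> (real \<Rightarrow> 'a::real_normed_vector) \<Rightarrow> real \<Rightarrow> 'a" where
  "ac_value I g = (SOME w. ac_version I g w)"

lemma abs_cont_on_imp_continuous_on: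
  assumes "abs_cont_on {a..b} w"
  shows "continuous_on {a..b} w"
  unfolding continuous_on_iff
proof (intro ballI allI impI)
  fix x e :: real
  assume x: "x \<in> {a..b}" and "0 < e"
  then obtain d where "d > 0" and d: "\<And>D::(real \<times> real) set. finite D \<Longrightarrow>
        (\<forall>(r, s)\<in>D. r \<le> s \<and> {r..s} \<subseteq> {a..b}) \<Longrightarrow>
        pairwise (\<lambda>(r, s) (c, d). disjnt {r<..<s} {c<..<d}) D \<Longrightarrow>
        (\<Sum>(r, s)\<in>D. s - r) < d \<Longrightarrow> (\<Sum>(r, s)\<in>D. norm (w s - w r)) < e"
    using assms unfolding abs_cont_on_def by meson
  show "\<exists>d>0. \<forall>x'\<in>{a..b}. dist x' x < d \<longrightarrow> dist (w x') (w x) < e"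
  proof (intro exI[of _ d] conjI ballI impI)
    fix y assume y: "y \<in> {a..b}" and yx: "dist y x < d"
    have "norm (w (max x y) - w (min x y)) < e"
      using d[of "{(min x y, max x y)}"] x y yx by (auto simp: dist_real_def)
    then show "dist (w y) (w x) < e"
      by (auto simp: dist_norm norm_minus_commute max_def min_def split: if_splits)
  qed fact
qed

lemma ac_value_eq:
  assumes w: "ac_version I g w" and ab: "a < b" "{a..b} \<subseteq> I" and I: "I \<in> sets lebesgue"
    and t: "t \<in> {a..b}"
  shows "ac_value I g t = w t"
proof -
  define v where "v = ac_value I g"
  have v: "ac_version I g v"
    unfolding v_def ac_value_def using w by (rule someI[where P = "ac_version I g"])
  have "AE s in lebesgue_on I. v s - w s = 0"
    using v w unfolding ac_version_def by (auto elim: AE_mp)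
  then have ae: "AE s in lebesgue. s \<in> I \<longrightarrow> v s - w s = 0"
    using I by (subst (asm) AE_restrict_space_iff) auto
  have cont: "continuous_on {a..b} (\<lambda>s. v s - w s)"
    using v w ab unfolding ac_version_def loc_abs_cont_on_def
    by (intro continuous_on_diff abs_cont_on_imp_continuous_on) auto
  have "v t - w t = 0"
  proof (rule ccontr)
    assume nz: "v t - w t \<noteq> 0"
    obtain d where "d > 0"
      and d: "\<And>s. s \<in> {a..b} \<Longrightarrow> dist s t < d \<Longrightarrow> v s - w s \<noteq> 0"
      using cont t nz unfolding continuous_on_iff
      by (metis zero_less_dist_iff dist_commute less_irrefl)
    define r where "r = max a (t - d)"
    define s where "s = min b (t + d)"
    have "r < s" using \<open>d > 0\<close> t ab by (auto simp: r_def s_def)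
    have sub: "{r<..<s} \<subseteq> {x. \<not> (x \<in> I \<longrightarrow> v x - w x = 0)}"
    proof
      fix x assume "x \<in> {r<..<s}"
      then have "x \<in> {a..b}" "dist x t < d"
        by (auto simp: r_def s_def dist_real_def)
      with d[of x] ab show "x \<in> {x. \<not> (x \<in> I \<longrightarrow> v x - w x = 0)}" by auto
    qed
    obtain N where N: "N \<in> null_sets lebesgue" "{x. \<not> (x \<in> I \<longrightarrow> v x - w x = 0)} \<subseteq> N"
      using ae by (auto simp: eventually_ae_filter)
    have "emeasure lebesgue {r<..<s} \<le> emeasure lebesgue N"
      using N sub by (intro emeasure_mono) auto
    with N \<open>r < s\<close> show False by auto
  qed
  then show ?thesis by (simp add: v_def)
qed

subsection \<open>The DAE and its admissible solutions\<close>

definition dae_solution ::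
  "real^'n^'m \<Rightarrow> real^'n^'m \<Rightarrow> real^'n^'p \<Rightarrow> real set \<Rightarrow>
   (real \<Rightarrow> real^'n) \<Rightarrow> (real \<Rightarrow> real^'m) \<Rightarrow> (real \<Rightarrow> real^'p) \<Rightarrow> (real \<Rightarrow> real^'p) \<Rightarrow> bool" where
  "dae_solution F A H I x f y \<eta> \<longleftrightarrow>
     x \<in> L2_loc I \<and> f \<in> L2_loc I \<and> y \<in> L2_loc I \<and> \<eta> \<in> L2_loc I \<and>
     (\<exists>w. ac_version I (\<lambda>s. F *v x s) w) \<and>
     (\<forall>t\<in>I. ac_value I (\<lambda>s. F *v x s) t =
        ac_value I (\<lambda>s. F *v x s) 0 + (LINT s|lebesgue_on {0..t}. A *v x s + f s)) \<and>
     (AE t in lebesgue_on I. y t = H *v x t + \<eta> t)"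

definition admissible ::
  "real^'n^'m \<Rightarrow> real^'n^'m \<Rightarrow> real^'n^'p \<Rightarrow> real^'m^'m \<Rightarrow> real^'m^'m \<Rightarrow> real^'p^'p \<Rightarrow> real set \<Rightarrow>
   ((real \<Rightarrow> real^'n) \<times> (real \<Rightarrow> real^'m) \<times> (real \<Rightarrow> real^'p) \<times> (real \<Rightarrow> real^'p)) set" where
  "admissible F A H Q0 Q R I =
     {(x, f, y, \<eta>). dae_solution F A H I x f y \<eta> \<and>
        (\<forall>\<tau>\<in>I.
           ac_value I (\<lambda>s. F *v x s) 0 \<bullet> (Q0 *v ac_value I (\<lambda>s. F *v x s) 0) +
           (LINT t|lebesgue_on {0..\<tau>}. f t \<bullet> (Q *v f t) + \<eta> t \<bullet> (R *v \<eta> t)) \<le> 1)}"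

subsection \<open>Observers\<close>

text \<open>The worst-case error may be infinite, hence the extended reals.\<close>

definition sigma_fin ::
  "real^'n^'m \<Rightarrow> real^'n^'m \<Rightarrow> real^'n^'p \<Rightarrow> real^'m^'m \<Rightarrow> real^'m^'m \<Rightarrow> real^'p^'p \<Rightarrow>
   (real \<Rightarrow> real^'p) \<Rightarrow> real^'m \<Rightarrow> real \<Rightarrow> ereal" where
  "sigma_fin F A H Q0 Q R U l t =
     (SUP (x, f, y, \<eta>) \<in> admissible F A H Q0 Q R {0..t}.
        ereal ((l \<bullet> ac_value {0..t} (\<lambda>s. F *v x s) t - (LINT s|lebesgue_on {0..t}. y s \<bullet> U s))\<^sup>2))"

text \<open>
  An observer is a function of \<open>\<tau> > 0\<close> and \<open>s \<in> {0..\<tau>}\<close>; its values elsewhere are irrelevant.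
\<close>

definition observers :: "(real \<Rightarrow> real \<Rightarrow> real^'p) set" where
  "observers = {U. \<forall>\<tau>>0. U \<tau> \<in> L2_on {0..\<tau>}}"

definition sigma_lim ::
  "real^'n^'m \<Rightarrow> real^'n^'m \<Rightarrow> real^'n^'p \<Rightarrow> real^'m^'m \<Rightarrow> real^'m^'m \<Rightarrow> real^'p^'p \<Rightarrow>
   (real \<Rightarrow> real \<Rightarrow> real^'p) \<Rightarrow> real^'m \<Rightarrow> ereal" where
  "sigma_lim F A H Q0 Q R U l = Limsup at_top (\<lambda>t. sigma_fin F A H Q0 Q R (U t) l t)"

definition minimax_observer ::
  "real^'n^'m \<Rightarrow> real^'n^'m \<Rightarrow> real^'n^'p \<Rightarrow> real^'m^'m \<Rightarrow> real^'m^'m \<Rightarrow> real^'p^'p \<Rightarrow>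
   real^'m \<Rightarrow> (real \<Rightarrow> real \<Rightarrow> real^'p) \<Rightarrow> bool" where
  "minimax_observer F A H Q0 Q R l V \<longleftrightarrow>
     V \<in> observers \<and>
     sigma_lim F A H Q0 Q R V l = (INF U \<in> observers. sigma_lim F A H Q0 Q R U l) \<and>
     sigma_lim F A H Q0 Q R V l < \<infinity>"

subsection \<open>The dual DAE and detectability\<close>

definition dual_solution ::
  "real^'n^'m \<Rightarrow> real^'n^'m \<Rightarrow> real^'n^'p \<Rightarrow> real set \<Rightarrow>
   (real \<Rightarrow> real^'m) \<Rightarrow> (real \<Rightarrow> real^'p) \<Rightarrow> bool" where
  "dual_solution F A H I q u \<longleftrightarrow>
     q \<in> L2_loc I \<and> u \<in> L2_loc I \<and>
     (\<exists>w. ac_version I (\<lambda>s. transpose F *v q s) w) \<and>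
     (\<forall>t\<in>I. ac_value I (\<lambda>s. transpose F *v q s) t =
        ac_value I (\<lambda>s. transpose F *v q s) 0 +
        (LINT s|lebesgue_on {0..t}. transpose A *v q s - transpose H *v u s))"

definition dual_solutions ::
  "real^'n^'m \<Rightarrow> real^'n^'m \<Rightarrow> real^'n^'p \<Rightarrow> real^'m \<Rightarrow> real set \<Rightarrow>
   ((real \<Rightarrow> real^'m) \<times> (real \<Rightarrow> real^'p)) set" where
  "dual_solutions F A H l I =
     {(q, u). dual_solution F A H I q u \<and>
        ac_value I (\<lambda>s. transpose F *v q s) 0 = transpose F *v l}"

definition detectable ::
  "real^'n^'m \<Rightarrow> real^'n^'m \<Rightarrow> real^'n^'p \<Rightarrow> real^'m \<Rightarrow> bool" where
  "detectable F A H l \<longleftrightarrow>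
     (\<exists>(q, u) \<in> dual_solutions F A H l {0..}.
        (ac_value {0..} (\<lambda>s. transpose F *v q s) \<longlongrightarrow> 0) at_top)"

subsection \<open>The dual cost\<close>

definition P_mat :: "real^'n^'m \<Rightarrow> real^'m^'m" where
  "P_mat F = mat 1 - pinv (transpose F) ** transpose F"

definition M_opt :: "real^'n^'m \<Rightarrow> real^'m^'m \<Rightarrow> real^'n^'m" where
  "M_opt F Q0 = P_mat F ** pinv (P_mat F ** matrix_inv Q0 ** P_mat F) ** P_mat F **
     matrix_inv Q0 ** pinv (transpose F)"

definition Q0_bar :: "real^'n^'m \<Rightarrow> real^'m^'m \<Rightarrow> real^'m^'m" where
  "Q0_bar F Q0 = F ** transpose (pinv (transpose F) - M_opt F Q0) ** matrix_inv Q0 **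
     (pinv (transpose F) - M_opt F Q0) ** transpose F"

text \<open>
  The quadratic form of \<open>Q0_bar F Q0\<close> at \<open>z\<close>, as a function of \<open>w = transpose F *v z\<close>; by the
  lemma, the choice of the preimage \<open>z\<close> is immaterial.
\<close>

definition terminal_cost :: "real^'n^'m \<Rightarrow> real^'m^'m \<Rightarrow> real^'n \<Rightarrow> real" where
  "terminal_cost F Q0 w = (let z = (SOME z. transpose F *v z = w) in z \<bullet> (Q0_bar F Q0 *v z))"

lemma terminal_cost_eq:
  "terminal_cost F Q0 (transpose F *v z) = z \<bullet> (Q0_bar F Q0 *v z)"
proof -
  define W where "W = transpose (pinv (transpose F) - M_opt F Q0) ** matrix_inv Q0 **
     (pinv (transpose F) - M_opt F Q0)"
  have "Q0_bar F Q0 = F ** W ** transpose F"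
    by (simp add: Q0_bar_def W_def matrix_mul_assoc)
  then have *: "v \<bullet> (Q0_bar F Q0 *v v) = (transpose F *v v) \<bullet> (W *v (transpose F *v v))" for v
    by (simp add: dot_lmul_matrix flip: matrix_vector_mul_assoc)
  define v where "v = (SOME v. transpose F *v v = transpose F *v z)"
  have "transpose F *v v = transpose F *v z"
    unfolding v_def by (rule someI) (rule refl)
  then show ?thesis
    by (simp only: terminal_cost_def Let_def * flip: v_def)
qed

text \<open>
  \<open>J\<close> does not depend on the interval \<open>I \<supseteq> {0..\<tau>}\<close> on which \<open>(q, u)\<close> is a solution: for
  \<open>\<tau> > 0\<close> the absolutely continuous version on \<open>{0..\<tau>}\<close> is the restriction of the one on \<open>I\<close>.
\<close>

definition J ::
  "real^'n^'m \<Rightarrow> real^'m^'m \<Rightarrow> real^'m^'m \<Rightarrow> real^'p^'p \<Rightarrow>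
   (real \<Rightarrow> real^'m) \<Rightarrow> (real \<Rightarrow> real^'p) \<Rightarrow> real \<Rightarrow> real" where
  "J F Q0 Q R q u \<tau> =
     terminal_cost F Q0 (ac_value {0..\<tau>} (\<lambda>s. transpose F *v q s) \<tau>) +
     (LINT t|lebesgue_on {0..\<tau>}.
        q t \<bullet> (matrix_inv Q *v q t) + u t \<bullet> (matrix_inv R *v u t))"

end

theory Submission
  imports Defs
begin

text \<open>
  For a fixed observation kernel \<open>U\<close> on \<open>[0, t]\<close>, the worst-case error \<open>sigma_fin U l t\<close> is related to the
  dual cost by linear-quadratic duality.  If \<open>U(s) = u(t - s)\<close> for a dual solution \<open>(q, u)\<close> starting at
  \<open>F\<^sup>T l\<close>, an integration by parts expresses the estimation error through \<open>F x(0)\<close>, \<open>f\<close>, \<open>\<eta>\<close>, and the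
  Cauchy--Schwarz inequality bounds its square by \<open>J q u t\<close> (\<open>weak_duality\<close>).  Conversely, if the
  worst-case error of \<open>U\<close> is finite, the error is a bounded linear functional of \<open>(F x(0), f, \<eta>)\<close>, and
  the function representing it, read backwards in time, is a dual solution with control \<open>U(t - s)\<close>
  whose cost is at most the worst-case error (\<open>strong_duality\<close>).  Hence every observer has
  asymptotic error at least \<open>Limsup\<close> of the finite horizon minima of \<open>J\<close>, and an observer made from a
  dual solution on \<open>[0, \<infinity>)\<close> has asymptotic error at most \<open>Limsup\<close> of the cost of that solution.

  It remains to find a dual solution for which the two limits agree and are finite.  Detectability
  provides a dual solution with \<open>F\<^sup>T q \<longlonglongrightarrow> 0\<close>, but of possibly infinite cost.  The initial values of
  such solutions form a finite-dimensional space, so there are solutions depending linearly on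
  the initial value and a common time after which every initial value has been halved;
  concatenating these pieces gives solutions whose cost on \<open>[0, n]\<close> is bounded independently of
  \<open>n\<close> (\<open>lin_sol_bounded_energy\<close>).  By the parallelogram identity, near-minimisers of the cost on growing
  horizons form a Cauchy sequence on each bounded interval, and their limit is a solution on
  \<open>[0, \<infinity>)\<close> whose cost is the limit of the finite horizon minima (\<open>lin_sol_optimal\<close>).  A solution of
  finite cost satisfies \<open>F\<^sup>T q \<longlonglongrightarrow> 0\<close>, because \<open>F\<^sup>T q\<close> and its derivative are square integrable
  (\<open>lin_sol_tendsto_zero\<close>); so the terminal costs vanish in the limit, and the same fact gives the
  converse implication.  No Riccati equation and no normal form of the pencil is needed.
\<close>

section \<open>Square integrable functions\<close>

lemma L2_onI:
  "f \<in> borel_measurable (lebesgue_on S) \<Longrightarrow> integrable (lebesgue_on S) (\<lambda>t. (norm (f t))\<^sup>2) \<Longrightarrow> f \<in> L2_on S"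
  by (simp add: L2_on_def)

lemma L2_on_measurable: "f \<in> L2_on S \<Longrightarrow> f \<in> borel_measurable (lebesgue_on S)"
  and L2_on_integrable_sq: "f \<in> L2_on S \<Longrightarrow> integrable (lebesgue_on S) (\<lambda>t. (norm (f t))\<^sup>2)"
  by (simp_all add: L2_on_def)

lemma L2_on_dominated:
  fixes f :: "real \<Rightarrow> 'a::euclidean_space"
  assumes "f \<in> borel_measurable (lebesgue_on S)" "integrable (lebesgue_on S) g"
    and "AE t in lebesgue_on S. (norm (f t))\<^sup>2 \<le> g t"
  shows "f \<in> L2_on S"
proof (rule L2_onI)
  show "integrable (lebesgue_on S) (\<lambda>t. (norm (f t))\<^sup>2)"
    using assms by (intro Bochner_Integration.integrable_bound[OF assms(2)]) auto
qed fact

lemma L2_on_linear: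
  fixes f :: "real \<Rightarrow> 'a::euclidean_space" and K :: "'a \<Rightarrow> 'b::euclidean_space"
  assumes "linear K" "f \<in> L2_on S"
  shows "(\<lambda>t. K (f t)) \<in> L2_on S"
proof -
  interpret K: bounded_linear K using assms(1) by (simp add: linear_conv_bounded_linear)
  obtain B where B: "\<And>x. norm (K x) \<le> norm x * B" using K.bounded by blast
  show ?thesis
  proof (rule L2_on_dominated)
    have "K \<in> borel_measurable borel"
      by (intro borel_measurable_continuous_onI K.continuous_on continuous_on_id)
    then show "(\<lambda>t. K (f t)) \<in> borel_measurable (lebesgue_on S)"
      using L2_on_measurable[OF assms(2)] by measurable
    show "integrable (lebesgue_on S) (\<lambda>t. (norm (f t))\<^sup>2 * B\<^sup>2)"
      using L2_on_integrable_sq[OF assms(2)] by simp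
    show "AE t in lebesgue_on S. (norm (K (f t)))\<^sup>2 \<le> (norm (f t))\<^sup>2 * B\<^sup>2"
      using B by (auto simp: power_mono simp flip: power_mult_distrib)
  qed
qed

lemma norm_add_sq_le: "(norm (x + y :: 'a::real_normed_vector))\<^sup>2 \<le> 2 * (norm x)\<^sup>2 + 2 * (norm y)\<^sup>2"
proof -
  have "(norm (x + y))\<^sup>2 \<le> (norm x + norm y)\<^sup>2" by (intro power_mono norm_triangle_ineq) auto
  also have "\<dots> \<le> 2 * (norm x)\<^sup>2 + 2 * (norm y)\<^sup>2"
    using sum_squares_bound[of "norm x" "norm y"] by (simp add: power2_sum)
  finally show ?thesis .
qed

lemma L2_on_add:
  fixes f g :: "real \<Rightarrow> 'a::euclidean_space"
  assumes f: "f \<in> L2_on S" and g: "g \<in> L2_on S"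
  shows "(\<lambda>t. f t + g t) \<in> L2_on S"
proof (rule L2_on_dominated)
  show "(\<lambda>t. f t + g t) \<in> borel_measurable (lebesgue_on S)"
    using L2_on_measurable[OF f] L2_on_measurable[OF g] by simp
  show "integrable (lebesgue_on S) (\<lambda>t. 2 * (norm (f t))\<^sup>2 + 2 * (norm (g t))\<^sup>2)"
    using L2_on_integrable_sq[OF f] L2_on_integrable_sq[OF g] by simp
qed (auto simp: norm_add_sq_le)

lemma L2_on_scaleR: "f \<in> L2_on S \<Longrightarrow> (\<lambda>t. c *\<^sub>R f t) \<in> L2_on S"
  by (intro L2_on_linear[of "\<lambda>x. c *\<^sub>R x"]) (auto intro: linearI simp: algebra_simps)

lemma L2_on_diff:
  "f \<in> L2_on S \<Longrightarrow> g \<in> L2_on S \<Longrightarrow> (\<lambda>t. f t - g t) \<in> L2_on S"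
  using L2_on_add[OF _ L2_on_scaleR[of g S "-1"], of f] by simp

lemma L2_on_zero: "(\<lambda>t. 0) \<in> L2_on S"
  by (simp add: L2_on_def)

lemma L2_on_Pair:
  fixes f :: "real \<Rightarrow> 'a::euclidean_space" and g :: "real \<Rightarrow> 'b::euclidean_space"
  assumes "f \<in> L2_on S" "g \<in> L2_on S"
  shows "(\<lambda>t. (f t, g t)) \<in> L2_on S"
proof -
  have "(\<lambda>t. (f t, 0::'b) + (0::'a, g t)) \<in> L2_on S"
    using assms
    by (intro L2_on_add L2_on_linear[of "\<lambda>x. (x, 0)" f] L2_on_linear[of "\<lambda>x. (0, x)" g] linearI) auto
  then show ?thesis by simp
qed

lemma L2_on_fst: "f \<in> L2_on S \<Longrightarrow> (\<lambda>t. fst (f t)) \<in> L2_on S"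
  and L2_on_snd: "f \<in> L2_on S \<Longrightarrow> (\<lambda>t. snd (f t)) \<in> L2_on S"
  by (auto intro: L2_on_linear linear_fst linear_snd)

lemma L2_on_matrix:
  fixes M :: "real^'n^'m"
  shows "f \<in> L2_on S \<Longrightarrow> (\<lambda>t. M *v f t) \<in> L2_on S"
  by (intro L2_on_linear[of "(*v) M"]) (auto intro: matrix_vector_mul_linear)

lemma L2_on_inner_integrable:
  fixes f g :: "real \<Rightarrow> 'a::euclidean_space"
  assumes f: "f \<in> L2_on S" and g: "g \<in> L2_on S"
  shows "integrable (lebesgue_on S) (\<lambda>t. f t \<bullet> g t)"
proof (rule Bochner_Integration.integrable_bound)
  show "integrable (lebesgue_on S) (\<lambda>t. (norm (f t))\<^sup>2 + (norm (g t))\<^sup>2)"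
    using L2_on_integrable_sq[OF f] L2_on_integrable_sq[OF g] by simp
  show "(\<lambda>t. f t \<bullet> g t) \<in> borel_measurable (lebesgue_on S)"
    using L2_on_measurable[OF f] L2_on_measurable[OF g] by simp
  have "\<bar>x \<bullet> y\<bar> \<le> (norm x)\<^sup>2 + (norm y)\<^sup>2" for x y :: 'a
  proof -
    have "\<bar>x \<bullet> y\<bar> \<le> norm x * norm y" by (rule Cauchy_Schwarz_ineq2)
    also have "\<dots> \<le> (norm x)\<^sup>2 + (norm y)\<^sup>2"
      using sum_squares_bound[of "norm x" "norm y"] mult_nonneg_nonneg[OF norm_ge_zero[of x] norm_ge_zero[of y]] by linarith
    finally show ?thesis .
  qed
  then show "AE t in lebesgue_on S. norm (f t \<bullet> g t) \<le> norm ((norm (f t))\<^sup>2 + (norm (g t))\<^sup>2)"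
    by auto
qed

lemma integrable_lebesgue_on_const: "integrable (lebesgue_on {a..b::real}) (\<lambda>t. c)"
  by (intro finite_measure.integrable_const finite_measure_lebesgue_on) simp

lemma L2_on_cong:
  fixes f g :: "real \<Rightarrow> 'a::euclidean_space"
  assumes "f \<in> L2_on S" "\<And>t. t \<in> S \<Longrightarrow> g t = f t"
  shows "g \<in> L2_on S"
proof -
  have eq: "g t = f t" if "t \<in> space (lebesgue_on S)" for t
    using that assms(2) by (simp add: space_restrict_space)
  have "g \<in> borel_measurable (lebesgue_on S)"
    using L2_on_measurable[OF assms(1)] by (subst measurable_cong[OF eq])
  moreover have "integrable (lebesgue_on S) (\<lambda>t. (norm (g t))\<^sup>2)"
    using L2_on_integrable_sq[OF assms(1)]
    by (rule Bochner_Integration.integrable_cong[THEN iffD1, rotated 2]) (simp_all add: eq)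
  ultimately show ?thesis by (rule L2_onI)
qed

lemma L2_on_const: "(\<lambda>t. c) \<in> L2_on {a..b}"
  by (auto intro!: L2_onI simp: integrable_lebesgue_on_const)

lemma L2_on_integrable:
  fixes f :: "real \<Rightarrow> 'a::euclidean_space"
  assumes f: "f \<in> L2_on {a..b}"
  shows "integrable (lebesgue_on {a..b}) f"
proof (rule Bochner_Integration.integrable_bound)
  show "integrable (lebesgue_on {a..b}) (\<lambda>t. 1 + (norm (f t))\<^sup>2)"
    using L2_on_integrable_sq[OF f] by (simp add: integrable_lebesgue_on_const)
  have "x \<le> 1 + x\<^sup>2" if "0 \<le> x" for x :: real
    using sum_squares_bound[of x 1] that by simp
  then show "AE t in lebesgue_on {a..b}. norm (f t) \<le> norm (1 + (norm (f t))\<^sup>2)" by auto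
qed (use L2_on_measurable[OF f] in simp)

lemma lebesgue_on_subset_restrict:
  assumes "T \<subseteq> S" "T \<in> sets lebesgue" "S \<in> sets lebesgue"
  shows "lebesgue_on T = restrict_space (lebesgue_on S) T"
  using assms by (subst restrict_restrict_space) (auto simp: Int_absorb1)

lemma integrable_lebesgue_on_iff:
  fixes f :: "real \<Rightarrow> 'a::euclidean_space"
  assumes "S \<in> sets lebesgue"
  shows "integrable (lebesgue_on S) f \<longleftrightarrow> integrable lebesgue (\<lambda>x. indicator S x *\<^sub>R f x)"
  using assms by (simp add: integrable_restrict_space)

lemma integrable_lebesgue_on_subset:
  fixes f :: "real \<Rightarrow> 'a::euclidean_space"
  assumes "integrable (lebesgue_on S) f" "T \<subseteq> S" "T \<in> sets lebesgue" "S \<in> sets lebesgue"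
  shows "integrable (lebesgue_on T) f"
proof -
  have "integrable lebesgue (\<lambda>x. indicator T x *\<^sub>R (indicator S x *\<^sub>R f x))"
    using assms
    by (intro integrable_mult_indicator[of T lebesgue "\<lambda>x. indicator S x *\<^sub>R f x"])
      (simp_all only: integrable_lebesgue_on_iff)
  also have "(\<lambda>x. indicator T x *\<^sub>R (indicator S x *\<^sub>R f x)) = (\<lambda>x. indicator T x *\<^sub>R f x)"
    using assms(2) by (intro ext) (auto simp: indicator_def)
  finally show ?thesis using assms(3) by (simp add: integrable_lebesgue_on_iff)
qed

lemma L2_on_subset:
  fixes f :: "real \<Rightarrow> 'a::euclidean_space"
  assumes f: "f \<in> L2_on S" and "T \<subseteq> S" "T \<in> sets lebesgue" "S \<in> sets lebesgue"
  shows "f \<in> L2_on T"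
proof (rule L2_onI)
  show "f \<in> borel_measurable (lebesgue_on T)"
    using L2_on_measurable[OF f] assms(2)
    by (subst lebesgue_on_subset_restrict[OF assms(2-4)]) (rule measurable_restrict_space1)
  show "integrable (lebesgue_on T) (\<lambda>t. (norm (f t))\<^sup>2)"
    using integrable_lebesgue_on_subset[OF L2_on_integrable_sq[OF f]] assms by auto
qed

lemma AE_lebesgue_on_subset:
  assumes "AE t in lebesgue_on S. P t" "T \<subseteq> S" "T \<in> sets lebesgue" "S \<in> sets lebesgue"
  shows "AE t in lebesgue_on T. P t"
proof -
  have "AE t in lebesgue. t \<in> S \<longrightarrow> P t"
    using assms(1,4) by (subst (asm) AE_restrict_space_iff) auto
  then have "AE t in lebesgue. t \<in> T \<longrightarrow> P t"
    by (rule AE_mp) (use assms(2) in auto)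
  then show ?thesis using assms(3) by (subst AE_restrict_space_iff) auto
qed

lemma integral_lebesgue_on_mono:
  fixes f :: "real \<Rightarrow> real"
  assumes "integrable (lebesgue_on S) f" "T \<subseteq> S" "T \<in> sets lebesgue" "S \<in> sets lebesgue"
    and "\<And>t. 0 \<le> f t"
  shows "(LINT t|lebesgue_on T. f t) \<le> (LINT t|lebesgue_on S. f t)"
proof -
  have 1: "integrable lebesgue (\<lambda>x. indicator S x *\<^sub>R f x)"
    using assms by (simp add: integrable_lebesgue_on_iff)
  have 2: "integrable lebesgue (\<lambda>x. indicator T x *\<^sub>R f x)"
    using integrable_lebesgue_on_subset[OF assms(1-4)] assms(3)
    by (simp add: integrable_lebesgue_on_iff)
  have "(LINT t|lebesgue. indicator T t *\<^sub>R f t) \<le> (LINT t|lebesgue. indicator S t *\<^sub>R f t)"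
    using assms(2,5) by (intro integral_mono 1 2) (auto simp: indicator_def)
  then show ?thesis using assms by (simp add: integral_restrict_space)
qed

lemma integral_lebesgue_on_append:
  fixes f :: "real \<Rightarrow> 'a::euclidean_space"
  assumes f: "integrable (lebesgue_on {a..c}) f" and "a \<le> b" "b \<le> c"
  shows "(LINT t|lebesgue_on {a..c}. f t) =
    (LINT t|lebesgue_on {a..b}. f t) + (LINT t|lebesgue_on {b..c}. f t)"
proof -
  have 1: "integrable (lebesgue_on {a..b}) f" "integrable (lebesgue_on {b..c}) f"
    using assms by (auto intro: integrable_lebesgue_on_subset[OF f])
  then have 2: "integrable lebesgue (\<lambda>x. indicator {a..b} x *\<^sub>R f x)"
      "integrable lebesgue (\<lambda>x. indicator {b..c} x *\<^sub>R f x)"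
    by (simp_all add: integrable_lebesgue_on_iff)
  have "(LINT t|lebesgue_on {a..c}. f t) = (LINT t|lebesgue. indicator {a..c} t *\<^sub>R f t)"
    by (simp add: integral_restrict_space)
  also have "\<dots> = (LINT t|lebesgue. indicator {a..b} t *\<^sub>R f t + indicator {b..c} t *\<^sub>R f t)"
  proof (rule integral_cong_AE)
    show "(\<lambda>t. indicator {a..c} t *\<^sub>R f t) \<in> borel_measurable lebesgue"
      using f by (simp add: integrable_lebesgue_on_iff borel_measurable_integrable)
    show "(\<lambda>t. indicator {a..b} t *\<^sub>R f t + indicator {b..c} t *\<^sub>R f t) \<in> borel_measurable lebesgue"
      using 2 by (intro borel_measurable_add) auto
    have "{b} \<in> null_sets lebesgue" by (simp add: null_sets_completionI)
    then have ae: "AE t in lebesgue. t \<notin> {b}" by (rule AE_not_in)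
    show "AE t in lebesgue. indicator {a..c} t *\<^sub>R f t = indicator {a..b} t *\<^sub>R f t + indicator {b..c} t *\<^sub>R f t"
      by (rule AE_mp[OF ae], rule AE_I2) (use assms(2,3) in \<open>auto simp: indicator_def\<close>)
  qed
  also have "\<dots> = (LINT t|lebesgue_on {a..b}. f t) + (LINT t|lebesgue_on {b..c}. f t)"
    using 2 by (simp add: integral_restrict_space)
  finally show ?thesis .
qed

lemma integral_linear_lebesgue_on:
  fixes K :: "'a::euclidean_space \<Rightarrow> 'b::euclidean_space"
  assumes "linear K" "integrable M f"
  shows "(LINT t|M. K (f t)) = K (LINT t|M. f t)"
  using assms by (intro integral_bounded_linear) (auto simp: linear_conv_bounded_linear)

lemma L2_loc_Icc: "0 \<le> T \<Longrightarrow> L2_loc {0..T} = L2_on {0..T}"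
  unfolding L2_loc_def by (auto intro: L2_on_subset)

lemma L2_loc_atLeast: "L2_loc {0..} = {f. \<forall>T\<ge>0. f \<in> L2_on {0..T}}"
proof -
  have "f \<in> L2_on {a..b}" if "\<forall>T\<ge>0. f \<in> L2_on {0..T}" "a \<le> b" "{a..b} \<subseteq> {0..}" 
    for f :: "real \<Rightarrow> 'a" and a b :: real
  proof -
    have "0 \<le> a" using that(2,3) by auto
    then show ?thesis using that(1)[rule_format, of b] that(2) by (auto intro: L2_on_subset[of f "{0..b}"])
  qed
  then show ?thesis unfolding L2_loc_def by auto
qed

lemma L2_loc_Pair_iff:
  fixes f :: "real \<Rightarrow> 'a::euclidean_space" and g :: "real \<Rightarrow> 'b::euclidean_space"
  shows "(\<lambda>t. (f t, g t)) \<in> L2_loc I \<longleftrightarrow> f \<in> L2_loc I \<and> g \<in> L2_loc I"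
proof -
  have "(\<lambda>t. (f t, g t)) \<in> L2_on S \<longleftrightarrow> f \<in> L2_on S \<and> g \<in> L2_on S" for S
    using L2_on_Pair[of f S g] L2_on_fst[of "\<lambda>t. (f t, g t)"] L2_on_snd[of "\<lambda>t. (f t, g t)"] by auto
  then show ?thesis unfolding L2_loc_def by auto
qed

text \<open>The elementary inequality \<open>a \<le> \<epsilon> + a\<^sup>2 / \<epsilon>\<close>, integrated; it replaces the Cauchy--Schwarz inequality.\<close>

lemma integral_norm_le_sq:
  fixes f :: "real \<Rightarrow> 'a::euclidean_space"
  assumes f: "f \<in> L2_on S" and "S \<in> lmeasurable" and e: "0 < \<epsilon>"
  shows "(LINT t|lebesgue_on S. norm (f t)) \<le>
    \<epsilon> * measure lebesgue S + (LINT t|lebesgue_on S. (norm (f t))\<^sup>2) / \<epsilon>"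
proof -
  interpret finite_measure "lebesgue_on S" by (rule finite_measure_lebesgue_on) fact
  have S: "S \<in> sets lebesgue" using assms(2) by (rule fmeasurableD)
  have le: "x \<le> \<epsilon> + x\<^sup>2 / \<epsilon>" if "0 \<le> x" for x :: real
  proof -
    have "x * \<epsilon> \<le> \<epsilon>\<^sup>2 + x\<^sup>2" using sum_squares_bound[of x \<epsilon>] mult_nonneg_nonneg[OF that less_imp_le[OF e]] by linarith
    then show ?thesis using e by (simp add: field_simps power2_eq_square)
  qed
  have int: "integrable (lebesgue_on S) (\<lambda>t. \<epsilon> + (norm (f t))\<^sup>2 / \<epsilon>)"
    using L2_on_integrable_sq[OF f] by simp
  have "(LINT t|lebesgue_on S. norm (f t)) \<le> (LINT t|lebesgue_on S. \<epsilon> + (norm (f t))\<^sup>2 / \<epsilon>)"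
  proof (rule integral_mono)
    show "integrable (lebesgue_on S) (\<lambda>t. norm (f t))"
      using L2_on_measurable[OF f] le by (intro Bochner_Integration.integrable_bound[OF int]) (auto simp: less_imp_le[OF e])
  qed (use int le in auto)
  also have "\<dots> = \<epsilon> * measure lebesgue S + (LINT t|lebesgue_on S. (norm (f t))\<^sup>2) / \<epsilon>"
    using L2_on_integrable_sq[OF f] S
    by (simp add: measure_restrict_space space_restrict_space)
  finally show ?thesis .
qed

section \<open>Indefinite integrals of square integrable functions\<close>

lemma integral_lebesgue_on_null_diff:
  fixes f :: "real \<Rightarrow> 'a::euclidean_space"
  assumes f: "integrable (lebesgue_on T) f" and ST: "S \<subseteq> T" "S \<in> sets lebesgue" "T \<in> sets lebesgue"
    and null: "T - S \<in> null_sets lebesgue"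
  shows "(LINT t|lebesgue_on S. f t) = (LINT t|lebesgue_on T. f t)"
proof -
  have 1: "integrable lebesgue (\<lambda>x. indicator S x *\<^sub>R f x)"
      "integrable lebesgue (\<lambda>x. indicator T x *\<^sub>R f x)"
    using f integrable_lebesgue_on_subset[OF f ST] ST by (simp_all add: integrable_lebesgue_on_iff)
  have "(LINT t|lebesgue. indicator S t *\<^sub>R f t) = (LINT t|lebesgue. indicator T t *\<^sub>R f t)"
  proof (rule integral_cong_AE)
    show "AE t in lebesgue. indicator S t *\<^sub>R f t = indicator T t *\<^sub>R f t"
      by (rule AE_mp[OF AE_not_in[OF null]], rule AE_I2) (use ST(1) in \<open>auto simp: indicator_def\<close>)
  qed (use 1 in auto)
  then show ?thesis using ST by (simp add: integral_restrict_space)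
qed

lemma finite_null_sets_lebesgue: "finite S \<Longrightarrow> S \<in> null_sets (lebesgue :: real measure)"
  by (simp add: finite_imp_null_set_lborel null_sets_completionI)

lemma integral_lebesgue_on_Ioo:
  fixes f :: "real \<Rightarrow> 'a::euclidean_space"
  assumes f: "integrable (lebesgue_on {a..b}) f"
  shows "(LINT t|lebesgue_on {a<..<b}. f t) = (LINT t|lebesgue_on {a..b}. f t)"
proof (rule integral_lebesgue_on_null_diff[OF f])
  have "{a..b} - {a<..<b} \<subseteq> {a, b}" by auto
  then show "{a..b} - {a<..<b} \<in> null_sets lebesgue"
    by (intro finite_null_sets_lebesgue) (auto intro: finite_subset)
qed auto

lemma integral_lebesgue_on_Ico:
  fixes f :: "real \<Rightarrow> 'a::euclidean_space"
  assumes f: "integrable (lebesgue_on {a..b}) f"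
  shows "(LINT t|lebesgue_on {a..<b}. f t) = (LINT t|lebesgue_on {a..b}. f t)"
proof (rule integral_lebesgue_on_null_diff[OF f])
  have "{a..b} - {a..<b} \<subseteq> {b}" by auto
  then show "{a..b} - {a..<b} \<in> null_sets lebesgue"
    by (intro finite_null_sets_lebesgue) (auto intro: finite_subset)
qed auto

lemma integral_lebesgue_on_singleton:
  fixes f :: "real \<Rightarrow> 'a::euclidean_space"
  shows "(LINT s|lebesgue_on {a}. f s) = 0"
proof -
  have "(LINT s|lebesgue_on {a}. f s) = (LINT s|lebesgue. indicator {a} s *\<^sub>R f s)"
    by (simp add: integral_restrict_space)
  also have "\<dots> = 0"
  proof (rule integral_eq_zero_AE)
    have "{a} \<in> null_sets lebesgue" by (rule finite_null_sets_lebesgue) simp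
    then have "AE s in lebesgue. s \<notin> {a}" by (rule AE_not_in)
    then show "AE s in lebesgue. indicator {a} s *\<^sub>R f s = 0" by eventually_elim simp
  qed
  finally show ?thesis .
qed

text \<open>
  With \<open>C = \<integral> |h|\<^sup>2\<close>, the increments of \<open>W\<close> over disjoint intervals of total length \<open>\<delta>\<close> sum to at most
  \<open>r \<delta> + C / r\<close> for every \<open>r > 0\<close>; a large \<open>r\<close> is chosen first, and then a small \<open>\<delta>\<close>.
\<close>

lemma abs_cont_on_indefinite_integral:
  fixes h :: "real \<Rightarrow> 'a::euclidean_space"
  assumes h: "h \<in> L2_on {a..b}"
    and W: "\<And>c d. a \<le> c \<Longrightarrow> c \<le> d \<Longrightarrow> d \<le> b \<Longrightarrow> W d - W c = (LINT s|lebesgue_on {c..d}. h s)"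
  shows "abs_cont_on {a..b} W"
  unfolding abs_cont_on_def
proof (intro allI impI)
  fix e :: real assume e: "0 < e"
  define C where "C = (LINT s|lebesgue_on {a..b}. (norm (h s))\<^sup>2)"
  have C: "0 \<le> C" by (simp add: C_def)
  define r where "r = 2 * (C + 1) / e"
  have r: "0 < r" using e C by (simp add: r_def)
  show "\<exists>\<delta>>0. \<forall>D::(real \<times> real) set.
        finite D \<longrightarrow>
        (\<forall>(a', b')\<in>D. a' \<le> b' \<and> {a'..b'} \<subseteq> {a..b}) \<longrightarrow>
        pairwise (\<lambda>(a, b) (c, d). disjnt {a<..<b} {c<..<d}) D \<longrightarrow>
        (\<Sum>(a, b)\<in>D. b - a) < \<delta> \<longrightarrow>
        (\<Sum>(a, b)\<in>D. norm (W b - W a)) < e"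
  proof (intro exI[of _ "e / (2 * r)"] conjI allI impI)
    show "0 < e / (2 * r)" using e r by simp
    fix D :: "(real \<times> real) set"
    assume D: "finite D" and sub: "\<forall>(a', b')\<in>D. a' \<le> b' \<and> {a'..b'} \<subseteq> {a..b}"
      and disj: "pairwise (\<lambda>(a, b) (c, d). disjnt {a<..<b} {c<..<d}) D"
      and small: "(\<Sum>(a, b)\<in>D. b - a) < e / (2 * r)"
    have ab: "a \<le> fst p" "fst p \<le> snd p" "snd p \<le> b" if "p \<in> D" for p
      using sub that by force+
    let ?S = "\<lambda>p::real \<times> real. {fst p<..<snd p}"
    have L2: "h \<in> L2_on (?S p)" "h \<in> L2_on {fst p..snd p}" if "p \<in> D" for p
      using ab[OF that] by (auto intro!: L2_on_subset[OF h])
    have le: "norm (W (snd p) - W (fst p)) \<le>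
        r * (snd p - fst p) + (LINT s|lebesgue_on (?S p). (norm (h s))\<^sup>2) / r" if p: "p \<in> D" for p
    proof -
      have "norm (W (snd p) - W (fst p)) = norm (LINT s|lebesgue_on (?S p). h s)"
        using W[of "fst p" "snd p"] ab[OF p] integral_lebesgue_on_Ioo[OF L2_on_integrable[OF L2(2)[OF p]]] by simp
      also have "\<dots> \<le> (LINT s|lebesgue_on (?S p). norm (h s))" by (rule integral_norm_bound)
      also have "\<dots> \<le> r * measure lebesgue (?S p) + (LINT s|lebesgue_on (?S p). (norm (h s))\<^sup>2) / r"
        by (intro integral_norm_le_sq L2 p r) simp
      finally show ?thesis using ab[OF p] by simp
    qed
    have int: "integrable lebesgue (\<lambda>s. indicator (?S p) s *\<^sub>R (norm (h s))\<^sup>2)" if p: "p \<in> D" for p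
      using L2_on_integrable_sq[OF L2(1)[OF p]] by (subst (asm) integrable_lebesgue_on_iff) auto
    have "(\<Sum>p\<in>D. LINT s|lebesgue_on (?S p). (norm (h s))\<^sup>2) =
        (\<Sum>p\<in>D. LINT s|lebesgue. indicator (?S p) s *\<^sub>R (norm (h s))\<^sup>2)"
      by (simp add: integral_restrict_space)
    also have "\<dots> = (LINT s|lebesgue. (\<Sum>p\<in>D. indicator (?S p) s *\<^sub>R (norm (h s))\<^sup>2))"
      using int by (intro Bochner_Integration.integral_sum[symmetric]) auto
    also have "\<dots> \<le> (LINT s|lebesgue. indicator {a..b} s *\<^sub>R (norm (h s))\<^sup>2)"
    proof (rule integral_mono)
      show "integrable lebesgue (\<lambda>s. \<Sum>p\<in>D. indicator (?S p) s *\<^sub>R (norm (h s))\<^sup>2)"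
        using int by (intro Bochner_Integration.integrable_sum) auto
      show "integrable lebesgue (\<lambda>s. indicator {a..b} s *\<^sub>R (norm (h s))\<^sup>2)"
        using L2_on_integrable_sq[OF h] by (subst (asm) integrable_lebesgue_on_iff) auto
      fix s
      have "(\<Sum>p\<in>D. indicator (?S p) s :: real) \<le> indicator {a..b} s"
      proof (cases "\<exists>p\<in>D. s \<in> ?S p")
        case True
        then obtain p where p: "p \<in> D" "s \<in> ?S p" by blast
        have "indicator (?S p') s = (if p' = p then 1 else 0 :: real)" if "p' \<in> D" for p'
        proof (cases "p' = p")
          case False
          then have "disjnt (?S p') (?S p)"
            using disj that p(1) unfolding pairwise_def by (auto simp: split_beta)
          then show ?thesis using False p(2) by (auto simp: disjnt_def indicator_def)
        qed (use p in auto)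
        then have "(\<Sum>p\<in>D. indicator (?S p) s :: real) = (\<Sum>p'\<in>D. if p' = p then 1 else 0)"
          by (intro sum.cong) auto
        also have "\<dots> = 1" using D p(1) by (simp add: sum.delta)
        also have "\<dots> = indicator {a..b} s" using ab[OF p(1)] p(2) by (auto simp: indicator_def)
        finally show ?thesis by simp
      next
        case False
        then have "(\<Sum>p\<in>D. indicator (?S p) s :: real) = 0" by (intro sum.neutral) (auto simp: indicator_def)
        then show ?thesis by simp
      qed
      then show "(\<Sum>p\<in>D. indicator (?S p) s *\<^sub>R (norm (h s))\<^sup>2) \<le> indicator {a..b} s *\<^sub>R (norm (h s))\<^sup>2"
        by (simp add: mult_right_mono flip: sum_distrib_right)
    qed
    also have "\<dots> = C" by (simp add: C_def integral_restrict_space)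
    finally have sumC: "(\<Sum>p\<in>D. LINT s|lebesgue_on (?S p). (norm (h s))\<^sup>2) \<le> C" .
    have "(\<Sum>(a, b)\<in>D. norm (W b - W a)) \<le>
        (\<Sum>p\<in>D. r * (snd p - fst p) + (LINT s|lebesgue_on (?S p). (norm (h s))\<^sup>2) / r)"
      unfolding split_beta by (rule sum_mono) (rule le)
    also have "\<dots> = r * (\<Sum>(a, b)\<in>D. b - a) + (\<Sum>p\<in>D. LINT s|lebesgue_on (?S p). (norm (h s))\<^sup>2) / r"
      by (simp add: sum.distrib sum_distrib_left sum_divide_distrib split_beta)
    also have "\<dots> < r * (e / (2 * r)) + (C + 1) / r"
      using small sumC r by (intro add_strict_mono mult_strict_left_mono divide_strict_right_mono) auto
    also have "\<dots> = e"
    proof -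
      have "C + 1 = r * e / 2" using e by (simp add: r_def)
      then have "(C + 1) / r = e / 2" using r by (simp only: times_divide_eq_right divide_divide_eq_left) simp
      moreover have "r * (e / (2 * r)) = e / 2" using r by simp
      ultimately show ?thesis by linarith
    qed
    finally show "(\<Sum>(a, b)\<in>D. norm (W b - W a)) < e" .
  qed
qed

text \<open>
  The integrand is determined almost everywhere by its indefinite integral, since it is the limit of
  its averages over \<open>[x, x + h]\<close> at almost every \<open>x\<close>.
\<close>

lemma AE_zero_of_indefinite_integral_zero:
  fixes k :: "real \<Rightarrow> 'a::euclidean_space"
  assumes k: "integrable (lebesgue_on {0..T}) k"
    and zero: "\<And>t. 0 \<le> t \<Longrightarrow> t \<le> T \<Longrightarrow> (LINT s|lebesgue_on {0..t}. k s) = 0"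
  shows "AE t in lebesgue_on {0..T}. k t = 0"
proof -
  define f where "f = (\<lambda>x. indicator {0..T} x *\<^sub>R k x)"
  have f: "integrable lebesgue f" using k by (simp add: f_def integrable_lebesgue_on_iff)
  have fS: "integrable (lebesgue_on {a..b}) f" for a b
    using integrable_mult_indicator[OF _ f, of "{a..b}"] by (simp add: integrable_lebesgue_on_iff)
  have fi: "f integrable_on cbox a b" for a b
    using fS[of a b] by (simp add: integrable_on_lebesgue_on)
  obtain N where N: "negligible N"
    and lim: "\<And>x e. x \<notin> N \<Longrightarrow> 0 < e \<Longrightarrow> \<exists>d>0. \<forall>h. 0 < h \<and> h < d \<longrightarrow>
       norm (integral (cbox x (x + h *\<^sub>R One)) f /\<^sub>R h ^ DIM(real) - f x) < e"
    using integrable_ccontinuous_explicit[OF fi] by metis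
  have kz: "k x = 0" if x: "0 \<le> x" "x < T" "x \<notin> N" for x
  proof (rule ccontr)
    assume "k x \<noteq> 0"
    then have "0 < norm (f x)" using x by (simp add: f_def)
    from lim[OF x(3) this] obtain d where d: "0 < d"
      "\<And>h. 0 < h \<Longrightarrow> h < d \<Longrightarrow> norm (integral (cbox x (x + h *\<^sub>R One)) f /\<^sub>R h ^ DIM(real) - f x) < norm (f x)"
      by blast
    define h where "h = min (d / 2) (T - x)"
    have h: "0 < h" "h < d" "x + h \<le> T" using d(1) x by (auto simp: h_def)
    have "integral {x..x + h} f = (LINT s|lebesgue_on {x..x + h}. f s)"
      using fS by (simp add: lebesgue_integral_eq_integral)
    also have "\<dots> = (LINT s|lebesgue_on {x..x + h}. k s)"
      using h x by (intro Bochner_Integration.integral_cong) (auto simp: f_def space_restrict_space)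
    also have "\<dots> = (LINT s|lebesgue_on {0..x + h}. k s) - (LINT s|lebesgue_on {0..x}. k s)"
      using integral_lebesgue_on_append[of 0 "x + h" k x] integrable_lebesgue_on_subset[OF k, of "{0..x + h}"] h x
      by simp
    also have "\<dots> = 0" using zero[of x] zero[of "x + h"] h x by simp
    finally have "integral {x..x + h} f = 0" .
    then show False using d(2)[of h] h by simp
  qed
  have "N \<union> {T} \<in> null_sets lebesgue"
    using N finite_null_sets_lebesgue[of "{T}"] by (auto simp: negligible_iff_null_sets)
  from AE_not_in[OF this] have "AE t in lebesgue. t \<in> {0..T} \<longrightarrow> k t = 0"
    by (rule AE_mp) (use kz in \<open>auto intro!: AE_I2\<close>)
  then show ?thesis by (subst AE_restrict_space_iff) auto
qed

subsection \<open>Integration by parts\<close>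

text \<open>
  By Fubini's theorem: the square \<open>[0, t]\<^sup>2\<close> is split into the triangles \<open>s \<le> r\<close> and \<open>r < s\<close>.
\<close>

lemma integral_by_parts_real:
  fixes a b :: "real \<Rightarrow> real"
  assumes a: "integrable (lebesgue_on {0..t}) a" and b: "integrable (lebesgue_on {0..t}) b"
  shows "integrable (lebesgue_on {0..t}) (\<lambda>r. a r * (LINT s|lebesgue_on {0..r}. b s))"
    and "(LINT r|lebesgue_on {0..t}. a r * (LINT s|lebesgue_on {0..r}. b s)) +
      (LINT r|lebesgue_on {0..t}. b r * (LINT s|lebesgue_on {0..r}. a s)) =
      (LINT r|lebesgue_on {0..t}. a r) * (LINT r|lebesgue_on {0..t}. b r)"
proof -
  let ?M = "lebesgue_on {0..t}"
  interpret M: finite_measure ?M by (rule finite_measure_lebesgue_on) simp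
  interpret pair_sigma_finite ?M ?M ..
  have [measurable]: "a \<in> borel_measurable ?M" "b \<in> borel_measurable ?M"
    using a b by auto
  have id: "(\<lambda>x. x) \<in> borel_measurable ?M"
    using measurable_restrict_space1[of "\<lambda>x. x" lebesgue borel "{0..t}"] by (simp add: measurable_completion)
  have [measurable]: "fst \<in> borel_measurable (?M \<Otimes>\<^sub>M ?M)" "snd \<in> borel_measurable (?M \<Otimes>\<^sub>M ?M)"
    using measurable_compose[OF measurable_fst id, of ?M] measurable_compose[OF measurable_snd id, of ?M]
    by simp_all
  have ab: "integrable (?M \<Otimes>\<^sub>M ?M) (\<lambda>p. a (fst p) * b (snd p))"
  proof (rule Fubini_integrable)
    show "integrable ?M (\<lambda>x. LINT y|?M. norm (a (fst (x, y)) * b (snd (x, y))))"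
      using a by (simp add: abs_mult)
  qed (use b in auto)
  have dom: "integrable (?M \<Otimes>\<^sub>M ?M) (\<lambda>p. (if P (fst p) (snd p) then 1 else 0) * (a (fst p) * b (snd p)))"
    if "Measurable.pred (?M \<Otimes>\<^sub>M ?M) (\<lambda>p. P (fst p) (snd p))" for P :: "real \<Rightarrow> real \<Rightarrow> bool"
    using that by (intro Bochner_Integration.integrable_bound[OF ab]) auto
  have le: "integrable (?M \<Otimes>\<^sub>M ?M) (\<lambda>p. (if snd p \<le> fst p then 1 else 0) * (a (fst p) * b (snd p)))"
   and lt: "integrable (?M \<Otimes>\<^sub>M ?M) (\<lambda>p. (if fst p < snd p then 1 else 0) * (a (fst p) * b (snd p)))"
    by (rule dom; measurable)+
  have inner: "(LINT s|?M. (if s \<le> r then 1 else 0) * (c * g s)) = c * (LINT s|lebesgue_on {0..r}. g s)"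
    if "r \<in> {0..t}" for r c and g :: "real \<Rightarrow> real"
  proof -
    have "(LINT s|?M. (if s \<le> r then 1 else 0) * (c * g s)) =
       (LINT s|lebesgue. indicator {0..t} s * ((if s \<le> r then 1 else 0) * (c * g s)))"
      by (simp add: integral_restrict_space)
    also have "\<dots> = (LINT s|lebesgue. c * (indicator {0..r} s * g s))"
      using that by (intro Bochner_Integration.integral_cong) (auto simp: indicator_def)
    also have "\<dots> = c * (LINT s|lebesgue_on {0..r}. g s)"
      by (simp add: integral_restrict_space)
    finally show ?thesis .
  qed
  have inner': "(LINT s|?M. (if s < r then 1 else 0) * (g s * c)) = c * (LINT s|lebesgue_on {0..r}. g s)"
    if r: "r \<in> {0..t}" and g: "integrable ?M g" for r c and g :: "real \<Rightarrow> real"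
  proof -
    have "(LINT s|?M. (if s < r then 1 else 0) * (g s * c)) =
       (LINT s|lebesgue. indicator {0..t} s * ((if s < r then 1 else 0) * (g s * c)))"
      by (simp add: integral_restrict_space)
    also have "\<dots> = (LINT s|lebesgue. c * (indicator {0..<r} s * g s))"
      using r by (intro Bochner_Integration.integral_cong) (auto simp: indicator_def)
    also have "\<dots> = c * (LINT s|lebesgue_on {0..<r}. g s)"
      by (simp add: integral_restrict_space)
    also have "(LINT s|lebesgue_on {0..<r}. g s) = (LINT s|lebesgue_on {0..r}. g s)"
      using r by (intro integral_lebesgue_on_Ico integrable_lebesgue_on_subset[OF g]) auto
    finally show ?thesis .
  qed
  have "(LINT r|?M. a r * (LINT s|lebesgue_on {0..r}. b s)) =
      (LINT r|?M. LINT s|?M. (if s \<le> r then 1 else 0) * (a r * b s))"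
    using inner by (intro Bochner_Integration.integral_cong) (auto simp: space_restrict_space)
  also have "\<dots> = (LINT p|(?M \<Otimes>\<^sub>M ?M). (if snd p \<le> fst p then 1 else 0) * (a (fst p) * b (snd p)))"
    using integral_fst'[OF le] by simp
  finally have A: "(LINT r|?M. a r * (LINT s|lebesgue_on {0..r}. b s)) =
      (LINT p|(?M \<Otimes>\<^sub>M ?M). (if snd p \<le> fst p then 1 else 0) * (a (fst p) * b (snd p)))" .
  have "(LINT s|?M. b s * (LINT r|lebesgue_on {0..s}. a r)) =
      (LINT s|?M. LINT r|?M. (if r < s then 1 else 0) * (a r * b s))"
    using inner'[OF _ a] by (intro Bochner_Integration.integral_cong) (auto simp: space_restrict_space)
  also have "\<dots> = (LINT p|(?M \<Otimes>\<^sub>M ?M). (if fst p < snd p then 1 else 0) * (a (fst p) * b (snd p)))"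
    using integral_snd[of "\<lambda>r s. (if r < s then 1 else 0) * (a r * b s)"] lt
    by (simp only: case_prod_unfold)
  finally have B: "(LINT s|?M. b s * (LINT r|lebesgue_on {0..s}. a r)) =
      (LINT p|(?M \<Otimes>\<^sub>M ?M). (if fst p < snd p then 1 else 0) * (a (fst p) * b (snd p)))" .
  have "(LINT r|?M. a r * (LINT s|lebesgue_on {0..r}. b s)) + (LINT s|?M. b s * (LINT r|lebesgue_on {0..s}. a r))
     = (LINT p|(?M \<Otimes>\<^sub>M ?M). (if snd p \<le> fst p then 1 else 0) * (a (fst p) * b (snd p)) +
           (if fst p < snd p then 1 else 0) * (a (fst p) * b (snd p)))"
    unfolding A B using le lt by simp
  also have "\<dots> = (LINT p|(?M \<Otimes>\<^sub>M ?M). a (fst p) * b (snd p))"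
    by (intro Bochner_Integration.integral_cong) auto
  also have "\<dots> = (LINT r|?M. LINT s|?M. a r * b s)"
    using integral_fst'[OF ab] by simp
  finally show "(LINT r|?M. a r * (LINT s|lebesgue_on {0..r}. b s)) +
      (LINT r|?M. b r * (LINT s|lebesgue_on {0..r}. a s)) = (LINT r|?M. a r) * (LINT r|?M. b r)"
    by simp
  have "integrable ?M (\<lambda>r. LINT s|?M. (if s \<le> r then 1 else 0) * (a r * b s))"
    using integrable_fst'[OF le] by simp
  moreover have "integrable ?M (\<lambda>r. LINT s|?M. (if s \<le> r then 1 else 0) * (a r * b s)) \<longleftrightarrow>
     integrable ?M (\<lambda>r. a r * (LINT s|lebesgue_on {0..r}. b s))"
    using inner by (intro Bochner_Integration.integrable_cong) (auto simp: space_restrict_space)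
  ultimately show "integrable ?M (\<lambda>r. a r * (LINT s|lebesgue_on {0..r}. b s))" by simp
qed

lemma integral_by_parts_inner:
  fixes f g :: "real \<Rightarrow> 'a::euclidean_space"
  assumes f: "integrable (lebesgue_on {0..t}) f" and g: "integrable (lebesgue_on {0..t}) g" and "0 \<le> t"
    and X: "\<And>s. 0 \<le> s \<Longrightarrow> s \<le> t \<Longrightarrow> X s = X 0 + (LINT r|lebesgue_on {0..s}. f r)"
    and Y: "\<And>s. 0 \<le> s \<Longrightarrow> s \<le> t \<Longrightarrow> Y s = Y 0 + (LINT r|lebesgue_on {0..s}. g r)"
  shows "integrable (lebesgue_on {0..t}) (\<lambda>s. f s \<bullet> Y s)"
    and "(LINT s|lebesgue_on {0..t}. f s \<bullet> Y s) + (LINT s|lebesgue_on {0..t}. X s \<bullet> g s) =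
      X t \<bullet> Y t - X 0 \<bullet> Y 0"
proof -
  have comp: "integrable (lebesgue_on {0..t}) (\<lambda>s. u s \<bullet> Z s) \<and>
     (LINT s|lebesgue_on {0..t}. u s \<bullet> Z s) = (LINT s|lebesgue_on {0..t}. u s) \<bullet> Z 0 +
       (\<Sum>b\<in>Basis. LINT s|lebesgue_on {0..t}. (u s \<bullet> b) * (LINT r|lebesgue_on {0..s}. v r \<bullet> b))"
    if u: "integrable (lebesgue_on {0..t}) u" and v: "integrable (lebesgue_on {0..t}) v"
      and Z: "\<And>s. 0 \<le> s \<Longrightarrow> s \<le> t \<Longrightarrow> Z s = Z 0 + (LINT r|lebesgue_on {0..s}. v r)"
    for u v Z :: "real \<Rightarrow> 'a"
  proof -
    have eq: "u s \<bullet> Z s = u s \<bullet> Z 0 + (\<Sum>b\<in>Basis. (u s \<bullet> b) * (LINT r|lebesgue_on {0..s}. v r \<bullet> b))"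
      if s: "s \<in> {0..t}" for s
    proof -
      have vs: "integrable (lebesgue_on {0..s}) v"
        using s by (intro integrable_lebesgue_on_subset[OF v]) auto
      have "u s \<bullet> Z s = u s \<bullet> Z 0 + u s \<bullet> (LINT r|lebesgue_on {0..s}. v r)"
        using Z[of s] s by (simp add: inner_add_right)
      also have "u s \<bullet> (LINT r|lebesgue_on {0..s}. v r) =
          (\<Sum>b\<in>Basis. (u s \<bullet> b) * ((LINT r|lebesgue_on {0..s}. v r) \<bullet> b))"
        by (rule euclidean_inner)
      also have "\<dots> = (\<Sum>b\<in>Basis. (u s \<bullet> b) * (LINT r|lebesgue_on {0..s}. v r \<bullet> b))"
        using vs by (simp add: integral_inner_left)
      finally show ?thesis .
    qed
    have int: "integrable (lebesgue_on {0..t}) (\<lambda>s. (u s \<bullet> b) * (LINT r|lebesgue_on {0..s}. v r \<bullet> b))" for b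
      using u v by (intro integral_by_parts_real(1)) auto
    have "integrable (lebesgue_on {0..t}) (\<lambda>s. u s \<bullet> Z s) \<longleftrightarrow> integrable (lebesgue_on {0..t})
        (\<lambda>s. u s \<bullet> Z 0 + (\<Sum>b\<in>Basis. (u s \<bullet> b) * (LINT r|lebesgue_on {0..s}. v r \<bullet> b)))"
      using eq by (intro Bochner_Integration.integrable_cong) (auto simp: space_restrict_space)
    moreover have "integrable (lebesgue_on {0..t})
        (\<lambda>s. u s \<bullet> Z 0 + (\<Sum>b\<in>Basis. (u s \<bullet> b) * (LINT r|lebesgue_on {0..s}. v r \<bullet> b)))"
      using u int by (intro Bochner_Integration.integrable_add Bochner_Integration.integrable_sum) auto
    moreover have "(LINT s|lebesgue_on {0..t}. u s \<bullet> Z s) = (LINT s|lebesgue_on {0..t}. u s \<bullet> Z 0 +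
         (\<Sum>b\<in>Basis. (u s \<bullet> b) * (LINT r|lebesgue_on {0..s}. v r \<bullet> b)))"
      using eq by (intro Bochner_Integration.integral_cong) (auto simp: space_restrict_space)
    moreover have "\<dots> = (LINT s|lebesgue_on {0..t}. u s) \<bullet> Z 0 +
       (\<Sum>b\<in>Basis. LINT s|lebesgue_on {0..t}. (u s \<bullet> b) * (LINT r|lebesgue_on {0..s}. v r \<bullet> b))"
      using u int by (simp add: Bochner_Integration.integral_sum)
    ultimately show ?thesis by simp
  qed
  show "integrable (lebesgue_on {0..t}) (\<lambda>s. f s \<bullet> Y s)" using comp[OF f g Y] by simp
  let ?f = "LINT s|lebesgue_on {0..t}. f s" and ?g = "LINT s|lebesgue_on {0..t}. g s"
  have sum: "(\<Sum>b\<in>Basis. LINT s|lebesgue_on {0..t}. (f s \<bullet> b) * (LINT r|lebesgue_on {0..s}. g r \<bullet> b)) +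
     (\<Sum>b\<in>Basis. LINT s|lebesgue_on {0..t}. (g s \<bullet> b) * (LINT r|lebesgue_on {0..s}. f r \<bullet> b)) = ?f \<bullet> ?g"
  proof -
    have "?f \<bullet> ?g = (\<Sum>b\<in>Basis. (?f \<bullet> b) * (?g \<bullet> b))" by (rule euclidean_inner)
    also have "\<dots> = (\<Sum>b\<in>Basis. (LINT s|lebesgue_on {0..t}. f s \<bullet> b) * (LINT s|lebesgue_on {0..t}. g s \<bullet> b))"
      using f g by (simp add: integral_inner_left)
    also have "\<dots> = (\<Sum>b\<in>Basis. (LINT s|lebesgue_on {0..t}. (f s \<bullet> b) * (LINT r|lebesgue_on {0..s}. g r \<bullet> b)) +
        (LINT s|lebesgue_on {0..t}. (g s \<bullet> b) * (LINT r|lebesgue_on {0..s}. f r \<bullet> b)))"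
      using f g by (intro sum.cong refl integral_by_parts_real(2)[symmetric]) auto
    finally show ?thesis by (simp add: sum.distrib)
  qed
  have "(LINT s|lebesgue_on {0..t}. f s \<bullet> Y s) + (LINT s|lebesgue_on {0..t}. g s \<bullet> X s) =
      ?f \<bullet> Y 0 + ?g \<bullet> X 0 + ?f \<bullet> ?g"
    using comp[OF f g Y] comp[OF g f X] sum by simp
  also have "\<dots> = X t \<bullet> Y t - X 0 \<bullet> Y 0"
    using X[of t] Y[of t] \<open>0 \<le> t\<close> by (simp add: inner_add_left inner_add_right inner_commute)
  finally show "(LINT s|lebesgue_on {0..t}. f s \<bullet> Y s) + (LINT s|lebesgue_on {0..t}. X s \<bullet> g s) =
      X t \<bullet> Y t - X 0 \<bullet> Y 0"
    by (simp add: inner_commute)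
qed

section \<open>Translation, reflection and concatenation\<close>

lemma L2_on_indicator_iff:
  fixes f :: "real \<Rightarrow> 'a::euclidean_space"
  assumes "S \<in> sets lebesgue"
  shows "f \<in> L2_on S \<longleftrightarrow> (\<lambda>x. indicator S x *\<^sub>R f x) \<in> L2_on UNIV"
proof -
  have "(\<lambda>x. indicator S x *\<^sub>R (norm (f x))\<^sup>2) = (\<lambda>x. (norm (indicator S x *\<^sub>R f x))\<^sup>2)"
    by (auto simp: indicator_def fun_eq_iff)
  then show ?thesis using assms
    by (simp add: L2_on_def integrable_lebesgue_on_iff borel_measurable_restrict_space_iff
      lebesgue_on_UNIV_eq)
qed

text \<open>Translations (\<open>c = 1\<close>) and reflections (\<open>c = -1\<close>) of the time axis.\<close>

context
  fixes a c :: real and S T :: "real set"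
  assumes c: "\<bar>c\<bar> = 1" and S: "S \<in> sets lebesgue" and T: "T = (\<lambda>x. a + c * x) -` S"
begin

lemma distr_lebesgue_affine: "distr lebesgue lebesgue (\<lambda>x. a + c * x) = lebesgue"
proof -
  have "c \<noteq> 0" using c by auto
  then have "lebesgue = density (distr lebesgue lebesgue (\<lambda>x. a + c * x)) (\<lambda>_. ennreal (abs c))"
    by (rule lebesgue_real_affine)
  also have "\<dots> = distr lebesgue lebesgue (\<lambda>x. a + c * x)" by (simp add: c density_1)
  finally show ?thesis by simp
qed

lemma measurable_lebesgue_affine: "(\<lambda>x. a + c * x) \<in> lebesgue \<rightarrow>\<^sub>M lebesgue"
  using lebesgue_affine_measurable[where c= "\<lambda>x::real. c" and t = a] c by fastforce

lemma sets_lebesgue_affine: "T \<in> sets lebesgue"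
  using measurable_sets[OF measurable_lebesgue_affine S] by (simp add: T)

lemma indicator_affine: "indicator T x = (indicator S (a + c * x) :: real)"
  by (auto simp: T indicator_def)

lemma integrable_affine:
  fixes f :: "real \<Rightarrow> 'a::euclidean_space"
  assumes f: "integrable (lebesgue_on S) f"
  shows "integrable (lebesgue_on T) (\<lambda>x. f (a + c * x))"
    and "(LINT x|lebesgue_on T. f (a + c * x)) = (LINT x|lebesgue_on S. f x)"
proof -
  have f': "integrable lebesgue (\<lambda>x. indicator S x *\<^sub>R f x)"
    using f S by (simp add: integrable_lebesgue_on_iff)
  have "integrable (distr lebesgue lebesgue (\<lambda>x. a + c * x)) (\<lambda>x. indicator S x *\<^sub>R f x)"
    using f' by (simp add: distr_lebesgue_affine)
  then have "integrable lebesgue (\<lambda>x. indicator S (a + c * x) *\<^sub>R f (a + c * x))"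
    by (rule integrable_distr[OF measurable_lebesgue_affine])
  then show "integrable (lebesgue_on T) (\<lambda>x. f (a + c * x))"
    by (simp add: integrable_lebesgue_on_iff sets_lebesgue_affine indicator_affine)
  have "(LINT x|lebesgue_on S. f x) = (LINT x|distr lebesgue lebesgue (\<lambda>x. a + c * x). indicator S x *\<^sub>R f x)"
    using S by (simp add: distr_lebesgue_affine integral_restrict_space)
  also have "\<dots> = (LINT x|lebesgue. indicator S (a + c * x) *\<^sub>R f (a + c * x))"
    using f' by (intro integral_distr measurable_lebesgue_affine) auto
  also have "\<dots> = (LINT x|lebesgue_on T. f (a + c * x))"
    using sets_lebesgue_affine by (simp add: integral_restrict_space indicator_affine)
  finally show "(LINT x|lebesgue_on T. f (a + c * x)) = (LINT x|lebesgue_on S. f x)" by simp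
qed

lemma L2_on_affine:
  fixes f :: "real \<Rightarrow> 'a::euclidean_space"
  assumes f: "f \<in> L2_on S"
  shows "(\<lambda>x. f (a + c * x)) \<in> L2_on T"
proof (rule L2_onI)
  have "(\<lambda>x. indicator S x *\<^sub>R f x) \<in> borel_measurable lebesgue"
    using L2_on_measurable[OF f] S by (simp add: borel_measurable_restrict_space_iff)
  from measurable_compose[OF measurable_lebesgue_affine this]
  show "(\<lambda>x. f (a + c * x)) \<in> borel_measurable (lebesgue_on T)"
    using sets_lebesgue_affine by (simp add: borel_measurable_restrict_space_iff indicator_affine)
qed (rule integrable_affine(1)[OF L2_on_integrable_sq[OF f]])

lemma AE_affine:
  assumes P: "AE x in lebesgue_on S. P x"
  shows "AE x in lebesgue_on T. P (a + c * x)"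
proof -
  have "AE x in lebesgue. x \<in> S \<longrightarrow> P x"
    using P S by (subst (asm) AE_restrict_space_iff) auto
  then obtain N where N: "N \<in> null_sets lebesgue" "{x. \<not> (x \<in> S \<longrightarrow> P x)} \<subseteq> N"
    by (auto simp: eventually_ae_filter)
  let ?N = "(\<lambda>x. a + c * x) -` N"
  have "emeasure lebesgue N = emeasure (distr lebesgue lebesgue (\<lambda>x. a + c * x)) N"
    by (simp add: distr_lebesgue_affine)
  also have "\<dots> = emeasure lebesgue ?N"
    using N by (subst emeasure_distr) (auto intro: measurable_lebesgue_affine)
  finally have "?N \<in> null_sets lebesgue"
    using N measurable_sets[OF measurable_lebesgue_affine, of N] by (auto intro!: null_setsI)
  then have "AE x in lebesgue. x \<notin> ?N" by (rule AE_not_in)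
  then have "AE x in lebesgue. x \<in> T \<longrightarrow> P (a + c * x)"
    by (rule AE_mp, intro AE_I2) (use N(2) T in auto)
  then show ?thesis using sets_lebesgue_affine by (subst AE_restrict_space_iff) auto
qed

end

lemmas integrable_shift = integrable_affine[of 1, simplified]
  and L2_on_shift = L2_on_affine[of 1, simplified]
  and AE_shift = AE_affine[of 1, simplified]

text \<open>The function \<open>f\<close> up to time \<open>s\<close>, followed by \<open>g\<close> started at time \<open>s\<close>.\<close>

definition concat_at :: "real \<Rightarrow> (real \<Rightarrow> 'a) \<Rightarrow> (real \<Rightarrow> 'a) \<Rightarrow> real \<Rightarrow> 'a" where
  "concat_at s f g t = (if t < s then f t else g (t - s))"

lemma comp_concat_at: "K (concat_at s f g t) = concat_at s (\<lambda>t. K (f t)) (\<lambda>t. K (g t)) t"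
  by (simp add: concat_at_def)

lemma indicator_concat_at:
  fixes f g :: "real \<Rightarrow> 'a::real_vector"
  assumes "0 \<le> s" "0 \<le> r"
  shows "indicator {0..s + r} t *\<^sub>R concat_at s f g t =
    indicator {0..<s} t *\<^sub>R f t + indicator {s..s + r} t *\<^sub>R g (t - s)"
  using assms by (auto simp: indicator_def concat_at_def)

lemma Ico_subset_Icc: "{a..<b} \<subseteq> {a..b::real}"
  by auto

lemma integral_concat_at:
  fixes f g :: "real \<Rightarrow> 'a::euclidean_space"
  assumes f: "integrable (lebesgue_on {0..s}) f" and g: "integrable (lebesgue_on {0..r}) g"
    and "0 \<le> s" "0 \<le> r"
  shows "(LINT t|lebesgue_on {0..s + r}. concat_at s f g t) =
      (LINT t|lebesgue_on {0..s}. f t) + (LINT t|lebesgue_on {0..r}. g t)"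
proof -
  have T: "{s..s + r} = (\<lambda>x. -s + x) -` {0..r}" by auto
  have f': "integrable lebesgue (\<lambda>t. indicator {0..<s} t *\<^sub>R f t)"
    using integrable_lebesgue_on_subset[OF f Ico_subset_Icc] by (simp add: integrable_lebesgue_on_iff)
  have g0: "integrable (lebesgue_on {s..s + r}) (\<lambda>t. g (t - s))"
    using integrable_shift(1)[OF _ T g] by simp
  then have g': "integrable lebesgue (\<lambda>t. indicator {s..s + r} t *\<^sub>R g (t - s))"
    by (simp add: integrable_lebesgue_on_iff)
  have "(LINT t|lebesgue_on {0..s + r}. concat_at s f g t) =
     (LINT t|lebesgue_on {0..<s}. f t) + (LINT t|lebesgue_on {s..s + r}. g (t - s))"
    using f' g' by (simp add: integral_restrict_space indicator_concat_at[OF assms(3,4)])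
  then show "(LINT t|lebesgue_on {0..s + r}. concat_at s f g t) =
      (LINT t|lebesgue_on {0..s}. f t) + (LINT t|lebesgue_on {0..r}. g t)"
    using integral_lebesgue_on_Ico[OF f] integrable_shift(2)[OF _ T g] by simp
qed

lemma L2_on_concat_at:
  fixes f g :: "real \<Rightarrow> 'a::euclidean_space"
  assumes f: "f \<in> L2_on {0..s}" and g: "g \<in> L2_on {0..r}" and "0 \<le> s" "0 \<le> r"
  shows "concat_at s f g \<in> L2_on {0..s + r}"
proof -
  have T: "{s..s + r} = (\<lambda>x. -s + x) -` {0..r}" by auto
  have "(\<lambda>t. indicator {0..<s} t *\<^sub>R f t) \<in> L2_on UNIV"
    using L2_on_subset[OF f Ico_subset_Icc] by (simp add: L2_on_indicator_iff[symmetric])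
  moreover have "(\<lambda>t. g (t - s)) \<in> L2_on {s..s + r}"
    using L2_on_shift[OF _ T g] by simp
  then have "(\<lambda>t. indicator {s..s + r} t *\<^sub>R g (t - s)) \<in> L2_on UNIV"
    by (simp add: L2_on_indicator_iff[symmetric])
  ultimately show ?thesis
    by (subst L2_on_indicator_iff) (simp_all only: indicator_concat_at[OF assms(3,4)] L2_on_add, simp)
qed

section \<open>Solutions of linear differential-algebraic equations\<close>

text \<open>
  Both equations at hand have the form \<open>d(E \<xi>)/dt = G \<xi>\<close> with linear maps \<open>E\<close> and \<open>G\<close>: take
  \<open>\<xi> = (q, u)\<close> for the dual equation and \<open>\<xi> = (x, f)\<close> for the primal one.  The absolutely
  continuous version \<open>W\<close> of \<open>E \<xi>\<close> is made part of the solution.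
\<close>

definition lin_sol :: "('e::euclidean_space \<Rightarrow> 'b::euclidean_space) \<Rightarrow> ('e \<Rightarrow> 'b) \<Rightarrow> real set \<Rightarrow>
    (real \<Rightarrow> 'e) \<Rightarrow> (real \<Rightarrow> 'b) \<Rightarrow> bool" where
  "lin_sol E G I \<xi> W \<longleftrightarrow> \<xi> \<in> L2_loc I \<and>
     (\<forall>t\<in>I. W t = W 0 + (LINT s|lebesgue_on {0..t}. G (\<xi> s))) \<and>
     (AE t in lebesgue_on I. W t = E (\<xi> t))"

lemma lin_sol_L2: "lin_sol E G I \<xi> W \<Longrightarrow> \<xi> \<in> L2_loc I"
  and lin_sol_eq: "lin_sol E G I \<xi> W \<Longrightarrow> t \<in> I \<Longrightarrow> W t = W 0 + (LINT s|lebesgue_on {0..t}. G (\<xi> s))"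
  and lin_sol_AE: "lin_sol E G I \<xi> W \<Longrightarrow> AE t in lebesgue_on I. W t = E (\<xi> t)"
  unfolding lin_sol_def by (elim conjE, assumption, elim conjE, erule bspec, assumption, elim conjE)

text \<open>
  The intervals on which the equations are considered; they have non-empty interior, so that the
  absolutely continuous version of a function is unique.
\<close>

definition horizon :: "real set \<Rightarrow> bool" where
  "horizon I \<longleftrightarrow> I = {0..} \<or> (\<exists>T>0. I = {0..T})"

lemma horizon_simps [simp]: "horizon {0..}" "0 < T \<Longrightarrow> horizon {0..T}"
  by (auto simp: horizon_def)

lemma horizon_sets [simp]: "horizon I \<Longrightarrow> I \<in> sets lebesgue"
  by (auto simp: horizon_def)

lemma horizon_subset: "horizon I \<Longrightarrow> t \<in> I \<Longrightarrow> {0..t} \<subseteq> I \<and> 0 \<le> t"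
  by (auto simp: horizon_def)

lemma L2_loc_subset: "\<xi> \<in> L2_loc I \<Longrightarrow> {0..T} \<subseteq> I \<Longrightarrow> 0 \<le> T \<Longrightarrow> \<xi> \<in> L2_on {0..T}"
  unfolding L2_loc_def by blast

context
  fixes E G :: "'e::euclidean_space \<Rightarrow> 'b::euclidean_space"
  assumes E: "linear E" and G: "linear G"
begin

lemma lin_sol_rate:
  assumes "lin_sol E G I \<xi> W" "{0..T} \<subseteq> I" "0 \<le> T"
  shows "(\<lambda>t. G (\<xi> t)) \<in> L2_on {0..T}" "integrable (lebesgue_on {0..T}) (\<lambda>t. G (\<xi> t))"
proof -
  show *: "(\<lambda>t. G (\<xi> t)) \<in> L2_on {0..T}"
    using assms L2_loc_subset lin_sol_L2 by (intro L2_on_linear[OF G]) blast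
  show "integrable (lebesgue_on {0..T}) (\<lambda>t. G (\<xi> t))" by (rule L2_on_integrable[OF *])
qed

lemma lin_sol_increment:
  assumes sol: "lin_sol E G I \<xi> W" and I: "{0..d} \<subseteq> I" and cd: "0 \<le> c" "c \<le> d"
  shows "W d - W c = (LINT s|lebesgue_on {c..d}. G (\<xi> s))"
proof -
  have "c \<in> I" "d \<in> I" using I cd by auto
  then have "W d = W 0 + (LINT s|lebesgue_on {0..d}. G (\<xi> s))"
      "W c = W 0 + (LINT s|lebesgue_on {0..c}. G (\<xi> s))"
    by (auto intro: lin_sol_eq[OF sol])
  then show ?thesis
    using integral_lebesgue_on_append[OF lin_sol_rate(2)[OF sol I], of c] cd by simp
qed

lemma lin_sol_ac_version:
  assumes sol: "lin_sol E G I \<xi> W" and I: "horizon I"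
  shows "ac_version I (\<lambda>s. E (\<xi> s)) W"
proof -
  have "abs_cont_on {a..b} W" if "a \<le> b" "{a..b} \<subseteq> I" for a b
  proof (rule abs_cont_on_indefinite_integral)
    have "a \<in> I" "b \<in> I" using that by auto
    then have ab: "0 \<le> a" "{0..b} \<subseteq> I" using horizon_subset[OF I] by auto
    show "(\<lambda>t. G (\<xi> t)) \<in> L2_on {a..b}"
      using ab that by (auto intro!: L2_on_subset[OF lin_sol_rate(1)[OF sol ab(2)]])
    fix c d assume "a \<le> c" "c \<le> d" "d \<le> b"
    then show "W d - W c = (LINT s|lebesgue_on {c..d}. G (\<xi> s))"
      using ab by (intro lin_sol_increment[OF sol]) auto
  qed
  then show ?thesis using lin_sol_AE[OF sol] by (simp add: ac_version_def loc_abs_cont_on_def)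
qed

lemma lin_sol_ac_value:
  assumes sol: "lin_sol E G I \<xi> W" and I: "horizon I" and t: "t \<in> I"
  shows "ac_value I (\<lambda>s. E (\<xi> s)) t = W t"
proof -
  obtain b where "0 < b" "{0..b} \<subseteq> I" "t \<in> {0..b}"
  proof (cases "I = {0..}")
    case True
    then show ?thesis using that[of "t + 1"] t by auto
  next
    case False
    then obtain T where "0 < T" "I = {0..T}" using I by (auto simp: horizon_def)
    then show ?thesis using that[of T] t by simp
  qed
  then show ?thesis using ac_value_eq[OF lin_sol_ac_version[OF sol I], of 0 b t] I by simp
qed

lemma lin_sol_of_ac_value:
  assumes "\<xi> \<in> L2_loc I" "ac_version I (\<lambda>s. E (\<xi> s)) w"
    and "\<forall>t\<in>I. ac_value I (\<lambda>s. E (\<xi> s)) t =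
      ac_value I (\<lambda>s. E (\<xi> s)) 0 + (LINT s|lebesgue_on {0..t}. G (\<xi> s))"
  shows "lin_sol E G I \<xi> (ac_value I (\<lambda>s. E (\<xi> s)))"
proof -
  have "ac_version I (\<lambda>s. E (\<xi> s)) (ac_value I (\<lambda>s. E (\<xi> s)))"
    unfolding ac_value_def using assms(2) by (rule someI[where P = "ac_version I (\<lambda>s. E (\<xi> s))"])
  then show ?thesis using assms unfolding lin_sol_def ac_version_def by blast
qed

lemma lin_sol_restrict:
  assumes sol: "lin_sol E G I \<xi> W" and "{0..T} \<subseteq> I" "0 \<le> T" "I \<in> sets lebesgue"
  shows "lin_sol E G {0..T} \<xi> W"
  unfolding lin_sol_def
proof (intro conjI ballI)
  show "\<xi> \<in> L2_loc {0..T}"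
    using L2_loc_subset[OF lin_sol_L2[OF sol]] assms(2,3) by (simp add: L2_loc_Icc)
  show "W t = W 0 + (LINT s|lebesgue_on {0..t}. G (\<xi> s))" if "t \<in> {0..T}" for t
    using that assms(2) by (intro lin_sol_eq[OF sol]) auto
  show "AE t in lebesgue_on {0..T}. W t = E (\<xi> t)"
    using assms by (intro AE_lebesgue_on_subset[OF lin_sol_AE[OF sol]]) auto
qed

lemma lin_sol_atLeastI:
  assumes "\<And>n::nat. lin_sol E G {0..real n} \<xi> W"
  shows "lin_sol E G {0..} \<xi> W"
  unfolding lin_sol_def
proof (intro conjI ballI)
  have L2: "\<xi> \<in> L2_on {0..real n}" for n
    using lin_sol_L2[OF assms[of n]] by (simp add: L2_loc_Icc)
  show "\<xi> \<in> L2_loc {0..}"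
    unfolding L2_loc_atLeast
  proof clarify
    fix T :: real assume "0 \<le> T"
    obtain n :: nat where "T \<le> real n" using real_arch_simple by blast
    then show "\<xi> \<in> L2_on {0..T}" by (auto intro: L2_on_subset[OF L2[of n]])
  qed
  show "W t = W 0 + (LINT s|lebesgue_on {0..t}. G (\<xi> s))" if "t \<in> {0..}" for t
  proof -
    obtain n :: nat where "t \<le> real n" using real_arch_simple by blast
    then have "t \<in> {0..real n}" using that by simp
    then show ?thesis by (rule lin_sol_eq[OF assms])
  qed
  have "AE t in lebesgue. t \<in> {0..real n} \<longrightarrow> W t = E (\<xi> t)" for n
    using lin_sol_AE[OF assms[of n]] by (subst (asm) AE_restrict_space_iff) auto
  then have "AE t in lebesgue. \<forall>n. t \<in> {0..real n} \<longrightarrow> W t = E (\<xi> t)"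
    by (intro AE_all_countable[THEN iffD2] allI)
  then have "AE t in lebesgue. t \<in> {0..} \<longrightarrow> W t = E (\<xi> t)"
    by (rule AE_mp, intro AE_I2) (metis atLeastAtMost_iff atLeast_iff real_arch_simple)
  then show "AE t in lebesgue_on {0..}. W t = E (\<xi> t)"
    by (subst AE_restrict_space_iff) auto
qed

lemma L2_loc_lincomb:
  assumes "\<xi> \<in> L2_loc I" "\<zeta> \<in> L2_loc I"
  shows "(\<lambda>t. a *\<^sub>R \<xi> t + b *\<^sub>R \<zeta> t) \<in> L2_loc I"
  using assms unfolding L2_loc_def by (auto intro!: L2_on_add L2_on_scaleR)

lemma lin_sol_lincomb:
  assumes 1: "lin_sol E G I \<xi> W" and 2: "lin_sol E G I \<zeta> Z" and I: "\<And>t. t \<in> I \<Longrightarrow> {0..t} \<subseteq> I \<and> 0 \<le> t"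
  shows "lin_sol E G I (\<lambda>t. a *\<^sub>R \<xi> t + b *\<^sub>R \<zeta> t) (\<lambda>t. a *\<^sub>R W t + b *\<^sub>R Z t)"
  unfolding lin_sol_def
proof (intro conjI ballI)
  fix t assume t: "t \<in> I"
  then have t': "{0..t} \<subseteq> I" "0 \<le> t" using I by auto
  have "(LINT s|lebesgue_on {0..t}. G (a *\<^sub>R \<xi> s + b *\<^sub>R \<zeta> s)) =
      a *\<^sub>R (LINT s|lebesgue_on {0..t}. G (\<xi> s)) + b *\<^sub>R (LINT s|lebesgue_on {0..t}. G (\<zeta> s))"
    using lin_sol_rate(2)[OF 1 t'] lin_sol_rate(2)[OF 2 t'] by (simp add: linear_add[OF G] linear_scale[OF G])
  moreover have "W t = W 0 + (LINT s|lebesgue_on {0..t}. G (\<xi> s))"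
    "Z t = Z 0 + (LINT s|lebesgue_on {0..t}. G (\<zeta> s))"
    using t by (auto intro: lin_sol_eq[OF 1] lin_sol_eq[OF 2])
  ultimately show "a *\<^sub>R W t + b *\<^sub>R Z t = a *\<^sub>R W 0 + b *\<^sub>R Z 0 +
       (LINT s|lebesgue_on {0..t}. G (a *\<^sub>R \<xi> s + b *\<^sub>R \<zeta> s))"
    by (simp add: scaleR_add_right)
next
  have "AE t in lebesgue_on I. W t = E (\<xi> t)" "AE t in lebesgue_on I. Z t = E (\<zeta> t)"
    by (rule lin_sol_AE[OF 1], rule lin_sol_AE[OF 2])
  then show "AE t in lebesgue_on I. a *\<^sub>R W t + b *\<^sub>R Z t = E (a *\<^sub>R \<xi> t + b *\<^sub>R \<zeta> t)"
    by eventually_elim (simp add: linear_add[OF E] linear_scale[OF E])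
qed (intro L2_loc_lincomb lin_sol_L2[OF 1] lin_sol_L2[OF 2])

lemma lin_sol_zero: "lin_sol E G I (\<lambda>t. 0) (\<lambda>t. 0)"
  by (simp add: lin_sol_def linear_0[OF E] linear_0[OF G] L2_loc_def L2_on_zero)

lemma lin_sol_sum:
  assumes "\<And>b. b \<in> B \<Longrightarrow> lin_sol E G I (\<xi> b) (W b)" and I: "\<And>t. t \<in> I \<Longrightarrow> {0..t} \<subseteq> I \<and> 0 \<le> t"
  shows "lin_sol E G I (\<lambda>t. \<Sum>b\<in>B. r b *\<^sub>R \<xi> b t) (\<lambda>t. \<Sum>b\<in>B. r b *\<^sub>R W b t)"
  using assms(1)
proof (induction B rule: infinite_finite_induct)
  case (insert b B)
  have "lin_sol E G I (\<lambda>t. r b *\<^sub>R \<xi> b t + 1 *\<^sub>R (\<Sum>b\<in>B. r b *\<^sub>R \<xi> b t))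
      (\<lambda>t. r b *\<^sub>R W b t + 1 *\<^sub>R (\<Sum>b\<in>B. r b *\<^sub>R W b t))"
    using insert by (intro lin_sol_lincomb I) auto
  then show ?case using insert(1,2) by simp
qed (simp_all add: lin_sol_zero)

lemma lin_sol_shift:
  assumes sol: "lin_sol E G {0..} \<xi> W" and s: "0 \<le> s"
  shows "lin_sol E G {0..} (\<lambda>t. \<xi> (s + t)) (\<lambda>t. W (s + t))"
  unfolding lin_sol_def
proof (intro conjI ballI)
  have T: "{0..t} = (\<lambda>x. s + x) -` {s..s + t}" for t by auto
  have L2: "\<xi> \<in> L2_on {0..t}" if "0 \<le> t" for t
    using lin_sol_L2[OF sol] that by (simp add: L2_loc_atLeast)
  show "(\<lambda>t. \<xi> (s + t)) \<in> L2_loc {0..}"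
    unfolding L2_loc_atLeast
  proof clarify
    fix t :: real assume "0 \<le> t"
    then have "\<xi> \<in> L2_on {s..s + t}" using s by (intro L2_on_subset[OF L2[of "s + t"]]) auto
    then show "(\<lambda>t. \<xi> (s + t)) \<in> L2_on {0..t}" using L2_on_shift[OF _ T] by simp
  qed
  show "W (s + t) = W (s + 0) + (LINT r|lebesgue_on {0..t}. G (\<xi> (s + r)))" if t: "t \<in> {0..}" for t
  proof -
    have "integrable (lebesgue_on {s..s + t}) (\<lambda>r. G (\<xi> r))"
      using s t by (intro integrable_lebesgue_on_subset[OF lin_sol_rate(2)[OF sol, of "s + t"]]) auto
    then have "(LINT r|lebesgue_on {0..t}. G (\<xi> (s + r))) = (LINT r|lebesgue_on {s..s + t}. G (\<xi> r))"
      using integrable_shift(2)[OF _ T] by simp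
    then show ?thesis using lin_sol_increment[OF sol, of "s + t" s] s t by (simp add: algebra_simps)
  qed
  have "AE t in lebesgue_on {s..}. W t = E (\<xi> t)"
    using s by (intro AE_lebesgue_on_subset[OF lin_sol_AE[OF sol]]) auto
  moreover have "{0..} = (\<lambda>x. s + x) -` {s..}" by auto
  ultimately show "AE t in lebesgue_on {0..}. W (s + t) = E (\<xi> (s + t))"
    by (intro AE_shift[where P = "\<lambda>t. W t = E (\<xi> t)"]) auto
qed

lemma lin_sol_concat_at:
  assumes 1: "lin_sol E G {0..s} \<xi> W" and 2: "lin_sol E G {0..r} \<zeta> Z"
    and junction: "Z 0 = W s" and sr: "0 \<le> s" "0 \<le> r"
  shows "lin_sol E G {0..s + r} (concat_at s \<xi> \<zeta>) (concat_at s W Z)"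
  unfolding lin_sol_def
proof (intro conjI ballI)
  have L2: "\<xi> \<in> L2_on {0..s}" "\<zeta> \<in> L2_on {0..r}"
    using lin_sol_L2[OF 1] lin_sol_L2[OF 2] sr by (simp_all add: L2_loc_Icc)
  then show "concat_at s \<xi> \<zeta> \<in> L2_loc {0..s + r}"
    using sr by (simp add: L2_loc_Icc L2_on_concat_at)
  have W: "W t = W 0 + (LINT r|lebesgue_on {0..t}. G (\<xi> r))" if "0 \<le> t" "t \<le> s" for t
    using that by (intro lin_sol_eq[OF 1]) simp
  have Z: "Z t = Z 0 + (LINT r|lebesgue_on {0..t}. G (\<zeta> r))" if "0 \<le> t" "t \<le> r" for t
    using that by (intro lin_sol_eq[OF 2]) simp
  have start: "concat_at s W Z 0 = W 0"
    using junction sr by (auto simp: concat_at_def)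
  fix t assume t: "t \<in> {0..s + r}"
  show "concat_at s W Z t = concat_at s W Z 0 + (LINT p|lebesgue_on {0..t}. G (concat_at s \<xi> \<zeta> p))"
  proof (cases "t < s")
    case True
    then have "(LINT p|lebesgue_on {0..t}. G (concat_at s \<xi> \<zeta> p)) = (LINT p|lebesgue_on {0..t}. G (\<xi> p))"
      by (intro Bochner_Integration.integral_cong) (auto simp: concat_at_def space_restrict_space)
    moreover have "concat_at s W Z t = W t" using True by (simp add: concat_at_def)
    ultimately show ?thesis using W[of t] start True t by simp
  next
    case False
    have "integrable (lebesgue_on {0..t - s}) (\<lambda>p. G (\<zeta> p))"
      using False t by (intro integrable_lebesgue_on_subset[OF lin_sol_rate(2)[OF 2, of r]]) auto
    then have "(LINT p|lebesgue_on {0..s + (t - s)}. G (concat_at s \<xi> \<zeta> p)) =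
        (LINT p|lebesgue_on {0..s}. G (\<xi> p)) + (LINT p|lebesgue_on {0..t - s}. G (\<zeta> p))"
      unfolding comp_concat_at[of G]
      using False sr by (intro integral_concat_at lin_sol_rate(2)[OF 1]) auto
    moreover have "concat_at s W Z t = Z (t - s)" using False by (simp add: concat_at_def)
    ultimately show ?thesis
      using W[of s] Z[of "t - s"] start junction False t sr by simp
  qed
next
  have T: "{s..s + r} = (\<lambda>x. -s + x) -` {0..r}" by auto
  have "AE t in lebesgue_on {s..s + r}. Z (-s + t) = E (\<zeta> (-s + t))"
    by (intro AE_shift[OF _ T] lin_sol_AE[OF 2]) auto
  then have 2: "AE t in lebesgue. t \<in> {s..s + r} \<longrightarrow> Z (-s + t) = E (\<zeta> (-s + t))"
    by (subst (asm) AE_restrict_space_iff) auto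
  have "AE t in lebesgue_on {0..s}. W t = E (\<xi> t)" by (rule lin_sol_AE[OF 1])
  then have 1: "AE t in lebesgue. t \<in> {0..s} \<longrightarrow> W t = E (\<xi> t)"
    by (subst (asm) AE_restrict_space_iff) auto
  from 1 2 have "AE t in lebesgue. t \<in> {0..s + r} \<longrightarrow> concat_at s W Z t = E (concat_at s \<xi> \<zeta> t)"
    by eventually_elim (auto simp: concat_at_def)
  then show "AE t in lebesgue_on {0..s + r}. concat_at s W Z t = E (concat_at s \<xi> \<zeta> t)"
    by (subst AE_restrict_space_iff) auto
qed

end

text \<open>Linear relations satisfied by \<open>E \<xi>\<close> are inherited by its continuous version and by the rate.\<close>

lemma lin_sol_annihilate:
  fixes E G :: "'e::euclidean_space \<Rightarrow> 'b::euclidean_space" and L :: "'b \<Rightarrow> 'c::euclidean_space"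
  assumes E: "linear E" and G: "linear G" and L: "linear L" and LE: "\<And>x. L (E x) = 0"
    and T: "0 < T" and sol: "lin_sol E G {0..T} \<xi> W"
  shows "t \<in> {0..T} \<Longrightarrow> L (W t) = 0"
    and "AE t in lebesgue_on {0..T}. L (G (\<xi> t)) = 0"
proof -
  have LG: "linear (\<lambda>x. L (G x))" and LE': "linear (\<lambda>x. L (E x))"
    using linear_compose[OF G L] linear_compose[OF E L] by (simp_all add: o_def)
  have LW: "L (W t) = L (W 0) + (LINT s|lebesgue_on {0..t}. L (G (\<xi> s)))" if t: "t \<in> {0..T}" for t
  proof -
    have "integrable (lebesgue_on {0..t}) (\<lambda>s. G (\<xi> s))"
      using t by (intro lin_sol_rate(2)[OF E G sol]) auto
    then have "(LINT s|lebesgue_on {0..t}. L (G (\<xi> s))) = L (LINT s|lebesgue_on {0..t}. G (\<xi> s))"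
      by (rule integral_linear_lebesgue_on[OF L])
    then show ?thesis by (subst lin_sol_eq[OF sol t]) (simp add: linear_add[OF L])
  qed
  have "lin_sol (\<lambda>x. L (E x)) (\<lambda>x. L (G x)) {0..T} \<xi> (\<lambda>t. L (W t))"
    unfolding lin_sol_def
  proof (intro conjI ballI)
    show "AE t in lebesgue_on {0..T}. L (W t) = L (E (\<xi> t))"
      using lin_sol_AE[OF sol] by eventually_elim simp
    show "L (W t) = L (W 0) + (LINT s|lebesgue_on {0..t}. L (G (\<xi> s)))" if "t \<in> {0..T}" for t
      using that by (rule LW)
  qed (rule lin_sol_L2[OF sol])
  from lin_sol_ac_value[OF LE' LG this]
  have 1: "ac_value {0..T} (\<lambda>s. L (E (\<xi> s))) t = L (W t)" if "t \<in> {0..T}" for t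
    using T that by simp
  have z: "linear (\<lambda>x::'e. 0::'c)" by (simp add: linear_iff)
  have "lin_sol (\<lambda>x. 0) (\<lambda>x. 0) {0..T} \<xi> (\<lambda>t. 0::'c)"
    using lin_sol_L2[OF sol] by (simp add: lin_sol_def)
  from lin_sol_ac_value[OF z z this] have 2: "ac_value {0..T} (\<lambda>s. 0::'c) t = 0" if "t \<in> {0..T}" for t
    using T that by simp
  have LW0: "L (W t) = 0" if "t \<in> {0..T}" for t
    using 1[OF that] 2[OF that] by (simp add: LE)
  then show "t \<in> {0..T} \<Longrightarrow> L (W t) = 0" .
  show "AE t in lebesgue_on {0..T}. L (G (\<xi> t)) = 0"
  proof (rule AE_zero_of_indefinite_integral_zero)
    show "integrable (lebesgue_on {0..T}) (\<lambda>t. L (G (\<xi> t)))"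
      using T lin_sol_L2[OF sol] by (intro L2_on_integrable L2_on_linear[OF LG]) (simp add: L2_loc_Icc)
    fix t assume "0 \<le> t" "t \<le> T"
    then show "(LINT s|lebesgue_on {0..t}. L (G (\<xi> s))) = 0"
      using LW[of t] LW0[of t] LW0[of 0] T by simp
  qed
qed

section \<open>Decay and stabilisation\<close>

lemma linear_bound:
  fixes E :: "'a::euclidean_space \<Rightarrow> 'b::euclidean_space"
  assumes "linear E"
  obtains C where "0 \<le> C" "\<And>x. (norm (E x))\<^sup>2 \<le> C * (norm x)\<^sup>2"
proof -
  interpret E: bounded_linear E using assms by (simp add: linear_conv_bounded_linear)
  obtain B where B: "0 < B" "\<And>x. norm (E x) \<le> norm x * B" using E.pos_bounded by blast
  have "(norm (E x))\<^sup>2 \<le> B\<^sup>2 * (norm x)\<^sup>2" for x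
    using power_mono[OF B(2), of x 2] by (simp add: power_mult_distrib mult.commute)
  then show ?thesis using that[of "B\<^sup>2"] by simp
qed

lemma bounded_mono_increment_small:
  fixes \<Phi> :: "real \<Rightarrow> real"
  assumes mono: "\<And>s t. 0 \<le> s \<Longrightarrow> s \<le> t \<Longrightarrow> \<Phi> s \<le> \<Phi> t" and bound: "\<And>t. 0 \<le> t \<Longrightarrow> \<Phi> t \<le> C"
    and e: "0 < \<epsilon>"
  obtains T where "0 \<le> T" "\<And>s t. T \<le> s \<Longrightarrow> s \<le> t \<Longrightarrow> \<Phi> t - \<Phi> s < \<epsilon>"
proof -
  define L where "L = Sup (\<Phi> ` {0..})"
  have bdd: "bdd_above (\<Phi> ` {0..})" using bound by (auto intro!: bdd_aboveI)
  have "L - \<epsilon> < Sup (\<Phi> ` {0..})" using e by (simp add: L_def)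
  then obtain T where T: "0 \<le> T" "L - \<epsilon> < \<Phi> T"
    using bdd by (subst (asm) less_cSup_iff) auto
  have "\<Phi> t - \<Phi> s < \<epsilon>" if "T \<le> s" "s \<le> t" for s t
  proof -
    have "\<Phi> t \<le> L" unfolding L_def using bdd T that by (intro cSup_upper) auto
    then show ?thesis using mono[of T s] T that by linarith
  qed
  then show ?thesis using that T by blast
qed

text \<open>
  Since \<open>W = E \<xi>\<close> and \<open>W' = G \<xi>\<close>, the value \<open>|W t|\<close> is at most the integral of \<open>|E \<xi>| + |G \<xi>|\<close> over
  \<open>[t, t + 1]\<close>, and the energy of \<open>\<xi>\<close> on that interval tends to zero.
\<close>

lemma lin_sol_tendsto_zero:
  fixes E G :: "'e::euclidean_space \<Rightarrow> 'b::euclidean_space"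
  assumes E: "linear E" and G: "linear G" and sol: "lin_sol E G {0..} \<xi> W"
    and bound: "\<And>T. 0 \<le> T \<Longrightarrow> (LINT t|lebesgue_on {0..T}. (norm (\<xi> t))\<^sup>2) \<le> C"
  shows "(W \<longlongrightarrow> 0) at_top"
proof (rule tendstoI)
  fix e :: real assume e: "0 < e"
  obtain CE where CE: "0 \<le> CE" "\<And>x. (norm (E x))\<^sup>2 \<le> CE * (norm x)\<^sup>2" using linear_bound[OF E] by blast
  obtain CG where CG: "0 \<le> CG" "\<And>x. (norm (G x))\<^sup>2 \<le> CG * (norm x)\<^sup>2" using linear_bound[OF G] by blast
  define r where "r = e / (3 + CE + CG)"
  have r: "0 < r" using e CE CG by (simp add: r_def)
  have L2: "\<xi> \<in> L2_on {a..b}" if "0 \<le> a" "a \<le> b" for a b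
    using lin_sol_L2[OF sol] that unfolding L2_loc_def by auto
  define \<Phi> where "\<Phi> T = (LINT t|lebesgue_on {0..T}. (norm (\<xi> t))\<^sup>2)" for T
  have incr: "\<Phi> t - \<Phi> s = (LINT t|lebesgue_on {s..t}. (norm (\<xi> t))\<^sup>2)" if "0 \<le> s" "s \<le> t" for s t
    unfolding \<Phi>_def using integral_lebesgue_on_append[OF L2_on_integrable_sq[OF L2], of 0 t s] that by simp
  have mono: "\<Phi> s \<le> \<Phi> t" if "0 \<le> s" "s \<le> t" for s t
  proof -
    have "0 \<le> (LINT t|lebesgue_on {s..t}. (norm (\<xi> t))\<^sup>2)" by simp
    then show ?thesis using incr[OF that] by linarith
  qed
  have "0 < r\<^sup>2" using r by simp
  then obtain T where T: "0 \<le> T" "\<And>s t. T \<le> s \<Longrightarrow> s \<le> t \<Longrightarrow> \<Phi> t - \<Phi> s < r\<^sup>2"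
    using bounded_mono_increment_small[of \<Phi> C "r\<^sup>2"] mono bound unfolding \<Phi>_def by metis
  have "norm (W t) < e" if t: "T \<le> t" for t
  proof -
    let ?M = "lebesgue_on {t..t + 1}"
    have t0: "0 \<le> t" using T t by simp
    have xi: "\<xi> \<in> L2_on {t..t + 1}" using t0 by (intro L2) auto
    have EG: "(\<lambda>s. E (\<xi> s)) \<in> L2_on {t..t + 1}" "(\<lambda>s. G (\<xi> s)) \<in> L2_on {t..t + 1}"
      by (rule L2_on_linear[OF E xi], rule L2_on_linear[OF G xi])
    have int: "integrable ?M (\<lambda>s. norm (E (\<xi> s)))" "integrable ?M (\<lambda>s. norm (G (\<xi> s)))"
      using L2_on_integrable[OF EG(1)] L2_on_integrable[OF EG(2)] by auto
    have sq: "(LINT s|?M. (norm (\<xi> s))\<^sup>2) \<le> r\<^sup>2"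
      using T(2)[of t "t + 1"] incr[of t "t + 1"] t t0 by simp
    have bd: "(LINT s|?M. norm (K (\<xi> s))) \<le> r + CK * r"
      if K: "linear K" and CK: "0 \<le> CK" "\<And>x. (norm (K x))\<^sup>2 \<le> CK * (norm x)\<^sup>2"
      for K :: "'e \<Rightarrow> 'b" and CK
    proof -
      have K2: "(\<lambda>s. K (\<xi> s)) \<in> L2_on {t..t + 1}" by (rule L2_on_linear[OF K xi])
      have "(LINT s|?M. (norm (K (\<xi> s)))\<^sup>2) \<le> (LINT s|?M. CK * (norm (\<xi> s))\<^sup>2)"
        using L2_on_integrable_sq[OF K2] L2_on_integrable_sq[OF xi] CK by (intro integral_mono) auto
      also have "\<dots> \<le> CK * r\<^sup>2" using sq CK(1) by (simp add: mult_left_mono)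
      finally have "(LINT s|?M. (norm (K (\<xi> s)))\<^sup>2) / r \<le> CK * r"
        using r by (simp add: field_simps power2_eq_square)
      moreover have "(LINT s|?M. norm (K (\<xi> s))) \<le> r * measure lebesgue {t..t + 1} +
          (LINT s|?M. (norm (K (\<xi> s)))\<^sup>2) / r"
        by (intro integral_norm_le_sq K2 r) simp
      ultimately show ?thesis by simp
    qed
    have pt: "norm (W t) \<le> norm (W s) + (LINT p|?M. norm (G (\<xi> p)))" if s: "s \<in> {t..t + 1}" for s
    proof -
      have ts: "integrable (lebesgue_on {t..s}) (\<lambda>p. norm (G (\<xi> p)))"
        using s by (intro integrable_lebesgue_on_subset[OF int(2)]) auto
      have "norm (W s - W t) = norm (LINT p|lebesgue_on {t..s}. G (\<xi> p))"
        using lin_sol_increment[OF E G sol, of s t] s t0 by simp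
      also have "\<dots> \<le> (LINT p|lebesgue_on {t..s}. norm (G (\<xi> p)))" by (rule integral_norm_bound)
      also have "\<dots> \<le> (LINT p|?M. norm (G (\<xi> p)))"
        using s by (intro integral_lebesgue_on_mono int) auto
      finally show ?thesis using norm_triangle_ineq2[of "W t" "W s"] by (simp add: norm_minus_commute)
    qed
    have ae: "AE s in ?M. norm (W t) \<le> norm (E (\<xi> s)) + (LINT p|?M. norm (G (\<xi> p)))"
    proof -
      have "AE s in ?M. W s = E (\<xi> s)"
        using t0 by (intro AE_lebesgue_on_subset[OF lin_sol_AE[OF sol]]) auto
      moreover have "AE s in ?M. s \<in> {t..t + 1}" by (rule AE_I2) (simp add: space_restrict_space)
      ultimately show ?thesis by eventually_elim (metis pt)
    qed
    have "norm (W t) = (LINT s|?M. norm (W t))"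
      by (simp add: measure_restrict_space space_restrict_space)
    also have "\<dots> \<le> (LINT s|?M. norm (E (\<xi> s)) + (LINT p|?M. norm (G (\<xi> p))))"
      using int ae by (intro integral_mono_AE) auto
    also have "\<dots> = (LINT s|?M. norm (E (\<xi> s))) + (LINT p|?M. norm (G (\<xi> p)))"
      using int by (simp add: measure_restrict_space space_restrict_space)
    also have "\<dots> \<le> (r + CE * r) + (r + CG * r)"
      by (intro add_mono bd E G CE CG)
    also have "\<dots> < (3 + CE + CG) * r" using r by (simp add: algebra_simps)
    also have "\<dots> = e" using CE CG by (simp add: r_def)
    finally show ?thesis .
  qed
  then show "\<forall>\<^sub>F t in at_top. dist (W t) 0 < e"
    unfolding eventually_at_top_linorder by (auto simp: dist_norm)
qed

text \<open>
  If one solution with a given initial value has \<open>W \<longlongrightarrow> 0\<close>, then solutions of uniformly bounded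
  energy with that initial value exist on all bounded horizons.  The initial values of solutions
  with \<open>W \<longlongrightarrow> 0\<close> form a finite-dimensional space; by choosing such solutions for an orthonormal basis
  and extending linearly, a single time \<open>T\<close> is found after which every initial value in that space
  has been halved, and the corresponding pieces are concatenated.
\<close>

lemma lin_sol_bounded_energy:
  fixes E G :: "'e::euclidean_space \<Rightarrow> 'b::euclidean_space"
  assumes E: "linear E" and G: "linear G" and sol: "lin_sol E G {0..} \<xi>\<^sub>0 W\<^sub>0"
    and lim: "(W\<^sub>0 \<longlongrightarrow> 0) at_top"
  obtains C where "\<And>n::nat. \<exists>\<xi> W. lin_sol E G {0..real n} \<xi> W \<and> W 0 = W\<^sub>0 0 \<and>
    (LINT t|lebesgue_on {0..real n}. (norm (\<xi> t))\<^sup>2) \<le> C"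
proof -
  define S where "S = {a. \<exists>\<xi> W. lin_sol E G {0..} \<xi> W \<and> W 0 = a \<and> (W \<longlongrightarrow> 0) at_top}"
  have I: "{0..t} \<subseteq> {0..} \<and> 0 \<le> t" if "t \<in> {0..}" for t :: real using that by auto
  have "subspace S"
  proof (rule subspaceI)
    show "0 \<in> S" unfolding S_def using lin_sol_zero[OF E G] by fastforce
    fix a b assume "a \<in> S" "b \<in> S"
    then obtain \<xi> W \<zeta> Z where s: "lin_sol E G {0..} \<xi> W" "W 0 = a" "(W \<longlongrightarrow> 0) at_top"
      "lin_sol E G {0..} \<zeta> Z" "Z 0 = b" "(Z \<longlongrightarrow> 0) at_top" unfolding S_def by blast
    have "lin_sol E G {0..} (\<lambda>t. 1 *\<^sub>R \<xi> t + 1 *\<^sub>R \<zeta> t) (\<lambda>t. 1 *\<^sub>R W t + 1 *\<^sub>R Z t)"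
      by (rule lin_sol_lincomb[OF E G s(1,4) I])
    moreover have "((\<lambda>t. 1 *\<^sub>R W t + 1 *\<^sub>R Z t) \<longlongrightarrow> 0) at_top"
      using tendsto_add[OF s(3,6)] by simp
    ultimately show "a + b \<in> S" unfolding S_def using s(2,5) by fastforce
  next
    fix a c assume "a \<in> S"
    then obtain \<xi> W where s: "lin_sol E G {0..} \<xi> W" "W 0 = a" "(W \<longlongrightarrow> 0) at_top"
      unfolding S_def by blast
    have "lin_sol E G {0..} (\<lambda>t. c *\<^sub>R \<xi> t + 0 *\<^sub>R \<xi> t) (\<lambda>t. c *\<^sub>R W t + 0 *\<^sub>R W t)"
      by (rule lin_sol_lincomb[OF E G s(1,1) I])
    moreover have "((\<lambda>t. c *\<^sub>R W t + 0 *\<^sub>R W t) \<longlongrightarrow> 0) at_top"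
      using tendsto_scaleR[OF tendsto_const s(3), of c] by simp
    ultimately show "c *\<^sub>R a \<in> S" unfolding S_def using s(2) by fastforce
  qed
  then obtain B where B: "B \<subseteq> S" "pairwise orthogonal B" "\<And>x. x \<in> B \<Longrightarrow> norm x = 1"
      "independent B" "span B = S"
    by (rule orthonormal_basis_subspace) simp
  have fin: "finite B" using B(4) by (rule independent_imp_finite)
  have "\<forall>b\<in>B. \<exists>p. lin_sol E G {0..} (fst p) (snd p) \<and> snd p 0 = b \<and> (snd p \<longlongrightarrow> 0) at_top"
    using B(1) unfolding S_def by fastforce
  from bchoice[OF this] obtain p where p: "\<And>b. b \<in> B \<Longrightarrow> lin_sol E G {0..} (fst (p b)) (snd (p b))"
    "\<And>b. b \<in> B \<Longrightarrow> snd (p b) 0 = b" "\<And>b. b \<in> B \<Longrightarrow> (snd (p b) \<longlongrightarrow> 0) at_top" by blast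
  define X where "X a t = (\<Sum>b\<in>B. (a \<bullet> b) *\<^sub>R fst (p b) t)" for a t
  define Y where "Y a t = (\<Sum>b\<in>B. (a \<bullet> b) *\<^sub>R snd (p b) t)" for a t
  have XY: "lin_sol E G {0..} (X a) (Y a)" for a
    unfolding X_def Y_def by (rule lin_sol_sum[OF E G]) (use p(1) in auto)
  have Y0: "Y a 0 = a" if "a \<in> S" for a
  proof -
    have "Y a 0 = (\<Sum>b\<in>B. (a \<bullet> b) *\<^sub>R b)" unfolding Y_def by (simp add: p(2))
    then show ?thesis using orthonormal_basis_expand[OF B(2,3)] that fin B(5) by auto
  qed
  have Ylim: "(Y a \<longlongrightarrow> 0) at_top" for a
  proof -
    have "((\<lambda>t. \<Sum>b\<in>B. (a \<bullet> b) *\<^sub>R snd (p b) t) \<longlongrightarrow> (\<Sum>b\<in>B. (a \<bullet> b) *\<^sub>R 0)) at_top"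
      by (intro tendsto_sum tendsto_scaleR tendsto_const p(3))
    then show ?thesis by (simp add: Y_def[abs_def])
  qed
  have YS: "Y a T \<in> S" if "0 \<le> T" for a T
  proof -
    have "lin_sol E G {0..} (\<lambda>t. X a (T + t)) (\<lambda>t. Y a (T + t))"
      by (rule lin_sol_shift[OF E G XY that])
    moreover have "filterlim (\<lambda>t. T + t) at_top (at_top :: real filter)"
      by (rule filterlim_tendsto_add_at_top[OF tendsto_const filterlim_ident])
    from filterlim_compose[OF Ylim this] have "((\<lambda>t. Y a (T + t)) \<longlongrightarrow> 0) at_top" .
    ultimately show ?thesis unfolding S_def by force
  qed
  have coef: "\<bar>a \<bullet> b\<bar> \<le> norm a" if "b \<in> B" for a b
    using Cauchy_Schwarz_ineq2[of a b] B(3)[OF that] by simp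
  have "((\<lambda>t. \<Sum>b\<in>B. norm (snd (p b) t)) \<longlongrightarrow> (\<Sum>b\<in>B. norm (0::'b))) at_top"
    by (intro tendsto_sum tendsto_norm p(3))
  then have "((\<lambda>t. \<Sum>b\<in>B. norm (snd (p b) t)) \<longlongrightarrow> 0) at_top" by simp
  then have "\<forall>\<^sub>F t in at_top. (\<Sum>b\<in>B. norm (snd (p b) t)) < 1/2"
    by (rule order_tendstoD) simp
  then obtain T0 where T0: "\<And>t. T0 \<le> t \<Longrightarrow> (\<Sum>b\<in>B. norm (snd (p b) t)) < 1/2"
    unfolding eventually_at_top_linorder by blast
  define T where "T = max 1 T0"
  have T: "0 < T" "(\<Sum>b\<in>B. norm (snd (p b) T)) < 1/2" using T0[of T] by (auto simp: T_def)
  have half: "norm (Y a T) \<le> norm a / 2" for a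
  proof -
    have "norm (Y a T) \<le> (\<Sum>b\<in>B. norm ((a \<bullet> b) *\<^sub>R snd (p b) T))" unfolding Y_def by (rule norm_sum)
    also have "\<dots> \<le> (\<Sum>b\<in>B. norm a * norm (snd (p b) T))"
      using coef by (intro sum_mono) (simp add: mult_right_mono)
    also have "\<dots> = norm a * (\<Sum>b\<in>B. norm (snd (p b) T))" by (simp add: sum_distrib_left)
    also have "\<dots> \<le> norm a * (1/2)" using T(2) by (intro mult_left_mono) auto
    finally show ?thesis by simp
  qed
  have XL2: "X a \<in> L2_on {0..T}" for a
    using lin_sol_L2[OF XY] T by (auto simp: L2_loc_atLeast)
  have pL2: "fst (p b) \<in> L2_on {0..T}" if "b \<in> B" for b
    using lin_sol_L2[OF p(1)[OF that]] T by (auto simp: L2_loc_atLeast)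
  define C where "C = (\<Sum>b\<in>B. real (card B) * (LINT t|lebesgue_on {0..T}. (norm (fst (p b) t))\<^sup>2))"
  have C0: "0 \<le> C" unfolding C_def by (intro sum_nonneg) auto
  have cost: "(LINT t|lebesgue_on {0..T}. (norm (X a t))\<^sup>2) \<le> C * (norm a)\<^sup>2" for a
  proof -
    have pt: "(norm (X a t))\<^sup>2 \<le> (\<Sum>b\<in>B. real (card B) * (norm a)\<^sup>2 * (norm (fst (p b) t))\<^sup>2)" for t
    proof -
      have "norm (X a t) \<le> (\<Sum>b\<in>B. norm ((a \<bullet> b) *\<^sub>R fst (p b) t))" unfolding X_def by (rule norm_sum)
      also have "\<dots> \<le> (\<Sum>b\<in>B. norm a * norm (fst (p b) t))"
        using coef by (intro sum_mono) (simp add: mult_right_mono)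
      finally have "(norm (X a t))\<^sup>2 \<le> (\<Sum>b\<in>B. norm a * norm (fst (p b) t))\<^sup>2"
        by (intro power_mono) auto
      also have "\<dots> \<le> (\<Sum>b\<in>B. (norm a * norm (fst (p b) t))\<^sup>2) * real (card B)"
        using sum_squared_le_sum_of_squares[of "\<lambda>b. norm a * norm (fst (p b) t)" B] by simp
      finally show ?thesis by (simp add: power_mult_distrib sum_distrib_right sum_distrib_left mult_ac)
    qed
    have "(LINT t|lebesgue_on {0..T}. (norm (X a t))\<^sup>2) \<le>
      (LINT t|lebesgue_on {0..T}. (\<Sum>b\<in>B. real (card B) * (norm a)\<^sup>2 * (norm (fst (p b) t))\<^sup>2))"
      using L2_on_integrable_sq[OF XL2] L2_on_integrable_sq[OF pL2] pt
      by (intro integral_mono Bochner_Integration.integrable_sum) auto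
    also have "\<dots> = (\<Sum>b\<in>B. real (card B) * (norm a)\<^sup>2 * (LINT t|lebesgue_on {0..T}. (norm (fst (p b) t))\<^sup>2))"
      using L2_on_integrable_sq[OF pL2] by (subst Bochner_Integration.integral_sum) auto
    also have "\<dots> = C * (norm a)\<^sup>2" by (simp add: C_def sum_distrib_right sum_distrib_left mult_ac)
    finally show ?thesis .
  qed
  \<comment> \<open>the factor 2 is reproduced: the first piece costs \<open>C |a|\<^sup>2\<close>, the others \<open>2 C |a / 2|\<^sup>2\<close>\<close>
  have step: "\<exists>\<xi> W. lin_sol E G {0..real k * T} \<xi> W \<and> W 0 = a \<and>
      (LINT t|lebesgue_on {0..real k * T}. (norm (\<xi> t))\<^sup>2) \<le> 2 * C * (norm a)\<^sup>2" if "a \<in> S" for k a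
    using that
  proof (induction k arbitrary: a)
    case 0
    have ae: "AE t in lebesgue_on {0..0::real}. P t" for P
    proof -
      have "AE t in lebesgue. t \<notin> {0::real}" by (intro AE_not_in finite_null_sets_lebesgue) simp
      then have "AE t in lebesgue. t \<in> {0..0} \<longrightarrow> P t" by (rule AE_mp) (auto intro!: AE_I2)
      then show ?thesis by (subst AE_restrict_space_iff) auto
    qed
    have "lin_sol E G {0..0} (\<lambda>t. 0) (\<lambda>t. a)"
      unfolding lin_sol_def by (simp add: ae[simplified] L2_loc_def L2_on_zero linear_0[OF G])
    then show ?case using C0 by (intro exI[of _ "\<lambda>t. 0"] exI[of _ "\<lambda>t. a"]) simp
  next
    case (Suc k)
    have "Y a T \<in> S" using T by (intro YS) simp
    from Suc.IH[OF this] obtain \<xi> W where IH: "lin_sol E G {0..real k * T} \<xi> W" "W 0 = Y a T"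
      "(LINT t|lebesgue_on {0..real k * T}. (norm (\<xi> t))\<^sup>2) \<le> 2 * C * (norm (Y a T))\<^sup>2" by blast
    have kT: "0 \<le> real k * T" using T by simp
    have first: "lin_sol E G {0..T} (X a) (Y a)"
      using T by (intro lin_sol_restrict[OF E G XY]) auto
    have eq: "real (Suc k) * T = T + real k * T" by (simp add: algebra_simps)
    have "lin_sol E G {0..T + real k * T} (concat_at T (X a) \<xi>) (concat_at T (Y a) W)"
      using T kT by (intro lin_sol_concat_at[OF E G first IH(1,2)]) auto
    moreover have "concat_at T (Y a) W 0 = a" using T Y0[OF Suc.prems] by (simp add: concat_at_def)
    moreover have "(LINT t|lebesgue_on {0..T + real k * T}. (norm (concat_at T (X a) \<xi> t))\<^sup>2) \<le> 2 * C * (norm a)\<^sup>2"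
    proof -
      have xi: "\<xi> \<in> L2_on {0..real k * T}" using lin_sol_L2[OF IH(1)] kT by (simp add: L2_loc_Icc)
      have "(LINT t|lebesgue_on {0..T + real k * T}. (norm (concat_at T (X a) \<xi> t))\<^sup>2) =
        (LINT t|lebesgue_on {0..T}. (norm (X a t))\<^sup>2) + (LINT t|lebesgue_on {0..real k * T}. (norm (\<xi> t))\<^sup>2)"
        unfolding comp_concat_at[of "\<lambda>x. (norm x)\<^sup>2"]
        using T kT by (intro integral_concat_at L2_on_integrable_sq XL2 xi) auto
      also have "\<dots> \<le> C * (norm a)\<^sup>2 + 2 * C * (norm a / 2)\<^sup>2"
        using half[of a] C0
        by (intro add_mono cost order_trans[OF IH(3)] mult_left_mono power_mono) auto
      also have "\<dots> \<le> 2 * C * (norm a)\<^sup>2" using C0 by (simp add: power_divide)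
      finally show ?thesis .
    qed
    ultimately show ?case unfolding eq by blast
  qed
  have "W\<^sub>0 0 \<in> S" unfolding S_def using sol lim by blast
  note step = step[OF this]
  show ?thesis
  proof (rule that[of "2 * C * (norm (W\<^sub>0 0))\<^sup>2"])
    fix n :: nat
    obtain k :: nat where "real n < real k * T" using T(1) reals_Archimedean3 by blast
    moreover obtain \<xi> W where s: "lin_sol E G {0..real k * T} \<xi> W" "W 0 = W\<^sub>0 0"
      "(LINT t|lebesgue_on {0..real k * T}. (norm (\<xi> t))\<^sup>2) \<le> 2 * C * (norm (W\<^sub>0 0))\<^sup>2"
      using step by blast
    ultimately have "lin_sol E G {0..real n} \<xi> W"
      by (intro lin_sol_restrict[OF E G s(1)]) auto
    moreover have "(LINT t|lebesgue_on {0..real n}. (norm (\<xi> t))\<^sup>2) \<le>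
        (LINT t|lebesgue_on {0..real k * T}. (norm (\<xi> t))\<^sup>2)"
      using lin_sol_L2[OF s(1)] \<open>real n < real k * T\<close>
      by (intro integral_lebesgue_on_mono L2_on_integrable_sq) (auto simp: L2_loc_Icc)
    ultimately show "\<exists>\<xi> W. lin_sol E G {0..real n} \<xi> W \<and> W 0 = W\<^sub>0 0 \<and>
        (LINT t|lebesgue_on {0..real n}. (norm (\<xi> t))\<^sup>2) \<le> 2 * C * (norm (W\<^sub>0 0))\<^sup>2"
      using s by fastforce
  qed
qed

section \<open>Quadratic costs and completeness\<close>

text \<open>Symmetric positive definite operators; the weights \<open>Q\<^sup>-\<^sup>1\<close>, \<open>R\<^sup>-\<^sup>1\<close> etc. act through them.\<close>

definition pos_op :: "('e::euclidean_space \<Rightarrow> 'e) \<Rightarrow> bool" where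
  "pos_op K \<longleftrightarrow> linear K \<and> (\<forall>x y. K x \<bullet> y = x \<bullet> K y) \<and> (\<forall>x. x \<noteq> 0 \<longrightarrow> 0 < x \<bullet> K x)"

text \<open>The integral of the quadratic form \<open>x\<^sup>T K x\<close> along \<open>f\<close>.\<close>

definition cost :: "('e::euclidean_space \<Rightarrow> 'e) \<Rightarrow> real set \<Rightarrow> (real \<Rightarrow> 'e) \<Rightarrow> real" where
  "cost K S f = (LINT t|lebesgue_on S. f t \<bullet> K (f t))"

context
  fixes K :: "'e::euclidean_space \<Rightarrow> 'e"
  assumes K: "pos_op K"
begin

lemma pos_op_linear: "linear K"
  and pos_op_sym: "K x \<bullet> y = x \<bullet> K y"
  and pos_op_pos: "x \<noteq> 0 \<Longrightarrow> 0 < x \<bullet> K x"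
  using K by (auto simp: pos_op_def)

lemma pos_op_nonneg: "0 \<le> x \<bullet> K x"
  using pos_op_pos[of x] by (cases "x = 0") (auto simp: linear_0[OF pos_op_linear])

lemma pos_op_coercive: obtains c where "0 < c" "\<And>x. c * (norm x)\<^sup>2 \<le> x \<bullet> K x"
proof -
  have "continuous_on (sphere 0 1) (\<lambda>x. x \<bullet> K x)"
    using pos_op_linear by (intro continuous_intros linear_continuous_on) (simp add: linear_conv_bounded_linear)
  moreover have "sphere (0::'e) 1 \<noteq> {}" by simp
  ultimately obtain z where z: "z \<in> sphere 0 1" "\<And>x. x \<in> sphere 0 1 \<Longrightarrow> z \<bullet> K z \<le> x \<bullet> K x"
    using continuous_attains_inf[OF compact_sphere, of 0 1 "\<lambda>x. x \<bullet> K x"] by blast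
  have "(z \<bullet> K z) * (norm x)\<^sup>2 \<le> x \<bullet> K x" for x
  proof (cases "x = 0")
    case False
    define y where "y = x /\<^sub>R norm x"
    have "z \<bullet> K z \<le> y \<bullet> K y" using False by (intro z) (simp add: y_def)
    moreover have "x \<bullet> K x = (norm x)\<^sup>2 * (y \<bullet> K y)"
    proof -
      have "x = norm x *\<^sub>R y" using False by (simp add: y_def)
      then have "x \<bullet> K x = (norm x *\<^sub>R y) \<bullet> K (norm x *\<^sub>R y)" by metis
      then show ?thesis by (simp add: linear_scale[OF pos_op_linear] power2_eq_square)
    qed
    ultimately show ?thesis by (simp add: mult.commute[of "(norm x)\<^sup>2"] mult_right_mono)
  qed (simp add: pos_op_nonneg)
  moreover have "0 < z \<bullet> K z" using z(1) by (intro pos_op_pos) auto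
  ultimately show ?thesis using that by blast
qed

lemma pos_op_bounded: obtains C where "0 \<le> C" "\<And>x. x \<bullet> K x \<le> C * (norm x)\<^sup>2"
proof -
  interpret bounded_linear K using pos_op_linear by (simp add: linear_conv_bounded_linear)
  obtain B where B: "0 < B" "\<And>x. norm (K x) \<le> norm x * B" using pos_bounded by blast
  have "x \<bullet> K x \<le> B * (norm x)\<^sup>2" for x
  proof -
    have "x \<bullet> K x \<le> norm x * norm (K x)" by (rule norm_cauchy_schwarz)
    also have "\<dots> \<le> norm x * (norm x * B)" using B by (intro mult_left_mono) auto
    finally show ?thesis by (simp add: power2_eq_square mult_ac)
  qed
  then show ?thesis using that[of B] B by auto
qed

lemma pos_op_expand: "(x + r *\<^sub>R y) \<bullet> K (x + r *\<^sub>R y) = x \<bullet> K x + 2 * r * (x \<bullet> K y) + r\<^sup>2 * (y \<bullet> K y)"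
proof -
  have "y \<bullet> K x = x \<bullet> K y" using pos_op_sym[of x y] by (simp add: inner_commute)
  then show ?thesis
    by (simp add: linear_add[OF pos_op_linear] linear_scale[OF pos_op_linear] inner_add_left
      inner_add_right power2_eq_square algebra_simps)
qed

lemma pos_op_parallelogram:
  "(x - y) \<bullet> K (x - y) = 2 * (x \<bullet> K x) + 2 * (y \<bullet> K y) -
     4 * (((1/2) *\<^sub>R x + (1/2) *\<^sub>R y) \<bullet> K ((1/2) *\<^sub>R x + (1/2) *\<^sub>R y))"
proof -
  have eq: "(1/2) *\<^sub>R x + (1/2) *\<^sub>R y = (1/2) *\<^sub>R (x + 1 *\<^sub>R y)" by (simp add: scaleR_add_right)
  have "(x - y) \<bullet> K (x - y) = (x + (-1) *\<^sub>R y) \<bullet> K (x + (-1) *\<^sub>R y)" by simp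
  also have "\<dots> = x \<bullet> K x - 2 * (x \<bullet> K y) + y \<bullet> K y" by (simp only: pos_op_expand) simp
  also have "\<dots> = 2 * (x \<bullet> K x) + 2 * (y \<bullet> K y) - (x + 1 *\<^sub>R y) \<bullet> K (x + 1 *\<^sub>R y)"
    by (simp only: pos_op_expand) simp
  also have "(x + 1 *\<^sub>R y) \<bullet> K (x + 1 *\<^sub>R y) =
      4 * (((1/2) *\<^sub>R x + (1/2) *\<^sub>R y) \<bullet> K ((1/2) *\<^sub>R x + (1/2) *\<^sub>R y))"
    unfolding eq by (simp add: linear_scale[OF pos_op_linear])
  finally show ?thesis .
qed

lemma L2_on_pos_op: "f \<in> L2_on S \<Longrightarrow> (\<lambda>t. K (f t)) \<in> L2_on S"
  by (rule L2_on_linear[OF pos_op_linear])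

lemma cost_integrable: "f \<in> L2_on S \<Longrightarrow> integrable (lebesgue_on S) (\<lambda>t. f t \<bullet> K (f t))"
  by (intro L2_on_inner_integrable L2_on_pos_op)

lemma cost_nonneg: "0 \<le> cost K S f"
  unfolding cost_def by (intro integral_nonneg_AE AE_I2 pos_op_nonneg)

lemma cost_mono:
  "f \<in> L2_on S \<Longrightarrow> T \<subseteq> S \<Longrightarrow> T \<in> sets lebesgue \<Longrightarrow> S \<in> sets lebesgue \<Longrightarrow> cost K T f \<le> cost K S f"
  unfolding cost_def by (intro integral_lebesgue_on_mono cost_integrable pos_op_nonneg)

lemma cost_expand:
  assumes f: "f \<in> L2_on S" and g: "g \<in> L2_on S"
  shows "cost K S (\<lambda>t. f t + r *\<^sub>R g t) =
    cost K S f + 2 * r * (LINT t|lebesgue_on S. f t \<bullet> K (g t)) + r\<^sup>2 * cost K S g"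
  using cost_integrable[OF f] cost_integrable[OF g] L2_on_inner_integrable[OF f L2_on_pos_op[OF g]]
  unfolding cost_def pos_op_expand by simp

lemma cost_parallelogram:
  assumes f: "f \<in> L2_on S" and g: "g \<in> L2_on S"
  shows "cost K S (\<lambda>t. f t - g t) = 2 * cost K S f + 2 * cost K S g -
    4 * cost K S (\<lambda>t. (1/2) *\<^sub>R f t + (1/2) *\<^sub>R g t)"
  using cost_integrable[OF f] cost_integrable[OF g]
    cost_integrable[OF L2_on_add[OF L2_on_scaleR[OF f, of "1/2"] L2_on_scaleR[OF g, of "1/2"]]]
  unfolding cost_def pos_op_parallelogram by simp

end

subsection \<open>Completeness of the space of square integrable functions\<close>

text \<open>Almost everywhere convergence under a square integrable bound.\<close>

definition L2_dom_conv :: "real set \<Rightarrow> (nat \<Rightarrow> real \<Rightarrow> 'e::euclidean_space) \<Rightarrow> (real \<Rightarrow> 'e) \<Rightarrow> bool" where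
  "L2_dom_conv S f g \<longleftrightarrow> (\<forall>k. f k \<in> L2_on S) \<and> g \<in> L2_on S \<and>
     (AE t in lebesgue_on S. (\<lambda>k. f k t) \<longlonglongrightarrow> g t) \<and>
     (\<exists>D. integrable (lebesgue_on S) D \<and> (AE t in lebesgue_on S. \<forall>k. (norm (f k t))\<^sup>2 \<le> D t))"

text \<open>
  A sequence with \<open>\<parallel>f\<^sub>k\<^sub>+\<^sub>1 - f\<^sub>k\<parallel>\<^sup>2 \<le> 16\<^sup>-\<^sup>k\<close>: the sum \<open>D\<close> of \<open>4\<^sup>k |f\<^sub>k\<^sub>+\<^sub>1 - f\<^sub>k|\<^sup>2\<close> is integrable, and
  wherever it is finite, \<open>|f\<^sub>k\<^sub>+\<^sub>1 - f\<^sub>k| \<le> \<surd>D 2\<^sup>-\<^sup>k\<close>.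
\<close>

lemma L2_dom_conv_lim:
  fixes f :: "nat \<Rightarrow> real \<Rightarrow> 'e::euclidean_space"
  assumes f: "\<And>k. f k \<in> L2_on S"
    and cauchy: "\<And>k. (LINT t|lebesgue_on S. (norm (f (Suc k) t - f k t))\<^sup>2) \<le> (1/16)^k"
  shows "L2_dom_conv S f (\<lambda>t. lim (\<lambda>k. f k t))"
proof -
  let ?M = "lebesgue_on S"
  define d where "d k t = 4^k * (norm (f (Suc k) t - f k t))\<^sup>2" for k t
  have dL2: "(\<lambda>t. f (Suc k) t - f k t) \<in> L2_on S" for k by (intro L2_on_diff f)
  have d_int: "integrable ?M (d k)" for k
    unfolding d_def using L2_on_integrable_sq[OF dL2] by simp
  have d0: "0 \<le> d k t" for k t by (simp add: d_def)
  have dbound: "(LINT t|?M. d k t) \<le> (1/4)^k" for k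
  proof -
    have "(LINT t|?M. d k t) = 4^k * (LINT t|?M. (norm (f (Suc k) t - f k t))\<^sup>2)" by (simp add: d_def)
    also have "\<dots> \<le> 4^k * (1/16)^k" by (intro mult_left_mono cauchy) simp
    also have "\<dots> = (1/4)^k" by (simp flip: power_mult_distrib)
    finally show ?thesis .
  qed
  have geo: "summable (\<lambda>k. (1/4::real)^k)" by (rule summable_geometric) simp
  have sum_int: "summable (\<lambda>k. LINT t|?M. norm (d k t))"
  proof (rule summable_comparison_test'[OF geo, of 0])
    fix k
    have "(LINT t|?M. norm (d k t)) = (LINT t|?M. d k t)" using d0 by simp
    moreover have "0 \<le> (LINT t|?M. d k t)" using d0 by simp
    ultimately show "norm (LINT t|?M. norm (d k t)) \<le> (1/4)^k" using dbound[of k] by simp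
  qed
  have ae_sum: "AE t in ?M. summable (\<lambda>k. norm (d k t))"
  proof -
    have "(\<integral>\<^sup>+t. (\<Sum>k. ennreal (d k t)) \<partial>?M) = (\<Sum>k. \<integral>\<^sup>+t. ennreal (d k t) \<partial>?M)"
      using d_int by (intro nn_integral_suminf) auto
    also have "\<dots> = (\<Sum>k. ennreal (LINT t|?M. d k t))"
      using d_int d0 by (simp add: nn_integral_eq_integral)
    also have "\<dots> \<le> (\<Sum>k. ennreal ((1/4)^k))"
      using dbound by (intro suminf_le summableI ennreal_leI) auto
    also have "\<dots> = ennreal (\<Sum>k. (1/4)^k)" using geo by (intro suminf_ennreal2) auto
    also have "\<dots> < \<infinity>" by simp
    finally have fin: "(\<integral>\<^sup>+t. (\<Sum>k. ennreal (d k t)) \<partial>?M) \<noteq> \<infinity>" by simp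
    have "(\<lambda>t. \<Sum>k. ennreal (d k t)) \<in> borel_measurable ?M"
      using borel_measurable_integrable[OF d_int] by measurable
    from nn_integral_noteq_infinite[OF this fin] have "AE t in ?M. (\<Sum>k. ennreal (d k t)) \<noteq> \<infinity>" .
    then show ?thesis
      by eventually_elim (use d0 in \<open>auto intro!: summable_suminf_not_top\<close>)
  qed
  define D where "D t = (\<Sum>k. d k t)" for t
  have D_int: "integrable ?M D"
    unfolding D_def by (rule integrable_suminf[OF d_int ae_sum sum_int])
  have step: "norm (f (Suc k) t - f k t) \<le> sqrt (D t) * (1/2)^k" if "summable (\<lambda>k. norm (d k t))" for t k
  proof -
    have "summable (\<lambda>k. d k t)" using that d0 by simp
    then have "d k t \<le> D t" unfolding D_def using sum_le_suminf[of "\<lambda>k. d k t" "{k}"] d0 by simp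
    then have "sqrt (d k t) \<le> sqrt (D t)" by simp
    moreover have "sqrt (d k t) = 2^k * norm (f (Suc k) t - f k t)"
    proof -
      have "(4::real)^k = (2^k)\<^sup>2" by (simp add: power2_eq_square flip: power_mult_distrib)
      then show ?thesis by (simp add: d_def real_sqrt_mult)
    qed
    ultimately show ?thesis by (simp add: field_simps power_divide)
  qed
  have geo2: "summable (\<lambda>k. (1/2::real)^k)" by (rule summable_geometric) simp
  have conv: "convergent (\<lambda>k. f k t)" and bd: "(norm (f k t))\<^sup>2 \<le> 2 * (norm (f 0 t))\<^sup>2 + 8 * D t"
    if t: "summable (\<lambda>k. norm (d k t))" for t k
  proof -
    have tel: "(\<Sum>j<n. f (Suc j) t - f j t) = f n t - f 0 t" for n by (rule sum_lessThan_telescope)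
    have sum: "summable (\<lambda>j. f (Suc j) t - f j t)"
      by (rule summable_comparison_test'[OF summable_mult[OF geo2, of "sqrt (D t)"], of 0]) (use step[OF t] in simp)
    from summable_LIMSEQ[OF this] have "(\<lambda>n. f n t - f 0 t) \<longlonglongrightarrow> (\<Sum>j. f (Suc j) t - f j t)"
      by (simp only: tel)
    from tendsto_add[OF this tendsto_const[of "f 0 t"]] show "convergent (\<lambda>k. f k t)"
      by (auto simp: convergent_def)
    have D0: "0 \<le> D t" unfolding D_def using t d0 by (intro suminf_nonneg) simp_all
    have "norm (f k t - f 0 t) \<le> (\<Sum>j<k. norm (f (Suc j) t - f j t))"
      unfolding tel[symmetric] by (rule norm_sum)
    also have "\<dots> \<le> (\<Sum>j<k. sqrt (D t) * (1/2)^j)" by (intro sum_mono step t)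
    also have "\<dots> = sqrt (D t) * (\<Sum>j<k. (1/2)^j)" by (simp add: sum_distrib_left)
    also have "\<dots> \<le> sqrt (D t) * 2"
    proof (intro mult_left_mono)
      have "(\<Sum>j<k. (1/2::real)^j) \<le> (\<Sum>j. (1/2)^j)" using geo2 by (intro sum_le_suminf) auto
      then show "(\<Sum>j<k. (1/2::real)^j) \<le> 2" by (simp add: suminf_geometric)
    qed (use D0 in simp)
    finally have "(norm (f k t - f 0 t))\<^sup>2 \<le> (sqrt (D t) * 2)\<^sup>2" by (rule power_mono) simp
    then have "(norm (f k t - f 0 t))\<^sup>2 \<le> 4 * D t" using D0 by (simp add: power_mult_distrib)
    then show "(norm (f k t))\<^sup>2 \<le> 2 * (norm (f 0 t))\<^sup>2 + 8 * D t"
      using norm_add_sq_le[of "f 0 t" "f k t - f 0 t"] by simp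
  qed
  have D'_int: "integrable ?M (\<lambda>t. 2 * (norm (f 0 t))\<^sup>2 + 8 * D t)"
    using D_int L2_on_integrable_sq[OF f] by simp
  have ae_conv: "AE t in ?M. (\<lambda>k. f k t) \<longlonglongrightarrow> lim (\<lambda>k. f k t)"
    using ae_sum by eventually_elim (use conv in \<open>simp add: convergent_LIMSEQ_iff\<close>)
  have ae_bd: "AE t in ?M. \<forall>k. (norm (f k t))\<^sup>2 \<le> 2 * (norm (f 0 t))\<^sup>2 + 8 * D t"
    using ae_sum by eventually_elim (use bd in blast)
  have "(\<lambda>t. lim (\<lambda>k. f k t)) \<in> L2_on S"
  proof (rule L2_on_dominated[OF _ D'_int])
    show "(\<lambda>t. lim (\<lambda>k. f k t)) \<in> borel_measurable ?M"
      using L2_on_measurable[OF f] by (rule borel_measurable_lim_metric)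
    show "AE t in ?M. (norm (lim (\<lambda>k. f k t)))\<^sup>2 \<le> 2 * (norm (f 0 t))\<^sup>2 + 8 * D t"
      using ae_conv ae_bd
    proof eventually_elim
      case (elim t)
      have "(\<lambda>k. (norm (f k t))\<^sup>2) \<longlonglongrightarrow> (norm (lim (\<lambda>k. f k t)))\<^sup>2"
        using elim(1) by (intro tendsto_intros)
      then show ?case by (rule LIMSEQ_le_const2) (use elim(2) in blast)
    qed
  qed
  then show ?thesis using f ae_conv ae_bd D'_int unfolding L2_dom_conv_def by blast
qed

lemma L2_dom_conv_subset:
  assumes "L2_dom_conv S f g" "T \<subseteq> S" "T \<in> sets lebesgue" "S \<in> sets lebesgue"
  shows "L2_dom_conv T f g"
  using assms L2_on_subset AE_lebesgue_on_subset integrable_lebesgue_on_subset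
  unfolding L2_dom_conv_def by (smt (verit) eventually_mono)

lemma LIMSEQ_linear:
  fixes G :: "'e::euclidean_space \<Rightarrow> 'b::euclidean_space"
  shows "linear G \<Longrightarrow> h \<longlonglongrightarrow> l \<Longrightarrow> (\<lambda>k. G (h k)) \<longlonglongrightarrow> G l"
  by (rule bounded_linear.tendsto[OF linear_conv_bounded_linear[THEN iffD1]])

lemma L2_dom_conv_linear:
  fixes G :: "'e::euclidean_space \<Rightarrow> 'b::euclidean_space"
  assumes conv: "L2_dom_conv {a..b} f g" and G: "linear G"
  shows "(\<lambda>k. LINT t|lebesgue_on {a..b}. G (f k t)) \<longlonglongrightarrow> (LINT t|lebesgue_on {a..b}. G (g t))"
proof -
  have f: "f k \<in> L2_on {a..b}" and g: "g \<in> L2_on {a..b}" for k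
    using conv by (auto simp: L2_dom_conv_def)
  obtain D where D: "integrable (lebesgue_on {a..b}) D"
      "AE t in lebesgue_on {a..b}. \<forall>k. (norm (f k t))\<^sup>2 \<le> D t"
    and lim: "AE t in lebesgue_on {a..b}. (\<lambda>k. f k t) \<longlonglongrightarrow> g t"
    using conv unfolding L2_dom_conv_def by blast
  obtain C where C: "0 \<le> C" "\<And>x. (norm (G x))\<^sup>2 \<le> C * (norm x)\<^sup>2" using linear_bound[OF G] by blast
  show ?thesis
  proof (rule integral_dominated_convergence[where w = "\<lambda>t. 1 + C * D t"])
    show "(\<lambda>t. G (g t)) \<in> borel_measurable (lebesgue_on {a..b})"
      "\<And>k. (\<lambda>t. G (f k t)) \<in> borel_measurable (lebesgue_on {a..b})"
      using L2_on_linear[OF G f] L2_on_linear[OF G g] by (auto simp: L2_on_def)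
    show "integrable (lebesgue_on {a..b}) (\<lambda>t. 1 + C * D t)"
      using D(1) by (simp add: integrable_lebesgue_on_const)
    show "AE t in lebesgue_on {a..b}. (\<lambda>k. G (f k t)) \<longlonglongrightarrow> G (g t)"
      using lim by eventually_elim (rule LIMSEQ_linear[OF G])
    show "AE t in lebesgue_on {a..b}. norm (G (f k t)) \<le> 1 + C * D t" for k
      using D(2)
    proof eventually_elim
      case (elim t)
      have "norm (G (f k t)) \<le> 1 + (norm (G (f k t)))\<^sup>2"
        using sum_squares_bound[of "norm (G (f k t))" 1, unfolded mult_1_right one_power2]
          norm_ge_zero[of "G (f k t)"] by linarith
      also have "\<dots> \<le> 1 + C * (norm (f k t))\<^sup>2" using C(2) by simp
      also have "\<dots> \<le> 1 + C * D t" using C(1) elim by (simp add: mult_left_mono)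
      finally show ?case .
    qed
  qed
qed

lemma L2_dom_conv_cost:
  assumes conv: "L2_dom_conv S f g" and K: "pos_op K"
  shows "(\<lambda>k. cost K S (f k)) \<longlonglongrightarrow> cost K S g"
proof -
  have f: "f k \<in> L2_on S" and g: "g \<in> L2_on S" for k
    using conv by (auto simp: L2_dom_conv_def)
  obtain D where D: "integrable (lebesgue_on S) D" "AE t in lebesgue_on S. \<forall>k. (norm (f k t))\<^sup>2 \<le> D t"
    and lim: "AE t in lebesgue_on S. (\<lambda>k. f k t) \<longlonglongrightarrow> g t"
    using conv unfolding L2_dom_conv_def by blast
  obtain C where C: "0 \<le> C" "\<And>x. x \<bullet> K x \<le> C * (norm x)\<^sup>2" using pos_op_bounded[OF K] by blast
  show ?thesis
    unfolding cost_def
  proof (rule integral_dominated_convergence[where w = "\<lambda>t. C * D t"])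
    show "(\<lambda>t. g t \<bullet> K (g t)) \<in> borel_measurable (lebesgue_on S)"
      "\<And>k. (\<lambda>t. f k t \<bullet> K (f k t)) \<in> borel_measurable (lebesgue_on S)"
      using cost_integrable[OF K f] cost_integrable[OF K g] by auto
    show "integrable (lebesgue_on S) (\<lambda>t. C * D t)" using D(1) by simp
    show "AE t in lebesgue_on S. (\<lambda>k. f k t \<bullet> K (f k t)) \<longlonglongrightarrow> g t \<bullet> K (g t)"
      using lim by eventually_elim (intro tendsto_inner LIMSEQ_linear[OF pos_op_linear[OF K]])
    show "AE t in lebesgue_on S. norm (f k t \<bullet> K (f k t)) \<le> C * D t" for k
      using D(2)
    proof eventually_elim
      case (elim t)
      have "f k t \<bullet> K (f k t) \<le> C * (norm (f k t))\<^sup>2" by (rule C(2))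
      also have "\<dots> \<le> C * D t" using C(1) elim by (intro mult_left_mono) auto
      finally show ?case using pos_op_nonneg[OF K] by simp
    qed
  qed
qed

lemma L2_dom_conv_inner:
  assumes conv: "L2_dom_conv S f g" and h: "h \<in> L2_on S"
  shows "(\<lambda>k. LINT t|lebesgue_on S. f k t \<bullet> h t) \<longlonglongrightarrow> (LINT t|lebesgue_on S. g t \<bullet> h t)"
proof -
  have f: "f k \<in> L2_on S" and g: "g \<in> L2_on S" for k
    using conv by (auto simp: L2_dom_conv_def)
  obtain D where D: "integrable (lebesgue_on S) D" "AE t in lebesgue_on S. \<forall>k. (norm (f k t))\<^sup>2 \<le> D t"
    and lim: "AE t in lebesgue_on S. (\<lambda>k. f k t) \<longlonglongrightarrow> g t"
    using conv unfolding L2_dom_conv_def by blast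
  show ?thesis
  proof (rule integral_dominated_convergence[where w = "\<lambda>t. D t + (norm (h t))\<^sup>2"])
    show "(\<lambda>t. g t \<bullet> h t) \<in> borel_measurable (lebesgue_on S)"
      "\<And>k. (\<lambda>t. f k t \<bullet> h t) \<in> borel_measurable (lebesgue_on S)"
      using L2_on_inner_integrable[OF f h] L2_on_inner_integrable[OF g h] by auto
    show "integrable (lebesgue_on S) (\<lambda>t. D t + (norm (h t))\<^sup>2)"
      using D(1) L2_on_integrable_sq[OF h] by simp
    show "AE t in lebesgue_on S. (\<lambda>k. f k t \<bullet> h t) \<longlonglongrightarrow> g t \<bullet> h t"
      using lim by eventually_elim (intro tendsto_intros)
    show "AE t in lebesgue_on S. norm (f k t \<bullet> h t) \<le> D t + (norm (h t))\<^sup>2" for k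
      using D(2)
    proof eventually_elim
      case (elim t)
      have "\<bar>f k t \<bullet> h t\<bar> \<le> norm (f k t) * norm (h t)" by (rule Cauchy_Schwarz_ineq2)
      also have "\<dots> \<le> (norm (f k t))\<^sup>2 + (norm (h t))\<^sup>2"
        using sum_squares_bound[of "norm (f k t)" "norm (h t)"]
          mult_nonneg_nonneg[OF norm_ge_zero[of "f k t"] norm_ge_zero[of "h t"]] by linarith
      finally show ?case using elim[rule_format, of k] by simp
    qed
  qed
qed

text \<open>
  The same with energies replaced by a positive definite cost; for minimising sequences, the bound
  on the cost of the differences will come from the parallelogram identity.
\<close>

lemma L2_dom_conv_of_cost:
  fixes K :: "'e::euclidean_space \<Rightarrow> 'e"
  assumes K: "pos_op K" and c: "0 < c" "\<And>x. c * (norm x)\<^sup>2 \<le> x \<bullet> K x"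
    and f: "\<And>k. f k \<in> L2_on S"
    and cauchy: "\<And>k. cost K S (\<lambda>t. f (Suc k) t - f k t) \<le> c * (1/16)^k"
  shows "L2_dom_conv S f (\<lambda>t. lim (\<lambda>k. f k t))"
proof (rule L2_dom_conv_lim[OF f])
  fix k
  have d: "(\<lambda>t. f (Suc k) t - f k t) \<in> L2_on S" by (intro L2_on_diff f)
  have "c * (LINT t|lebesgue_on S. (norm (f (Suc k) t - f k t))\<^sup>2) =
      (LINT t|lebesgue_on S. c * (norm (f (Suc k) t - f k t))\<^sup>2)" by simp
  also have "\<dots> \<le> cost K S (\<lambda>t. f (Suc k) t - f k t)"
    unfolding cost_def using L2_on_integrable_sq[OF d] cost_integrable[OF K d] c(2)
    by (intro integral_mono) auto
  also note cauchy[of k]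
  finally show "(LINT t|lebesgue_on S. (norm (f (Suc k) t - f k t))\<^sup>2) \<le> (1/16)^k"
    using c(1) by simp
qed

section \<open>The infinite horizon optimal control problem\<close>

text \<open>
  The minimal costs \<open>v\<^sub>n\<close> on \<open>[0, n]\<close> increase to a limit \<open>v\<close>, and near-minimisers on growing horizons
  converge on every bounded interval to a solution of cost at most \<open>v\<close>.
\<close>

lemma lin_sol_optimal:
  fixes E G :: "'e::euclidean_space \<Rightarrow> 'b::euclidean_space" and K :: "'e \<Rightarrow> 'e"
  assumes E: "linear E" and G: "linear G" and K: "pos_op K"
    and bounded: "\<And>n::nat. \<exists>\<xi> W. lin_sol E G {0..real n} \<xi> W \<and> W 0 = e \<and> cost K {0..real n} \<xi> \<le> C"
  obtains \<xi> W v where "lin_sol E G {0..} \<xi> W" "W 0 = e" "\<And>T. 0 \<le> T \<Longrightarrow> cost K {0..T} \<xi> \<le> v"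
    "\<And>\<epsilon>. 0 < \<epsilon> \<Longrightarrow> \<exists>n::nat. \<forall>\<zeta> Z. lin_sol E G {0..real n} \<zeta> Z \<longrightarrow> Z 0 = e \<longrightarrow> v - \<epsilon> < cost K {0..real n} \<zeta>"
proof -
  define V where "V n = {cost K {0..real n} \<zeta> |\<zeta>. \<exists>Z. lin_sol E G {0..real n} \<zeta> Z \<and> Z 0 = e}" for n :: nat
  define v where "v n = Inf (V n)" for n
  have L2: "\<zeta> \<in> L2_on {0..real n}" if "lin_sol E G {0..real n} \<zeta> Z" for \<zeta> Z and n :: nat
    using lin_sol_L2[OF that] by (simp add: L2_loc_Icc)
  have restrict: "lin_sol E G {0..real n} \<zeta> Z" if "lin_sol E G {0..real m} \<zeta> Z" "n \<le> m" for \<zeta> Z and n m :: nat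
    using that by (intro lin_sol_restrict[OF E G that(1)]) auto
  have bdd: "bdd_below (V n)" for n
    by (rule bdd_belowI[of _ 0]) (auto simp: V_def cost_nonneg[OF K])
  have ne: "V n \<noteq> {}" for n unfolding V_def using bounded[of n] by blast
  have v_le: "v n \<le> cost K {0..real n} \<zeta>" if "lin_sol E G {0..real n} \<zeta> Z" "Z 0 = e" for n \<zeta> Z
    unfolding v_def using that by (intro cInf_lower bdd) (auto simp: V_def)
  have v_mono: "v n \<le> v m" if "n \<le> m" for n m
    unfolding v_def[of m]
  proof (rule cInf_greatest[OF ne])
    fix x assume "x \<in> V m"
    then obtain \<zeta> Z where z: "lin_sol E G {0..real m} \<zeta> Z" "Z 0 = e" "x = cost K {0..real m} \<zeta>"
      unfolding V_def by blast
    have "v n \<le> cost K {0..real n} \<zeta>" by (rule v_le[OF restrict[OF z(1) that] z(2)])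
    also have "\<dots> \<le> x" unfolding z(3) using that by (intro cost_mono[OF K L2[OF z(1)]]) auto
    finally show "v n \<le> x" .
  qed
  have v_bound: "v n \<le> C" for n
  proof -
    obtain \<zeta> Z where "lin_sol E G {0..real n} \<zeta> Z" "Z 0 = e" "cost K {0..real n} \<zeta> \<le> C"
      using bounded[of n] by blast
    then show ?thesis using v_le[of n \<zeta> Z] by linarith
  qed
  define v' where "v' = Sup (range v)"
  have bdd_v: "bdd_above (range v)" using v_bound by (auto intro!: bdd_aboveI[of _ C])
  have v_le': "v n \<le> v'" for n
    unfolding v'_def by (intro cSup_upper bdd_v) auto
  have v_approx: "\<exists>n. v' - \<epsilon> < v n" if "0 < \<epsilon>" for \<epsilon>
    using that less_cSup_iff[OF _ bdd_v, of "v' - \<epsilon>"] unfolding v'_def by auto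
  obtain c where c: "0 < c" "\<And>x. c * (norm x)\<^sup>2 \<le> x \<bullet> K x" using pos_op_coercive[OF K] by blast
  \<comment> \<open>minimisers up to \<open>\<kappa> j\<close> differ by at most \<open>8 \<kappa> j\<close> in cost, hence by \<open>16\<^sup>-\<^sup>j\<close> in energy\<close>
  define \<kappa> where "\<kappa> j = c / 8 * (1/16)^j" for j :: nat
  have \<kappa>: "0 < \<kappa> j" "\<kappa> (Suc j) \<le> \<kappa> j" for j using c(1) by (auto simp: \<kappa>_def)
  have "\<exists>N. \<forall>j. v' - \<kappa> j < v (N j)" using v_approx[OF \<kappa>(1)] by (intro choice) blast
  then obtain N where N: "\<And>j. v' - \<kappa> j < v (N j)" by blast
  \<comment> \<open>increasing horizons \<open>n j \<ge> j\<close> on which the minimal cost is within \<open>\<kappa> j\<close> of its supremum\<close>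
  define n where "n j = (\<Sum>i\<le>j. N i) + j" for j
  have nN: "N j \<le> n j" for j unfolding n_def by (simp add: trans_le_add1 member_le_sum)
  have nj: "j \<le> n j" for j by (simp add: n_def)
  have nSuc: "n j \<le> n (Suc j)" for j by (simp add: n_def)
  have vn: "v' - \<kappa> j < v (n j)" for j using N[of j] v_mono[OF nN[of j]] by linarith
  have "\<exists>\<xi> W. lin_sol E G {0..real (n j)} \<xi> W \<and> W 0 = e \<and> cost K {0..real (n j)} \<xi> < v (n j) + \<kappa> j" for j
  proof -
    have "Inf (V (n j)) < v (n j) + \<kappa> j" using \<kappa>(1)[of j] by (simp add: v_def)
    from cInf_lessD[OF ne this] show ?thesis unfolding V_def by blast
  qed
  then obtain \<xi> W where s: "\<And>j. lin_sol E G {0..real (n j)} (\<xi> j) (W j)" "\<And>j. W j 0 = e"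
      "\<And>j. cost K {0..real (n j)} (\<xi> j) < v (n j) + \<kappa> j" by metis
  have up: "cost K {0..real (n j)} (\<xi> j) \<le> v' + \<kappa> j" for j using s(3)[of j] v_le'[of "n j"] by linarith
  have cau: "cost K {0..real (n j)} (\<lambda>t. \<xi> (Suc j) t - \<xi> j t) \<le> c * (1/16)^j" for j
  proof -
    have s': "lin_sol E G {0..real (n j)} (\<xi> (Suc j)) (W (Suc j))" by (rule restrict[OF s(1) nSuc])
    have "v (n j) \<le> cost K {0..real (n j)} (\<lambda>t. (1/2) *\<^sub>R \<xi> (Suc j) t + (1/2) *\<^sub>R \<xi> j t)"
    proof (rule v_le)
      show "lin_sol E G {0..real (n j)} (\<lambda>t. (1/2) *\<^sub>R \<xi> (Suc j) t + (1/2) *\<^sub>R \<xi> j t)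
        (\<lambda>t. (1/2) *\<^sub>R W (Suc j) t + (1/2) *\<^sub>R W j t)"
        by (rule lin_sol_lincomb[OF E G s' s(1)]) auto
    qed (simp add: s(2) flip: scaleR_add_left)
    moreover have "cost K {0..real (n j)} (\<xi> (Suc j)) \<le> cost K {0..real (n (Suc j))} (\<xi> (Suc j))"
      using nSuc[of j] by (intro cost_mono[OF K L2[OF s(1)]]) auto
    ultimately have "cost K {0..real (n j)} (\<lambda>t. \<xi> (Suc j) t - \<xi> j t) \<le> 8 * \<kappa> j"
      using cost_parallelogram[OF K L2[OF s'] L2[OF s(1)]] up[of j] up[of "Suc j"] \<kappa>(2)[of j] vn[of j]
      by linarith
    then show ?thesis by (simp add: \<kappa>_def)
  qed
  define g where "g t = lim (\<lambda>j. \<xi> j t)" for t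
  have conv: "L2_dom_conv {0..real m} (\<lambda>j. \<xi> (j + m)) g" for m
  proof -
    have f: "\<xi> (j + m) \<in> L2_on {0..real m}" for j
      using nj[of "j + m"] by (intro L2[OF restrict[OF s(1)]]) auto
    have "L2_dom_conv {0..real m} (\<lambda>j. \<xi> (j + m)) (\<lambda>t. lim (\<lambda>j. \<xi> (j + m) t))"
    proof (rule L2_dom_conv_of_cost[OF K c f])
      fix j
      have "cost K {0..real m} (\<lambda>t. \<xi> (Suc j + m) t - \<xi> (j + m) t) \<le>
        cost K {0..real (n (j + m))} (\<lambda>t. \<xi> (Suc (j + m)) t - \<xi> (j + m) t)"
        using nj[of "j + m"] L2[OF restrict[OF s(1) nSuc[of "j + m"]]] L2[OF s(1)[of "j + m"]]
        by (simp, intro cost_mono[OF K] L2_on_diff) auto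
      also have "\<dots> \<le> c * (1/16)^(j + m)" by (rule cau)
      also have "\<dots> \<le> c * (1/16)^j" using c(1) by (intro mult_left_mono power_decreasing) auto
      finally show "cost K {0..real m} (\<lambda>t. \<xi> (Suc j + m) t - \<xi> (j + m) t) \<le> c * (1/16)^j" .
    qed
    moreover have "lim (\<lambda>j. \<xi> (j + m) t) = g t" for t
      unfolding g_def lim_def
      by (intro arg_cong[where f = The] ext iffI LIMSEQ_ignore_initial_segment)
        (rule LIMSEQ_offset)
    ultimately show ?thesis by simp
  qed
  have gL2: "g \<in> L2_on {0..real m}" for m using conv[of m] by (simp add: L2_dom_conv_def)
  define Wg where "Wg t = e + (LINT s|lebesgue_on {0..t}. G (g s))" for t
  have lim_W: "(\<lambda>j. W (j + m) t) \<longlonglongrightarrow> Wg t" if t: "t \<in> {0..real m}" for m t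
  proof -
    have "L2_dom_conv {0..t} (\<lambda>j. \<xi> (j + m)) g"
      using t by (intro L2_dom_conv_subset[OF conv[of m]]) auto
    then have "(\<lambda>j. LINT s|lebesgue_on {0..t}. G (\<xi> (j + m) s)) \<longlonglongrightarrow> (LINT s|lebesgue_on {0..t}. G (g s))"
      by (rule L2_dom_conv_linear[OF _ G])
    then have "(\<lambda>j. e + (LINT s|lebesgue_on {0..t}. G (\<xi> (j + m) s))) \<longlonglongrightarrow> Wg t"
      unfolding Wg_def by (intro tendsto_add tendsto_const)
    moreover have "W (j + m) t = e + (LINT s|lebesgue_on {0..t}. G (\<xi> (j + m) s))" for j
    proof -
      have "t \<in> {0..real (n (j + m))}" using t nj[of "j + m"] by auto
      from lin_sol_eq[OF s(1) this] show ?thesis by (simp add: s(2))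
    qed
    ultimately show ?thesis by simp
  qed
  have sol: "lin_sol E G {0..} g Wg"
  proof (rule lin_sol_atLeastI[OF E G])
    fix m :: nat
    have "AE t in lebesgue_on {0..real m}. W (j + m) t = E (\<xi> (j + m) t)" for j
      using nj[of "j + m"] by (intro AE_lebesgue_on_subset[OF lin_sol_AE[OF s(1)]]) auto
    then have "AE t in lebesgue_on {0..real m}. \<forall>j. W (j + m) t = E (\<xi> (j + m) t)"
      by (intro AE_all_countable[THEN iffD2] allI)
    moreover have "AE t in lebesgue_on {0..real m}. (\<lambda>j. \<xi> (j + m) t) \<longlonglongrightarrow> g t"
      using conv[of m] by (simp add: L2_dom_conv_def)
    moreover have "AE t in lebesgue_on {0..real m}. t \<in> {0..real m}"
      by (rule AE_I2) (simp add: space_restrict_space)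
    ultimately have "AE t in lebesgue_on {0..real m}. Wg t = E (g t)"
    proof eventually_elim
      case (elim t)
      have "(\<lambda>j. W (j + m) t) \<longlonglongrightarrow> E (g t)"
        using LIMSEQ_linear[OF E elim(2)] elim(1) by simp
      then show ?case using lim_W[OF elim(3)] LIMSEQ_unique by blast
    qed
    moreover have "g \<in> L2_loc {0..real m}" using gL2 by (simp add: L2_loc_Icc)
    moreover have "Wg 0 = e" by (simp add: Wg_def integral_lebesgue_on_singleton)
    ultimately show "lin_sol E G {0..real m} g Wg"
      unfolding lin_sol_def by (simp add: Wg_def)
  qed
  have Wg0: "Wg 0 = e"
    using lim_W[of 0 0] s(2) by (simp add: LIMSEQ_const_iff)
  have costg: "cost K {0..T} g \<le> v'" if "0 \<le> T" for T
  proof -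
    obtain m :: nat where m: "T \<le> real m" using real_arch_simple by blast
    have "(\<lambda>j. cost K {0..real m} (\<xi> (j + m))) \<longlonglongrightarrow> cost K {0..real m} g"
      by (rule L2_dom_conv_cost[OF conv K])
    moreover have "(\<lambda>j. v' + \<kappa> (j + m)) \<longlonglongrightarrow> v'"
    proof -
      have "(\<lambda>j. \<kappa> j) \<longlonglongrightarrow> c / 8 * 0" unfolding \<kappa>_def by (intro tendsto_mult tendsto_const LIMSEQ_power_zero) simp
      then have "(\<lambda>j. v' + \<kappa> j) \<longlonglongrightarrow> v' + 0" by (intro tendsto_add tendsto_const) simp
      then show ?thesis using LIMSEQ_ignore_initial_segment by fastforce
    qed
    moreover have "cost K {0..real m} (\<xi> (j + m)) \<le> v' + \<kappa> (j + m)" for j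
    proof -
      have "cost K {0..real m} (\<xi> (j + m)) \<le> cost K {0..real (n (j + m))} (\<xi> (j + m))"
        using nj[of "j + m"] by (intro cost_mono[OF K L2[OF s(1)]]) auto
      then show ?thesis using up[of "j + m"] by linarith
    qed
    ultimately have "cost K {0..real m} g \<le> v'" by (intro LIMSEQ_le) auto
    moreover have "cost K {0..T} g \<le> cost K {0..real m} g" using m by (intro cost_mono[OF K gL2]) auto
    ultimately show ?thesis by linarith
  qed
  show ?thesis
  proof (rule that[OF sol Wg0 costg])
    fix \<epsilon> :: real assume "0 < \<epsilon>"
    from v_approx[OF this] obtain n where "v' - \<epsilon> < v n" by blast
    then show "\<exists>n::nat. \<forall>\<zeta> Z. lin_sol E G {0..real n} \<zeta> Z \<longrightarrow> Z 0 = e \<longrightarrow> v' - \<epsilon> < cost K {0..real n} \<zeta>"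
      using v_le by (intro exI[of _ n]) fastforce
  qed
qed

section \<open>Representation of bounded functionals\<close>

text \<open>
  The graph \<open>\<Gamma>\<close> of a linear functional on a space of square integrable functions, with
  \<open>\<phi>\<^sup>2 \<le> s \<cdot> cost h\<close>.  The representing function is the limit of a maximising sequence of
  \<open>2 \<phi> - cost h\<close>; that it is a limit of members of the space is also recorded.
\<close>

lemma bounded_functional_representation:
  fixes \<Gamma> :: "((real \<Rightarrow> 'e::euclidean_space) \<times> real) set" and K :: "'e \<Rightarrow> 'e"
  assumes K: "pos_op K" and L2: "\<And>h \<phi>. (h, \<phi>) \<in> \<Gamma> \<Longrightarrow> h \<in> L2_on S"
    and lincomb: "\<And>h \<phi> k \<psi> a b. (h, \<phi>) \<in> \<Gamma> \<Longrightarrow> (k, \<psi>) \<in> \<Gamma> \<Longrightarrow>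
      (\<lambda>t. a *\<^sub>R h t + b *\<^sub>R k t, a * \<phi> + b * \<psi>) \<in> \<Gamma>"
    and ne: "\<Gamma> \<noteq> {}" and s: "0 \<le> s"
    and bounded: "\<And>h \<phi>. (h, \<phi>) \<in> \<Gamma> \<Longrightarrow> \<phi>\<^sup>2 \<le> s * cost K S h"
  obtains g hs where "g \<in> L2_on S" "\<And>h \<phi>. (h, \<phi>) \<in> \<Gamma> \<Longrightarrow> \<phi> = (LINT t|lebesgue_on S. g t \<bullet> K (h t))"
    "cost K S g \<le> s" "\<And>k::nat. hs k \<in> fst ` \<Gamma>" "AE t in lebesgue_on S. (\<lambda>k. hs k t) \<longlonglongrightarrow> g t"
proof -
  define \<Psi> where "\<Psi> p = 2 * snd p - cost K S (fst p)" for p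
  have \<Psi>_le: "\<Psi> p \<le> s" if "p \<in> \<Gamma>" for p
  proof -
    obtain h \<phi> where p: "p = (h, \<phi>)" by force
    have N: "0 \<le> cost K S h" by (rule cost_nonneg[OF K])
    have "(2 * \<phi>)\<^sup>2 \<le> 4 * (s * cost K S h)" using bounded that p by (simp add: power_mult_distrib)
    also have "\<dots> \<le> (s + cost K S h)\<^sup>2"
      using sum_squares_bound[of s "cost K S h"] by (simp add: power2_sum)
    finally have "2 * \<phi> \<le> s + cost K S h" by (rule power2_le_imp_le) (use s N in simp)
    then show ?thesis by (simp add: \<Psi>_def p)
  qed
  define m where "m = Sup (\<Psi> ` \<Gamma>)"
  have bdd: "bdd_above (\<Psi> ` \<Gamma>)" using \<Psi>_le by (auto intro!: bdd_aboveI)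
  have \<Psi>_m: "\<Psi> p \<le> m" if "p \<in> \<Gamma>" for p unfolding m_def using bdd that by (intro cSup_upper) auto
  obtain c where c: "0 < c" "\<And>x. c * (norm x)\<^sup>2 \<le> x \<bullet> K x" using pos_op_coercive[OF K] by blast
  define \<kappa> where "\<kappa> j = c / 4 * (1/16)^j" for j :: nat
  have \<kappa>: "0 < \<kappa> j" "\<kappa> (Suc j) \<le> \<kappa> j" for j using c(1) by (auto simp: \<kappa>_def)
  have \<kappa>_lim: "\<kappa> \<longlonglongrightarrow> 0"
  proof -
    have "(\<lambda>j. \<kappa> j) \<longlonglongrightarrow> c / 4 * 0"
      unfolding \<kappa>_def by (intro tendsto_mult tendsto_const LIMSEQ_power_zero) simp
    then show ?thesis by simp
  qed
  have "\<exists>p. p \<in> \<Gamma> \<and> m - \<kappa> j < \<Psi> p" for j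
  proof -
    have "m - \<kappa> j < Sup (\<Psi> ` \<Gamma>)" using \<kappa>(1)[of j] by (simp add: m_def)
    then show ?thesis using bdd ne by (subst (asm) less_cSup_iff) auto
  qed
  then obtain p where p: "\<And>j. p j \<in> \<Gamma>" "\<And>j. m - \<kappa> j < \<Psi> (p j)" by metis
  define f where "f j = fst (p j)" for j
  define w where "w j = snd (p j)" for j
  have fw: "(f j, w j) \<in> \<Gamma>" for j using p(1) by (simp add: f_def w_def)
  have fL2: "f j \<in> L2_on S" for j by (rule L2[OF fw])
  have \<Psi>f: "\<Psi> (p j) = 2 * w j - cost K S (f j)" for j by (simp add: \<Psi>_def f_def w_def)
  define g where "g t = lim (\<lambda>j. f j t)" for t
  have conv: "L2_dom_conv S f g"
    unfolding g_def[abs_def]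
  proof (rule L2_dom_conv_of_cost[OF K c fL2])
    fix j
    have "((\<lambda>t. (1/2) *\<^sub>R f (Suc j) t + (1/2) *\<^sub>R f j t), 1/2 * w (Suc j) + 1/2 * w j) \<in> \<Gamma>"
      by (intro lincomb fw)
    from \<Psi>_m[OF this] have "w (Suc j) + w j - cost K S (\<lambda>t. (1/2) *\<^sub>R f (Suc j) t + (1/2) *\<^sub>R f j t) \<le> m"
      by (simp add: \<Psi>_def)
    then have "cost K S (\<lambda>t. f (Suc j) t - f j t) \<le> 4 * \<kappa> j"
      using cost_parallelogram[OF K fL2 fL2, of "Suc j" j] p(2)[of j] p(2)[of "Suc j"] \<kappa>(2)[of j]
      unfolding \<Psi>f by linarith
    then show "cost K S (\<lambda>t. f (Suc j) t - f j t) \<le> c * (1/16)^j" by (simp add: \<kappa>_def)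
  qed
  have gL2: "g \<in> L2_on S" using conv by (simp add: L2_dom_conv_def)
  have rep: "\<phi> = (LINT t|lebesgue_on S. g t \<bullet> K (h t))" if h: "(h, \<phi>) \<in> \<Gamma>" for h \<phi>
  proof -
    define B where "B = (LINT t|lebesgue_on S. g t \<bullet> K (h t))"
    define N where "N = cost K S h"
    have N: "0 \<le> N" unfolding N_def by (rule cost_nonneg[OF K])
    have lim: "(\<lambda>j. LINT t|lebesgue_on S. f j t \<bullet> K (h t)) \<longlonglongrightarrow> B"
      unfolding B_def by (rule L2_dom_conv_inner[OF conv L2_on_pos_op[OF K L2[OF h]]])
    \<comment> \<open>moving the maximising sequence by \<open>r h\<close> does not raise \<open>\<Psi>\<close> above its supremum\<close>
    have var: "2 * r * (\<phi> - B) \<le> r\<^sup>2 * N" for r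
    proof -
      have le: "2 * r * (\<phi> - (LINT t|lebesgue_on S. f j t \<bullet> K (h t))) \<le> r\<^sup>2 * N + \<kappa> j" for j
      proof -
        have "((\<lambda>t. 1 *\<^sub>R f j t + r *\<^sub>R h t), 1 * w j + r * \<phi>) \<in> \<Gamma>" by (intro lincomb fw h)
        from \<Psi>_m[OF this] have "2 * (w j + r * \<phi>) - cost K S (\<lambda>t. f j t + r *\<^sub>R h t) \<le> m"
          by (simp add: \<Psi>_def)
        then show ?thesis
          unfolding cost_expand[OF K fL2 L2[OF h]] N_def using p(2)[of j] \<Psi>f[of j]
          by (simp add: algebra_simps)
      qed
      have "(\<lambda>j. 2 * r * (\<phi> - (LINT t|lebesgue_on S. f j t \<bullet> K (h t)))) \<longlonglongrightarrow> 2 * r * (\<phi> - B)"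
        by (intro tendsto_intros lim)
      moreover have "(\<lambda>j. r\<^sup>2 * N + \<kappa> j) \<longlonglongrightarrow> r\<^sup>2 * N + 0" by (intro tendsto_intros \<kappa>_lim)
      ultimately show ?thesis using le by (intro LIMSEQ_le) auto
    qed
    define \<delta> where "\<delta> = \<phi> - B"
    define r where "r = \<delta> / (N + 1)"
    have \<delta>: "\<delta> = r * (N + 1)" using N by (simp add: r_def)
    have "2 * r * (r * (N + 1)) \<le> r\<^sup>2 * N" using var[of r] unfolding \<delta>_def[symmetric] \<delta> .
    then have "r\<^sup>2 * (N + 2) \<le> 0" by (simp add: algebra_simps power2_eq_square)
    then have "r = 0" using N by (simp add: mult_le_0_iff)
    then have "\<delta> = 0" using \<delta> by simp
    then show ?thesis by (simp add: \<delta>_def B_def)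
  qed
  have "cost K S g \<le> s"
  proof -
    have "(\<lambda>j. LINT t|lebesgue_on S. f j t \<bullet> K (g t)) \<longlonglongrightarrow> cost K S g"
      unfolding cost_def by (rule L2_dom_conv_inner[OF conv L2_on_pos_op[OF K gL2]])
    moreover have "w j = (LINT t|lebesgue_on S. f j t \<bullet> K (g t))" for j
    proof -
      have "g t \<bullet> K (f j t) = f j t \<bullet> K (g t)" for t by (metis inner_commute pos_op_sym[OF K])
      then show ?thesis unfolding rep[OF fw] by simp
    qed
    ultimately have "w \<longlonglongrightarrow> cost K S g" by presburger
    then have "(\<lambda>j. 2 * w j - cost K S (f j)) \<longlonglongrightarrow> 2 * cost K S g - cost K S g"
      by (intro tendsto_intros L2_dom_conv_cost[OF conv K])
    moreover have "2 * w j - cost K S (f j) \<le> s" for j using \<Psi>_le[OF p(1)] by (simp add: \<Psi>f)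
    ultimately have "2 * cost K S g - cost K S g \<le> s" by (intro LIMSEQ_le_const2) auto
    then show ?thesis by simp
  qed
  moreover have "f j \<in> fst ` \<Gamma>" for j using fw[of j] by force
  moreover have "AE t in lebesgue_on S. (\<lambda>k. f k t) \<longlonglongrightarrow> g t" using conv by (simp add: L2_dom_conv_def)
  ultimately show ?thesis using that[of g f] gL2 rep by blast
qed

section \<open>The pseudoinverse and the terminal cost\<close>

text \<open>Products with a transposed matrix are kept in the form \<open>transpose M *v x\<close>.\<close>

declare transpose_matrix_vector [simp del]

lemma inner_matrix_transpose:
  fixes M :: "real^'n^'m"
  shows "(M *v x) \<bullet> y = x \<bullet> (transpose M *v y)"
  by (metis dot_lmul_matrix transpose_matrix_vector inner_commute)

lemma inner_transpose_matrix:
  fixes M :: "real^'n^'m"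
  shows "(transpose M *v x) \<bullet> y = x \<bullet> (M *v y)"
  using inner_matrix_transpose[of "transpose M" x y] by simp

lemma symmetric_matrixI:
  fixes M :: "real^'n^'n"
  assumes "\<And>x y. (M *v x) \<bullet> y = x \<bullet> (M *v y)"
  shows "transpose M = M"
proof -
  have "x \<bullet> (transpose M *v y - M *v y) = 0" for x y
    using assms[of x y] by (simp add: inner_matrix_transpose inner_diff_right)
  then have "transpose M *v y = M *v y" for y
    by (metis inner_eq_zero_iff right_minus_eq)
  then show ?thesis by (simp add: matrix_eq)
qed

text \<open>
  Every \<open>y\<close> has a least squares solution \<open>x\<close> of \<open>M x = y\<close> in the row space of \<open>M\<close>; it is unique, hence
  linear in \<open>y\<close>, and its matrix satisfies the four Penrose equations.
\<close>

lemma least_squares_exists: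
  fixes M :: "real^'n^'m"
  shows "\<exists>z. transpose M *v (y - M *v (transpose M *v z)) = 0"
proof -
  have sub: "subspace (range ((*v) M))" "subspace (range ((*v) (transpose M)))"
    by (intro linear_subspace_image matrix_vector_mul_linear subspace_UNIV)+
  obtain a b where ab: "a \<in> span (range ((*v) M))" "\<And>w. w \<in> span (range ((*v) M)) \<Longrightarrow> orthogonal b w" "y = a + b"
    using orthogonal_subspace_decomp_exists by blast
  have a: "a \<in> range ((*v) M)" using ab(1) sub(1) by (metis span_eq_iff)
  have b: "orthogonal b (M *v w)" for w using ab(2) by (simp add: span_base)
  then have bz: "transpose M *v b = 0"
    by (metis inner_eq_zero_iff inner_matrix_transpose inner_commute orthogonal_def)
  obtain x where x: "a = M *v x" using a by blast
  obtain c d where cd: "c \<in> span (range ((*v) (transpose M)))"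
    "\<And>w. w \<in> span (range ((*v) (transpose M))) \<Longrightarrow> orthogonal d w" "x = c + d"
    using orthogonal_subspace_decomp_exists by blast
  have "c \<in> range ((*v) (transpose M))" using cd(1) sub(2) by (metis span_eq_iff)
  then obtain z where z: "c = transpose M *v z" by blast
  have "orthogonal d (transpose M *v w)" for w using cd(2) by (simp add: span_base)
  then have "M *v d = 0"
    by (metis inner_eq_zero_iff inner_matrix_transpose orthogonal_def)
  then have "M *v (transpose M *v z) = a" using x cd(3) z by (simp add: matrix_vector_right_distrib)
  then show ?thesis using bz ab(3) by (intro exI[of _ z]) simp
qed

lemma pinv_is_pinv:
  fixes M :: "real^'n^'m"
  shows "is_pinv M (pinv M)"
proof -
  obtain f where f: "\<And>y. transpose M *v (y - M *v (transpose M *v f y)) = 0"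
    using least_squares_exists[of M] by metis
  define T where "T y = transpose M *v f y" for y
  have normal: "transpose M *v (y - M *v T y) = 0" for y using f by (simp add: T_def)
  have kerM: "M *v x = 0" if "transpose M *v (M *v x) = 0" for x
  proof -
    have "(M *v x) \<bullet> (M *v x) = x \<bullet> (transpose M *v (M *v x))" by (rule inner_matrix_transpose)
    then show ?thesis using that by simp
  qed
  have unique: "transpose M *v z = T y" if "transpose M *v (y - M *v (transpose M *v z)) = 0" for y z
  proof -
    have diff: "transpose M *v (z - f y) = transpose M *v z - T y"
      by (simp add: T_def matrix_vector_mult_diff_distrib)
    have "transpose M *v (M *v (transpose M *v (z - f y))) = 0"
      using that normal[of y] unfolding diff by (simp add: matrix_vector_mult_diff_distrib)
    then have "M *v (transpose M *v (z - f y)) = 0" by (rule kerM)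
    then have "(transpose M *v (z - f y)) \<bullet> (transpose M *v (z - f y)) = 0"
      by (simp add: inner_matrix_transpose)
    then show ?thesis unfolding diff by simp
  qed
  have lin: "linear T"
  proof (rule linearI)
    fix a b c
    have "transpose M *v (f a + f b) = T (a + b)"
      using normal[of a] normal[of b]
      by (intro unique) (simp add: T_def matrix_vector_right_distrib matrix_vector_mult_diff_distrib)
    then show "T (a + b) = T a + T b" by (simp add: T_def matrix_vector_right_distrib)
    have "transpose M *v (c *\<^sub>R f a) = T (c *\<^sub>R a)"
    proof (rule unique)
      have "transpose M *v (c *\<^sub>R a - M *v (transpose M *v (c *\<^sub>R f a))) =
          c *\<^sub>R (transpose M *v (a - M *v T a))"
        by (simp add: T_def matrix_vector_mult_diff_distrib matrix_vector_mult_scaleR scaleR_diff_right)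
      then show "transpose M *v (c *\<^sub>R a - M *v (transpose M *v (c *\<^sub>R f a))) = 0"
        by (simp only: normal scaleR_zero_right)
    qed
    then show "T (c *\<^sub>R a) = c *\<^sub>R T a" by (simp add: T_def matrix_vector_mult_scaleR)
  qed
  have X: "matrix T *v y = T y" for y using lin by (simp add: matrix_works)
  have MTM: "M *v T (M *v x) = M *v x" for x
  proof -
    have "transpose M *v (M *v (x - T (M *v x))) = 0"
      using normal[of "M *v x"] by (simp add: matrix_vector_mult_diff_distrib)
    from kerM[OF this] show ?thesis by (simp add: matrix_vector_mult_diff_distrib)
  qed
  have TMT: "T (M *v T y) = T y" for y
    using unique[of "M *v T y" "f y"] by (simp add: T_def)
  have MT: "(M *v T y) \<bullet> z = (M *v T y) \<bullet> (M *v T z)" for y z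
  proof -
    have "(M *v T y) \<bullet> (z - M *v T z) = 0" by (simp add: inner_matrix_transpose normal)
    then show ?thesis by (simp add: inner_diff_right)
  qed
  have TM: "T (M *v x) \<bullet> z = T (M *v x) \<bullet> T (M *v z)" for x z
  proof -
    have "T (M *v x) \<bullet> (z - T (M *v z)) = f (M *v x) \<bullet> (M *v (z - T (M *v z)))"
      unfolding T_def[of "M *v x"] by (simp add: inner_matrix_transpose)
    then show ?thesis by (simp add: inner_diff_right matrix_vector_mult_diff_distrib MTM)
  qed
  have "is_pinv M (matrix T)"
    unfolding is_pinv_def
  proof (intro conjI)
    show "M ** matrix T ** M = M" "matrix T ** M ** matrix T = matrix T"
      by (simp_all add: matrix_eq X MTM TMT flip: matrix_vector_mul_assoc)
    show "transpose (M ** matrix T) = M ** matrix T"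
      by (rule symmetric_matrixI) (simp add: X flip: matrix_vector_mul_assoc, metis MT inner_commute)
    show "transpose (matrix T ** M) = matrix T ** M"
      by (rule symmetric_matrixI) (simp add: X flip: matrix_vector_mul_assoc, metis TM inner_commute)
  qed
  then have "pinv M = matrix T" unfolding pinv_def using is_pinv_unique by (intro the_equality)
  then show ?thesis using \<open>is_pinv M (matrix T)\<close> by simp
qed

lemma pinv_vector:
  fixes M :: "real^'n^'m"
  shows "M *v (pinv M *v (M *v x)) = M *v x"
    and "(M *v (pinv M *v y)) \<bullet> y' = y \<bullet> (M *v (pinv M *v y'))"
    and "(pinv M *v (M *v x)) \<bullet> x' = x \<bullet> (pinv M *v (M *v x'))"
proof -
  have p: "M ** pinv M ** M = M" "transpose (M ** pinv M) = M ** pinv M"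
    "transpose (pinv M ** M) = pinv M ** M"
    using pinv_is_pinv[of M] by (auto simp: is_pinv_def)
  show "M *v (pinv M *v (M *v x)) = M *v x"
    using p(1) by (simp add: matrix_vector_mul_assoc matrix_mul_assoc)
  show "(M *v (pinv M *v y)) \<bullet> y' = y \<bullet> (M *v (pinv M *v y'))"
    using inner_matrix_transpose[of "M ** pinv M" y y'] by (simp add: p(2) flip: matrix_vector_mul_assoc)
  show "(pinv M *v (M *v x)) \<bullet> x' = x \<bullet> (pinv M *v (M *v x'))"
    using inner_matrix_transpose[of "pinv M ** M" x x'] by (simp add: p(3) flip: matrix_vector_mul_assoc)
qed

lemma sym_pos_def_pos_op: "sym_pos_def M \<Longrightarrow> pos_op ((*v) M)"
  unfolding sym_pos_def_def pos_op_def
  using inner_matrix_transpose[of M] by (auto simp: matrix_vector_mul_linear)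

lemma sym_pos_def_inverse:
  fixes M :: "real^'n^'n"
  assumes M: "sym_pos_def M"
  shows "M *v (matrix_inv M *v x) = x" "matrix_inv M *v (M *v x) = x"
proof -
  have "\<forall>x. M *v x = 0 \<longrightarrow> x = 0" using M unfolding sym_pos_def_def by (metis inner_zero_right less_irrefl)
  then have "invertible M" by (simp add: invertible_left_inverse matrix_left_invertible_ker)
  then have "M ** matrix_inv M = mat 1 \<and> matrix_inv M ** M = mat 1"
    unfolding matrix_inv_def invertible_def by (rule someI_ex)
  then show "M *v (matrix_inv M *v x) = x" "matrix_inv M *v (M *v x) = x"
    by (simp_all add: matrix_vector_mul_assoc)
qed

lemma pos_op_matrix_inv:
  fixes M :: "real^'n^'n"
  assumes M: "sym_pos_def M"
  shows "pos_op ((*v) (matrix_inv M))"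
proof -
  note inv = sym_pos_def_inverse[OF M] and pM = sym_pos_def_pos_op[OF M]
  have sym: "(matrix_inv M *v x) \<bullet> y = x \<bullet> (matrix_inv M *v y)" for x y
    using pos_op_sym[OF pM, of "matrix_inv M *v x" "matrix_inv M *v y"] by (simp add: inv)
  have "0 < x \<bullet> (matrix_inv M *v x)" if "x \<noteq> 0" for x
  proof -
    have "matrix_inv M *v x \<noteq> 0" using that inv(1)[of x] by auto
    from pos_op_pos[OF pM this] show ?thesis by (simp add: inv inner_commute)
  qed
  then show ?thesis using sym by (simp add: pos_op_def matrix_vector_mul_linear)
qed

text \<open>A weighted Cauchy--Schwarz inequality, obtained from \<open>(M b - r z)\<^sup>T M\<^sup>-\<^sup>1 (M b - r z) \<ge> 0\<close>.\<close>

lemma weighted_young: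
  fixes M :: "real^'n^'n"
  assumes M: "sym_pos_def M"
  shows "2 * r * (z \<bullet> b) \<le> r\<^sup>2 * (z \<bullet> (matrix_inv M *v z)) + b \<bullet> (M *v b)"
proof -
  note inv = sym_pos_def_inverse[OF M] and pI = pos_op_matrix_inv[OF M]
  have "0 \<le> (M *v b + (-r) *\<^sub>R z) \<bullet> (matrix_inv M *v (M *v b + (-r) *\<^sub>R z))" by (rule pos_op_nonneg[OF pI])
  also have "\<dots> = (M *v b) \<bullet> b - 2 * r * (b \<bullet> z) + r\<^sup>2 * (z \<bullet> (matrix_inv M *v z))"
    unfolding pos_op_expand[OF pI] by (simp add: inv pos_op_sym[OF pI, symmetric])
  finally show ?thesis by (simp add: inner_commute)
qed

text \<open>
  The terminal cost at \<open>w\<close> is the minimum of \<open>z\<^sup>T Q\<^sub>0\<^sup>-\<^sup>1 z\<close> over all \<open>z\<close> with \<open>F\<^sup>T z = w\<close>: the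
  correction \<open>M_opt\<close> of the least-norm solution makes \<open>Q\<^sub>0\<^sup>-\<^sup>1 z\<close> orthogonal to the kernel of \<open>F\<^sup>T\<close>.
\<close>

context
  fixes F :: "real^'n^'m" and Q0 :: "real^'m^'m"
  assumes Q0: "sym_pos_def Q0"
begin

text \<open>The minimising preimage of \<open>w\<close> under \<open>F\<^sup>T\<close>, for \<open>w\<close> in the range of \<open>F\<^sup>T\<close>.\<close>

definition opt_preimage :: "real^'n \<Rightarrow> real^'m" where
  "opt_preimage w = (pinv (transpose F) - M_opt F Q0) *v w"

lemma terminal_cost_opt_preimage:
  "terminal_cost F Q0 (transpose F *v z) =
    opt_preimage (transpose F *v z) \<bullet> (matrix_inv Q0 *v opt_preimage (transpose F *v z))"
proof -
  define D where "D = pinv (transpose F) - M_opt F Q0"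
  have "terminal_cost F Q0 (transpose F *v z) =
      z \<bullet> (F *v (transpose D *v (matrix_inv Q0 *v (D *v (transpose F *v z)))))"
    by (simp add: terminal_cost_eq Q0_bar_def D_def flip: matrix_vector_mul_assoc)
  also have "\<dots> = (D *v (transpose F *v z)) \<bullet> (matrix_inv Q0 *v (D *v (transpose F *v z)))"
    using inner_matrix_transpose[of "transpose F"] inner_matrix_transpose[of D] by simp
  finally show ?thesis by (simp add: opt_preimage_def D_def)
qed

lemma P_mat_props:
  "transpose F *v (P_mat F *v x) = 0" "(P_mat F *v x) \<bullet> y = x \<bullet> (P_mat F *v y)"
  "transpose F *v x = 0 \<Longrightarrow> P_mat F *v x = x"
  by (simp_all add: P_mat_def matrix_vector_mult_diff_rdistrib matrix_vector_mult_diff_distrib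
      pinv_vector inner_diff_left inner_diff_right flip: matrix_vector_mul_assoc)

lemma opt_preimage_is_preimage:
  "transpose F *v opt_preimage (transpose F *v z) = transpose F *v z"
  by (simp add: opt_preimage_def M_opt_def matrix_vector_mult_diff_rdistrib
      matrix_vector_mult_diff_distrib P_mat_props pinv_vector flip: matrix_vector_mul_assoc)

lemma opt_preimage_residual: "P_mat F *v (matrix_inv Q0 *v opt_preimage w) = 0"
proof -
  let ?P = "P_mat F" and ?S = "matrix_inv Q0"
  define N where "N = ?P ** ?S ** ?P"
  define b where "b = ?P *v (?S *v (pinv (transpose F) *v w))"
  define v where "v = b - N *v (pinv N *v b)"
  note pS = pos_op_matrix_inv[OF Q0]
  have N: "N *v x = ?P *v (?S *v (?P *v x))" for x by (simp add: N_def flip: matrix_vector_mul_assoc)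
  have symN: "(N *v x) \<bullet> y = x \<bullet> (N *v y)" for x y
    by (simp add: N P_mat_props(2) pos_op_sym[OF pS])
  have idem: "?P *v (?P *v x) = ?P *v x" for x by (rule P_mat_props(3)[OF P_mat_props(1)])
  have v: "?P *v (?S *v opt_preimage w) = v"
    by (simp add: v_def b_def N opt_preimage_def M_opt_def N_def[symmetric] idem matrix_vector_mult_diff_rdistrib
      matrix_vector_mult_diff_distrib flip: matrix_vector_mul_assoc)
  have Nv: "x \<bullet> (N *v v) = 0" for x
  proof -
    have "x \<bullet> (N *v v) = (N *v x) \<bullet> b - (N *v x) \<bullet> (N *v (pinv N *v b))"
      by (simp add: symN[symmetric] v_def inner_diff_right)
    also have "(N *v x) \<bullet> (N *v (pinv N *v b)) = (N *v (pinv N *v (N *v x))) \<bullet> b"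
      by (simp add: pinv_vector(2))
    finally show ?thesis by (simp add: pinv_vector(1))
  qed
  have "(?P *v v) \<bullet> (?S *v (?P *v v)) = 0"
    using Nv[of v] by (simp add: N P_mat_props(2)[symmetric])
  then have Pv: "?P *v v = 0" using pos_op_pos[OF pS, of "?P *v v"] by fastforce
  have "v \<bullet> v = v \<bullet> b - v \<bullet> (N *v (pinv N *v b))" by (simp add: v_def inner_diff_right)
  also have "v \<bullet> (N *v (pinv N *v b)) = (N *v v) \<bullet> (pinv N *v b)" by (simp add: symN)
  also have "N *v v = 0" by (simp add: N Pv matrix_vector_mult_0_right)
  also have "v \<bullet> b = (?P *v v) \<bullet> (?S *v (pinv (transpose F) *v w))" by (simp add: b_def P_mat_props(2))
  finally have "v = 0" by (simp add: Pv)
  then show ?thesis using v by simp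
qed

lemma terminal_cost_le:
  assumes z: "transpose F *v z = w"
  shows "terminal_cost F Q0 w \<le> z \<bullet> (matrix_inv Q0 *v z)"
proof -
  define y where "y = opt_preimage w"
  define d where "d = z - y"
  note pS = pos_op_matrix_inv[OF Q0]
  have "transpose F *v y = w" using opt_preimage_is_preimage[of z] z by (simp add: y_def)
  then have "P_mat F *v d = d"
    using z by (intro P_mat_props(3)) (simp add: d_def matrix_vector_mult_diff_distrib)
  then have "d \<bullet> (matrix_inv Q0 *v y) = d \<bullet> (P_mat F *v (matrix_inv Q0 *v y))"
    by (metis P_mat_props(2))
  also have "\<dots> = 0" unfolding y_def opt_preimage_residual by simp
  finally have orth: "y \<bullet> (matrix_inv Q0 *v d) = 0"
    by (metis inner_commute pos_op_sym[OF pS])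
  have "z = y + 1 *\<^sub>R d" by (simp add: d_def)
  then have "z \<bullet> (matrix_inv Q0 *v z) = y \<bullet> (matrix_inv Q0 *v y) + d \<bullet> (matrix_inv Q0 *v d)"
    using pos_op_expand[OF pS, of y 1 d] orth by simp
  moreover have "0 \<le> d \<bullet> (matrix_inv Q0 *v d)" by (rule pos_op_nonneg[OF pS])
  moreover have "terminal_cost F Q0 w = y \<bullet> (matrix_inv Q0 *v y)"
    using terminal_cost_opt_preimage[of z] z by (simp add: y_def)
  ultimately show ?thesis by simp
qed

lemma terminal_cost_attained:
  assumes "w \<in> range ((*v) (transpose F))"
  obtains z where "transpose F *v z = w" "terminal_cost F Q0 w = z \<bullet> (matrix_inv Q0 *v z)"
proof -
  obtain y where "w = transpose F *v y" using assms by blast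
  then show ?thesis
    using that[of "opt_preimage w"] by (simp add: opt_preimage_is_preimage terminal_cost_opt_preimage)
qed

lemma terminal_cost_nonneg:
  assumes "w \<in> range ((*v) (transpose F))"
  shows "0 \<le> terminal_cost F Q0 w"
proof -
  obtain z where "terminal_cost F Q0 w = z \<bullet> (matrix_inv Q0 *v z)"
    using terminal_cost_attained[OF assms] by blast
  then show ?thesis by (simp add: pos_op_nonneg[OF pos_op_matrix_inv[OF Q0]])
qed

lemma terminal_cost_tendsto_zero:
  assumes "\<And>t. 0 \<le> t \<Longrightarrow> W t \<in> range ((*v) (transpose F))" and W: "(W \<longlongrightarrow> 0) at_top"
  shows "((\<lambda>t::real. terminal_cost F Q0 (W t)) \<longlongrightarrow> 0) at_top"
proof -
  have "((\<lambda>t. opt_preimage (W t) \<bullet> (matrix_inv Q0 *v opt_preimage (W t))) \<longlongrightarrow> (0::real^'m) \<bullet> 0) at_top"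
    unfolding opt_preimage_def
    by (intro tendsto_inner bounded_linear.tendsto_zero[OF matrix_vector_mul_bounded_linear] W)
  moreover have "\<forall>\<^sub>F t in at_top. opt_preimage (W t) \<bullet> (matrix_inv Q0 *v opt_preimage (W t)) = terminal_cost F Q0 (W t)"
    using eventually_ge_at_top[of 0]
  proof eventually_elim
    case (elim t)
    then obtain z where "W t = transpose F *v z" using assms(1) by blast
    then show ?case by (simp add: terminal_cost_opt_preimage)
  qed
  ultimately show ?thesis by (simp add: tendsto_cong)
qed

end

section \<open>The dual and the primal equation as linear differential-algebraic equations\<close>

text \<open>The maps \<open>E\<close> and \<open>G\<close> for the dual equation, with \<open>\<xi> = (q, u)\<close>, and for the primal one, with
  \<open>\<xi> = (x, f)\<close>; the weight in the dual running cost.\<close>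

definition dual_state :: "real^'n^'m \<Rightarrow> (real^'m) \<times> (real^'p) \<Rightarrow> real^'n" where
  "dual_state F z = transpose F *v fst z"

definition dual_rate :: "real^'n^'m \<Rightarrow> real^'n^'p \<Rightarrow> (real^'m) \<times> (real^'p) \<Rightarrow> real^'n" where
  "dual_rate A H z = transpose A *v fst z - transpose H *v snd z"

definition primal_state :: "real^'n^'m \<Rightarrow> (real^'n) \<times> (real^'m) \<Rightarrow> real^'m" where
  "primal_state F z = F *v fst z"

definition primal_rate :: "real^'n^'m \<Rightarrow> (real^'n) \<times> (real^'m) \<Rightarrow> real^'m" where
  "primal_rate A z = A *v fst z + snd z"

definition dual_weight :: "real^'m^'m \<Rightarrow> real^'p^'p \<Rightarrow> (real^'m) \<times> (real^'p) \<Rightarrow> (real^'m) \<times> (real^'p)" where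
  "dual_weight Q R z = (matrix_inv Q *v fst z, matrix_inv R *v snd z)"

lemma linear_dual_state: "linear (dual_state F)"
  and linear_dual_rate: "linear (dual_rate A H)"
  and linear_primal_state: "linear (primal_state F)"
  and linear_primal_rate: "linear (primal_rate A)"
  by (auto intro!: linearI simp: dual_state_def dual_rate_def primal_state_def primal_rate_def
      matrix_vector_right_distrib matrix_vector_mult_scaleR algebra_simps)

lemma pos_op_dual_weight:
  assumes "sym_pos_def Q" "sym_pos_def R"
  shows "pos_op (dual_weight Q R)"
proof -
  note q = pos_op_matrix_inv[OF assms(1)] and r = pos_op_matrix_inv[OF assms(2)]
  have "0 < z \<bullet> dual_weight Q R z" if "z \<noteq> 0" for z
  proof (cases "fst z = 0")
    case True
    then have "snd z \<noteq> 0" using that by (auto simp: prod_eq_iff)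
    from pos_op_pos[OF r this] show ?thesis
      using pos_op_nonneg[OF q, of "fst z"] by (simp add: dual_weight_def inner_prod_def)
  next
    case False
    from pos_op_pos[OF q this] show ?thesis
      using pos_op_nonneg[OF r, of "snd z"] by (simp add: dual_weight_def inner_prod_def)
  qed
  moreover have "linear (dual_weight Q R)"
    by (auto intro!: linearI simp: dual_weight_def matrix_vector_right_distrib matrix_vector_mult_scaleR)
  ultimately show ?thesis
    by (simp add: pos_op_def dual_weight_def inner_prod_def pos_op_sym[OF q] pos_op_sym[OF r])
qed

lemma dual_solutions_iff:
  assumes I: "horizon I"
  shows "(q, u) \<in> dual_solutions F A H l I \<longleftrightarrow>
    (\<exists>W. lin_sol (dual_state F) (dual_rate A H) I (\<lambda>t. (q t, u t)) W \<and> W 0 = transpose F *v l)"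
proof
  assume "(q, u) \<in> dual_solutions F A H l I"
  then have *: "dual_solution F A H I q u" "ac_value I (\<lambda>s. transpose F *v q s) 0 = transpose F *v l"
    by (auto simp: dual_solutions_def)
  then obtain w where "ac_version I (\<lambda>s. transpose F *v q s) w" unfolding dual_solution_def by blast
  then have "lin_sol (dual_state F) (dual_rate A H) I (\<lambda>t. (q t, u t))
      (ac_value I (\<lambda>s. dual_state F (q s, u s)))"
    using *(1)
    by (intro lin_sol_of_ac_value[OF linear_dual_state linear_dual_rate])
      (auto simp: dual_solution_def L2_loc_Pair_iff dual_state_def dual_rate_def)
  then show "\<exists>W. lin_sol (dual_state F) (dual_rate A H) I (\<lambda>t. (q t, u t)) W \<and> W 0 = transpose F *v l"
    using *(2) by (auto simp: dual_state_def)
next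
  assume "\<exists>W. lin_sol (dual_state F) (dual_rate A H) I (\<lambda>t. (q t, u t)) W \<and> W 0 = transpose F *v l"
  then obtain W where W: "lin_sol (dual_state F) (dual_rate A H) I (\<lambda>t. (q t, u t)) W"
    "W 0 = transpose F *v l" by blast
  have ac: "ac_version I (\<lambda>s. transpose F *v q s) W"
    using lin_sol_ac_version[OF linear_dual_state linear_dual_rate W(1) I] by (simp add: dual_state_def)
  have val: "ac_value I (\<lambda>s. transpose F *v q s) t = W t" if "t \<in> I" for t
    using lin_sol_ac_value[OF linear_dual_state linear_dual_rate W(1) I that] by (simp add: dual_state_def)
  have 0: "0 \<in> I" using I by (auto simp: horizon_def)
  have eq: "ac_value I (\<lambda>s. transpose F *v q s) t = ac_value I (\<lambda>s. transpose F *v q s) 0 +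
      (LINT s|lebesgue_on {0..t}. transpose A *v q s - transpose H *v u s)" if "t \<in> I" for t
    using lin_sol_eq[OF W(1) that] by (simp add: val[OF that] val[OF 0] dual_rate_def)
  have L2: "q \<in> L2_loc I" "u \<in> L2_loc I" using lin_sol_L2[OF W(1)] by (simp_all add: L2_loc_Pair_iff)
  have "dual_solution F A H I q u" unfolding dual_solution_def using L2 ac eq by blast
  then show "(q, u) \<in> dual_solutions F A H l I"
    using val[OF 0] W(2) by (simp add: dual_solutions_def)
qed

lemma J_lin_sol:
  assumes sol: "lin_sol (dual_state F) (dual_rate A H) I (\<lambda>t. (q t, u t)) W" and I: "horizon I"
    and t: "{0..t} \<subseteq> I" "0 < t"
  shows "J F Q0 Q R q u t = terminal_cost F Q0 (W t) + cost (dual_weight Q R) {0..t} (\<lambda>t. (q t, u t))"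
proof -
  have "lin_sol (dual_state F) (dual_rate A H) {0..t} (\<lambda>t. (q t, u t)) W"
    using t I by (intro lin_sol_restrict[OF linear_dual_state linear_dual_rate sol]) auto
  from lin_sol_ac_value[OF linear_dual_state linear_dual_rate this]
  have "ac_value {0..t} (\<lambda>s. transpose F *v q s) t = W t" using t by (simp add: dual_state_def)
  then show ?thesis by (simp add: J_def cost_def dual_weight_def inner_prod_def)
qed

lemma dual_lin_sol_range:
  fixes F A :: "real^'n^'m" and H :: "real^'n^'p"
  assumes sol: "lin_sol (dual_state F) (dual_rate A H) I \<xi> W" and I: "horizon I" and t: "t \<in> I"
  shows "W t \<in> range ((*v) (transpose F))"
proof -
  obtain b where b: "0 < b" "{0..b} \<subseteq> I" "t \<in> {0..b}"
  proof (cases "I = {0..}")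
    case True
    then show ?thesis using that[of "t + 1"] t by auto
  next
    case False
    then obtain T where "0 < T" "I = {0..T}" using I by (auto simp: horizon_def)
    then show ?thesis using that[of T] t by simp
  qed
  have sol': "lin_sol (dual_state F) (dual_rate A H) {0..b} \<xi> W"
    using b I by (intro lin_sol_restrict[OF linear_dual_state linear_dual_rate sol]) auto
  define L where "L w = transpose F *v (pinv (transpose F) *v w) - w" for w :: "real^'n"
  have "linear L"
    unfolding L_def by (auto intro!: linearI simp: matrix_vector_right_distrib matrix_vector_mult_scaleR algebra_simps)
  from lin_sol_annihilate(1)[OF linear_dual_state linear_dual_rate this _ b(1) sol' b(3)]
  have "L (W t) = 0" by (simp add: L_def dual_state_def pinv_vector(1))
  then have "W t = transpose F *v (pinv (transpose F) *v W t)" by (simp add: L_def)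
  then show ?thesis by (rule range_eqI)
qed

text \<open>Solutions of the dual equation with arbitrary initial value.\<close>

abbreviation dual_sol ::
  "real^'n^'m \<Rightarrow> real^'n^'m \<Rightarrow> real^'n^'p \<Rightarrow> real set \<Rightarrow> (real \<Rightarrow> (real^'m) \<times> (real^'p)) \<Rightarrow>
    (real \<Rightarrow> real^'n) \<Rightarrow> bool" where
  "dual_sol F A H \<equiv> lin_sol (dual_state F) (dual_rate A H)"

section \<open>Weak duality\<close>

text \<open>
  For an admissible \<open>(x, f, y, \<eta>)\<close> on \<open>[0, t]\<close> and a dual solution \<open>(q, u)\<close>, put \<open>p(s) = q(t - s)\<close> and
  \<open>U(s) = u(t - s)\<close>.  Integrating \<open>d/ds (F\<^sup>T p)\<^sup>T F\<^sup>+ (F x)\<close> from \<open>0\<close> to \<open>t\<close> gives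
  \<open>l\<^sup>T F x(t) - \<integral> y\<^sup>T U = z\<^sup>T F x(0) + \<integral> (p\<^sup>T f - \<eta>\<^sup>T U)\<close> for every \<open>z\<close> with \<open>F\<^sup>T z = F\<^sup>T q(t)\<close>, and the
  right-hand side is estimated by the weighted Cauchy--Schwarz inequality.  The values and the rates
  of \<open>F\<^sup>T p\<close> and \<open>F x\<close> lie in the ranges of \<open>F\<^sup>T\<close> and \<open>F\<close>, which makes \<open>F\<^sup>+\<close> disappear.
\<close>

text \<open>The Cauchy--Schwarz inequality in the form in which it follows from Young's inequality.\<close>

lemma square_le_of_young:
  fixes D c :: real
  assumes "\<And>r. 2 * r * D \<le> r\<^sup>2 * c + 1" and c: "0 \<le> c"
  shows "D\<^sup>2 \<le> c"
proof (cases "c = 0")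
  case True
  then have "2 * D * D \<le> 1" "2 * (1 / D) * D \<le> 1" using assms(1)[of D] assms(1)[of "1 / D"] by auto
  then show ?thesis using True by (cases "D = 0") auto
next
  case False
  then have c: "0 < c" using c by simp
  have "2 * (D / c) * D \<le> (D / c)\<^sup>2 * c + 1" by (rule assms(1))
  also have "(D / c)\<^sup>2 * c = D\<^sup>2 / c" using c by (simp add: power2_eq_square)
  finally have "D\<^sup>2 / c \<le> 1" by (simp add: power2_eq_square)
  then show ?thesis using c by simp
qed

lemma lin_sol_backwards:
  fixes E G :: "'e::euclidean_space \<Rightarrow> 'b::euclidean_space"
  assumes E: "linear E" and G: "linear G" and sol: "lin_sol E G {0..t} \<xi> W" and s: "0 \<le> s" "s \<le> t"
  shows "W (t - s) = W t - (LINT r|lebesgue_on {0..s}. G (\<xi> (t - r)))"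
proof -
  have T: "{0..s} = (\<lambda>r. t + - 1 * r) -` {t - s..t}" by auto
  have "integrable (lebesgue_on {t - s..t}) (\<lambda>r. G (\<xi> r))"
    using s by (intro integrable_lebesgue_on_subset[OF lin_sol_rate(2)[OF E G sol, of t]]) auto
  then have "(LINT r|lebesgue_on {0..s}. G (\<xi> (t - r))) = (LINT r|lebesgue_on {t - s..t}. G (\<xi> r))"
    using integrable_affine(2)[OF _ _ T] by simp
  then show ?thesis using lin_sol_increment[OF E G sol, of t "t - s"] s by (simp add: algebra_simps)
qed

lemma weak_duality:
  fixes F A :: "real^'n^'m" and H :: "real^'n^'p"
  assumes Q0: "sym_pos_def Q0" and Q: "sym_pos_def Q" and R: "sym_pos_def R" and t: "0 < t"
    and dual: "dual_sol F A H {0..t} (\<lambda>s. (q s, u s)) W"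
    and W0: "W 0 = transpose F *v l"
    and adm: "(x, f, y, \<eta>) \<in> admissible F A H Q0 Q R {0..t}"
  shows "(l \<bullet> ac_value {0..t} (\<lambda>s. F *v x s) t - (LINT s|lebesgue_on {0..t}. y s \<bullet> u (t - s)))\<^sup>2 \<le>
    terminal_cost F Q0 (W t) + cost (dual_weight Q R) {0..t} (\<lambda>s. (q s, u s))"
proof -
  let ?M = "lebesgue_on {0..t}"
  define X where "X = ac_value {0..t} (\<lambda>s. F *v x s)"
  have dae: "dae_solution F A H {0..t} x f y \<eta>"
    and bound: "\<And>\<tau>. \<tau> \<in> {0..t} \<Longrightarrow> X 0 \<bullet> (Q0 *v X 0) +
      (LINT s|lebesgue_on {0..\<tau>}. f s \<bullet> (Q *v f s) + \<eta> s \<bullet> (R *v \<eta> s)) \<le> 1"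
    using adm unfolding admissible_def X_def by auto
  have L2: "x \<in> L2_on {0..t}" "f \<in> L2_on {0..t}" "y \<in> L2_on {0..t}" "\<eta> \<in> L2_on {0..t}"
    using dae t by (auto simp: dae_solution_def L2_loc_Icc)
  have y: "AE s in ?M. y s = H *v x s + \<eta> s" using dae by (simp add: dae_solution_def)
  have primal: "lin_sol (primal_state F) (primal_rate A) {0..t} (\<lambda>s. (x s, f s)) X"
  proof -
    obtain w where w: "ac_version {0..t} (\<lambda>s. F *v x s) w" using dae unfolding dae_solution_def by blast
    have eq: "\<forall>s\<in>{0..t}. ac_value {0..t} (\<lambda>s. F *v x s) s = ac_value {0..t} (\<lambda>s. F *v x s) 0 +
        (LINT r|lebesgue_on {0..s}. A *v x r + f r)"
      using dae unfolding dae_solution_def by (elim conjE)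
    have L2': "(\<lambda>s. (x s, f s)) \<in> L2_loc {0..t}"
      using L2 t by (simp add: L2_loc_Icc L2_on_Pair)
    have "lin_sol (primal_state F) (primal_rate A) {0..t} (\<lambda>s. (x s, f s))
        (ac_value {0..t} (\<lambda>s. primal_state F (x s, f s)))"
      by (rule lin_sol_of_ac_value[OF linear_primal_state linear_primal_rate L2', where w = w],
          simp_all only: primal_state_def primal_rate_def fst_conv snd_conv w) (rule eq)
    then show ?thesis by (simp add: primal_state_def X_def)
  qed
  have qu: "q \<in> L2_on {0..t}" "u \<in> L2_on {0..t}"
    using lin_sol_L2[OF dual] t unfolding L2_loc_Pair_iff by (auto simp: L2_loc_Icc)
  have rev: "{0..t} = (\<lambda>s. t + - 1 * s) -` {0..t}" by auto
  define p where "p s = q (t - s)" for s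
  define U where "U s = u (t - s)" for s
  have pU: "p \<in> L2_on {0..t}" "U \<in> L2_on {0..t}"
    using L2_on_affine[OF _ _ rev qu(1)] L2_on_affine[OF _ _ rev qu(2)]
    by (simp_all add: p_def[abs_def] U_def[abs_def])
  define C where "C = pinv F"
  \<comment> \<open>\<open>g\<close> is the derivative of \<open>W (t - s)\<close>, and \<open>v\<close> that of \<open>X\<close>\<close>
  define g where "g s = - dual_rate A H (p s, U s)" for s
  define v where "v s = primal_rate A (x s, f s)" for s
  have g_int: "integrable ?M g"
    unfolding g_def using L2_on_linear[OF linear_dual_rate L2_on_Pair[OF pU]]
    by (intro Bochner_Integration.integrable_minus L2_on_integrable)
  have v_L2: "v \<in> L2_on {0..t}"
    unfolding v_def by (rule L2_on_linear[OF linear_primal_rate L2_on_Pair[OF L2(1,2)]])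
  have IBP: "(LINT s|?M. g s \<bullet> (C *v X s)) + (LINT s|?M. W (t - s) \<bullet> (C *v v s)) =
      W (t - t) \<bullet> (C *v X t) - W (t - 0) \<bullet> (C *v X 0)"
    and IBP_int: "integrable ?M (\<lambda>s. g s \<bullet> (C *v X s))"
  proof -
    have Cv: "integrable ?M (\<lambda>s. C *v v s)" by (intro L2_on_integrable L2_on_matrix v_L2)
    have 1: "W (t - s) = W (t - 0) + (LINT r|lebesgue_on {0..s}. g r)" if "0 \<le> s" "s \<le> t" for s
      using lin_sol_backwards[OF linear_dual_state linear_dual_rate dual that] by (simp add: g_def p_def U_def)
    have 2: "C *v X s = C *v X 0 + (LINT r|lebesgue_on {0..s}. C *v v r)" if "0 \<le> s" "s \<le> t" for s
    proof -
      have "integrable (lebesgue_on {0..s}) v"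
        using that by (intro integrable_lebesgue_on_subset[OF L2_on_integrable[OF v_L2]]) auto
      then have "(LINT r|lebesgue_on {0..s}. C *v v r) = C *v (LINT r|lebesgue_on {0..s}. v r)"
        by (intro integral_linear_lebesgue_on matrix_vector_mul_linear)
      moreover have "X s = X 0 + (LINT r|lebesgue_on {0..s}. v r)"
        unfolding v_def using that by (intro lin_sol_eq[OF primal]) auto
      ultimately show ?thesis by (metis matrix_vector_right_distrib)
    qed
    show "(LINT s|?M. g s \<bullet> (C *v X s)) + (LINT s|?M. W (t - s) \<bullet> (C *v v s)) =
      W (t - t) \<bullet> (C *v X t) - W (t - 0) \<bullet> (C *v X 0)"
      using integral_by_parts_inner(2)[OF g_int Cv less_imp_le[OF t] 1 2] .
    show "integrable ?M (\<lambda>s. g s \<bullet> (C *v X s))"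
      using integral_by_parts_inner(1)[OF g_int Cv less_imp_le[OF t] 1 2] .
  qed
  \<comment> \<open>the projections onto the ranges of \<open>F\<^sup>T\<close> and \<open>F\<close> fix the states and the rates\<close>
  have lin1: "linear (\<lambda>w. C *v (F *v w) - w)" and lin2: "linear (\<lambda>w. F *v (C *v w) - w)"
    by (auto intro!: linearI simp: matrix_vector_right_distrib matrix_vector_mult_scaleR algebra_simps)
  have CF: "C *v (F *v (transpose F *v z)) = transpose F *v z" for z
  proof -
    have "(C *v (F *v (transpose F *v z)) - transpose F *v z) \<bullet> b = 0" for b
    proof -
      have "(C *v (F *v (transpose F *v z))) \<bullet> b = (transpose F *v z) \<bullet> (C *v (F *v b))"
        unfolding C_def by (rule pinv_vector(3))
      also have "\<dots> = z \<bullet> (F *v (C *v (F *v b)))" by (simp add: inner_matrix_transpose)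
      also have "\<dots> = z \<bullet> (F *v b)" by (simp add: C_def pinv_vector(1))
      also have "\<dots> = (transpose F *v z) \<bullet> b" by (simp add: inner_matrix_transpose)
      finally show ?thesis by (simp add: inner_diff_left)
    qed
    then show ?thesis by (metis inner_eq_zero_iff right_minus_eq)
  qed
  have FC: "F *v (C *v (F *v z)) = F *v z" for z by (simp add: C_def pinv_vector(1))
  have "AE s in ?M. C *v (F *v dual_rate A H (q s, u s)) - dual_rate A H (q s, u s) = 0"
    by (rule lin_sol_annihilate(2)[OF linear_dual_state linear_dual_rate lin1 _ t dual])
      (simp add: dual_state_def CF)
  from AE_affine[OF _ _ rev this] have g_range: "AE s in ?M. C *v (F *v g s) = g s"
    by (simp add: g_def p_def U_def linear_neg[OF matrix_vector_mul_linear])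
  have "AE s in ?M. W s = dual_state F (q s, u s)" by (rule lin_sol_AE[OF dual])
  from AE_affine[OF _ _ rev this] have Wp: "AE s in ?M. W (t - s) = transpose F *v p s"
    by (simp add: dual_state_def p_def)
  have FCX: "F *v (C *v X s) = X s" if "s \<in> {0..t}" for s
    using lin_sol_annihilate(1)[OF linear_primal_state linear_primal_rate lin2 _ t primal that]
    by (simp add: primal_state_def FC)
  have v_range: "AE s in ?M. F *v (C *v v s) = v s"
    using lin_sol_annihilate(2)[OF linear_primal_state linear_primal_rate lin2 _ t primal]
    by (simp add: primal_state_def FC v_def)
  have Xx: "AE s in ?M. X s = F *v x s" using lin_sol_AE[OF primal] by (simp add: primal_state_def)
  have 1: "AE s in ?M. g s \<bullet> (C *v X s) = g s \<bullet> x s"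
    using g_range Xx
  proof eventually_elim
    case (elim s)
    have "g s \<bullet> (C *v X s) = (C *v (F *v g s)) \<bullet> x s" unfolding elim(2) C_def by (simp add: pinv_vector(3))
    then show ?case by (simp add: elim(1))
  qed
  have 2: "AE s in ?M. W (t - s) \<bullet> (C *v v s) = p s \<bullet> v s"
    using Wp v_range by eventually_elim (simp add: inner_matrix_transpose)
  have gx_int: "integrable ?M (\<lambda>s. g s \<bullet> x s)" and pv_int: "integrable ?M (\<lambda>s. p s \<bullet> v s)"
    using L2_on_linear[OF linear_dual_rate[of A H] L2_on_Pair[OF pU]] L2(1) v_L2 pU(1)
    by (auto simp: g_def intro!: L2_on_inner_integrable)
  have meas2: "(\<lambda>s. W (t - s) \<bullet> (C *v v s)) \<in> borel_measurable ?M"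
  proof -
    have "continuous_on {0..t} W"
      using lin_sol_ac_version[OF linear_dual_state linear_dual_rate dual] t
      by (auto simp: ac_version_def loc_abs_cont_on_def intro!: abs_cont_on_imp_continuous_on)
    then have "continuous_on {0..t} (\<lambda>s. W (t - s))"
      by (rule continuous_on_compose2) (auto intro!: continuous_intros)
    then have "(\<lambda>s. W (t - s)) \<in> borel_measurable ?M"
      by (intro continuous_imp_measurable_on_sets_lebesgue) auto
    then show ?thesis by (rule borel_measurable_inner[OF _ L2_on_measurable[OF L2_on_matrix[OF v_L2]]])
  qed
  have "(LINT s|?M. g s \<bullet> x s) + (LINT s|?M. p s \<bullet> v s) =
      (LINT s|?M. g s \<bullet> (C *v X s)) + (LINT s|?M. W (t - s) \<bullet> (C *v v s))"
  proof -
    have "(LINT s|?M. g s \<bullet> (C *v X s)) = (LINT s|?M. g s \<bullet> x s)"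
      using IBP_int gx_int 1 by (intro integral_cong_AE) auto
    moreover have "(LINT s|?M. W (t - s) \<bullet> (C *v v s)) = (LINT s|?M. p s \<bullet> v s)"
      using meas2 pv_int 2 by (intro integral_cong_AE) auto
    ultimately show ?thesis by simp
  qed
  also note IBP
  also have "W (t - t) \<bullet> (C *v X t) = l \<bullet> X t"
    using FCX[of t] t by (simp add: W0 inner_matrix_transpose)
  finally have main: "(LINT s|?M. g s \<bullet> x s + p s \<bullet> v s) = l \<bullet> X t - W t \<bullet> (C *v X 0)"
    using gx_int pv_int by simp
  have W_range: "W t \<in> range ((*v) (transpose F))"
    using t by (intro dual_lin_sol_range[OF dual]) auto
  obtain z where z: "transpose F *v z = W t" "terminal_cost F Q0 (W t) = z \<bullet> (matrix_inv Q0 *v z)"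
    using terminal_cost_attained[OF Q0 W_range] by blast
  have zX: "W t \<bullet> (C *v X 0) = z \<bullet> X 0"
    unfolding z(1)[symmetric] using FCX[of 0] t by (simp add: inner_matrix_transpose)
  have pf_int: "integrable ?M (\<lambda>s. p s \<bullet> f s)" and \<eta>U_int: "integrable ?M (\<lambda>s. \<eta> s \<bullet> U s)"
    and yU_int: "integrable ?M (\<lambda>s. y s \<bullet> U s)"
    using L2 pU by (auto intro!: L2_on_inner_integrable)
  have "(LINT s|?M. g s \<bullet> x s + p s \<bullet> v s) = (LINT s|?M. y s \<bullet> U s + (p s \<bullet> f s - \<eta> s \<bullet> U s))"
  proof (rule integral_cong_AE)
    show "AE s in ?M. g s \<bullet> x s + p s \<bullet> v s = y s \<bullet> U s + (p s \<bullet> f s - \<eta> s \<bullet> U s)"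
      using y
    proof eventually_elim
      case (elim s)
      have "(transpose A *v p s) \<bullet> x s = p s \<bullet> (A *v x s)" "(transpose H *v U s) \<bullet> x s = U s \<bullet> (H *v x s)"
        by (simp_all add: inner_matrix_transpose)
      then show ?case
        by (simp add: g_def v_def dual_rate_def primal_rate_def elim inner_add_left inner_add_right
            inner_diff_left inner_diff_right inner_commute)
    qed
  qed (use gx_int pv_int pf_int \<eta>U_int yU_int in auto)
  also have "\<dots> = (LINT s|?M. y s \<bullet> U s) + (LINT s|?M. p s \<bullet> f s - \<eta> s \<bullet> U s)"
    using pf_int \<eta>U_int yU_int by simp
  finally have err: "l \<bullet> X t - (LINT s|?M. y s \<bullet> U s) = z \<bullet> X 0 + (LINT s|?M. p s \<bullet> f s - \<eta> s \<bullet> U s)"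
    using main zX by simp
  define c where "c = terminal_cost F Q0 (W t) + cost (dual_weight Q R) {0..t} (\<lambda>s. (q s, u s))"
  have c0: "0 \<le> c"
    unfolding c_def using terminal_cost_nonneg[OF Q0 W_range] cost_nonneg[OF pos_op_dual_weight[OF Q R]]
    by (intro add_nonneg_nonneg)
  note pw = pos_op_matrix_inv[OF Q] pos_op_matrix_inv[OF R] sym_pos_def_pos_op[OF Q] sym_pos_def_pos_op[OF R]
  have cost_rev: "cost (dual_weight Q R) {0..t} (\<lambda>s. (q s, u s)) =
      (LINT s|?M. p s \<bullet> (matrix_inv Q *v p s) + U s \<bullet> (matrix_inv R *v U s))"
    using integrable_affine(2)[OF _ _ rev cost_integrable[OF pos_op_dual_weight[OF Q R] L2_on_Pair[OF qu]]]
    by (simp add: cost_def dual_weight_def inner_prod_def p_def U_def)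
  have "2 * r * (l \<bullet> X t - (LINT s|?M. y s \<bullet> U s)) \<le> r\<^sup>2 * c + 1" for r
  proof -
    have int1: "integrable ?M (\<lambda>s. p s \<bullet> (matrix_inv Q *v p s) + U s \<bullet> (matrix_inv R *v U s))"
      using cost_integrable[OF pw(1) pU(1)] cost_integrable[OF pw(2) pU(2)] by simp
    have int2: "integrable ?M (\<lambda>s. f s \<bullet> (Q *v f s) + \<eta> s \<bullet> (R *v \<eta> s))"
      using cost_integrable[OF pw(3) L2(2)] cost_integrable[OF pw(4) L2(4)] by simp
    have "2 * r * (LINT s|?M. p s \<bullet> f s - \<eta> s \<bullet> U s) = (LINT s|?M. 2 * r * (p s \<bullet> f s - \<eta> s \<bullet> U s))"
      by simp
    also have "\<dots> \<le> (LINT s|?M. r\<^sup>2 * (p s \<bullet> (matrix_inv Q *v p s) + U s \<bullet> (matrix_inv R *v U s)) +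
        (f s \<bullet> (Q *v f s) + \<eta> s \<bullet> (R *v \<eta> s)))"
    proof (rule integral_mono)
      fix s
      show "2 * r * (p s \<bullet> f s - \<eta> s \<bullet> U s) \<le> r\<^sup>2 * (p s \<bullet> (matrix_inv Q *v p s) + U s \<bullet> (matrix_inv R *v U s)) +
          (f s \<bullet> (Q *v f s) + \<eta> s \<bullet> (R *v \<eta> s))"
        using weighted_young[OF Q, of r "p s" "f s"] weighted_young[OF R, of "- r" "U s" "\<eta> s"]
        by (simp add: algebra_simps inner_commute[of "\<eta> s" "U s"])
    qed (use int1 int2 pf_int \<eta>U_int in auto)
    also have "\<dots> = r\<^sup>2 * cost (dual_weight Q R) {0..t} (\<lambda>s. (q s, u s)) +
        (LINT s|?M. f s \<bullet> (Q *v f s) + \<eta> s \<bullet> (R *v \<eta> s))"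
      using int1 int2 unfolding cost_rev by (simp only: Bochner_Integration.integral_add
        Bochner_Integration.integrable_mult_right integral_mult_right_zero)
    finally show ?thesis
      using weighted_young[OF Q0, of r z "X 0"] bound[of t] t
      unfolding err c_def z(2) by (simp add: algebra_simps)
  qed
  from square_le_of_young[OF this c0] show ?thesis unfolding c_def X_def U_def by simp
qed

section \<open>Strong duality\<close>

text \<open>
  If the worst-case error of \<open>U\<close> is finite, the error is a bounded linear functional of
  \<open>(F x(0), f, \<eta>)\<close>, represented by some \<open>(z\<^sub>0, g\<^sub>1, g\<^sub>2)\<close> with respect to the weights \<open>Q\<^sub>0, Q, R\<close>.  Put
  \<open>z = Q\<^sub>0 z\<^sub>0\<close> and \<open>p = Q g\<^sub>1\<close>.  Varying \<open>\<eta>\<close> gives \<open>U = - R g\<^sub>2\<close>, varying the trajectory gives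
  \<open>F\<^sup>T p(r) = F\<^sup>T l + \<integral>\<^sub>r\<^sup>t (A\<^sup>T p - H\<^sup>T U)\<close>, and varying the initial value gives \<open>F\<^sup>T z = F\<^sup>T p(0)\<close>.  So
  \<open>(p(t - s), U(t - s))\<close> is a dual solution, and its cost is at most the squared norm of the functional.
\<close>

text \<open>The weight of the triples \<open>(F x(0), f, \<eta>)\<close>; the constant component is spread over \<open>[0, t]\<close>.\<close>

definition primal_weight :: "real \<Rightarrow> real^'m^'m \<Rightarrow> real^'m^'m \<Rightarrow> real^'p^'p \<Rightarrow>
    (real^'m) \<times> (real^'m) \<times> (real^'p) \<Rightarrow> (real^'m) \<times> (real^'m) \<times> (real^'p)" where
  "primal_weight t Q0 Q R z =
     ((1 / t) *\<^sub>R (Q0 *v fst z), Q *v fst (snd z), R *v snd (snd z))"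

lemma inner_primal_weight:
  "w \<bullet> primal_weight t Q0 Q R z = (fst w \<bullet> (Q0 *v fst z)) / t + fst (snd w) \<bullet> (Q *v fst (snd z)) +
     snd (snd w) \<bullet> (R *v snd (snd z))"
  by (simp add: primal_weight_def inner_prod_def)

lemma pos_op_primal_weight:
  assumes "0 < t" "sym_pos_def Q0" "sym_pos_def Q" "sym_pos_def R"
  shows "pos_op (primal_weight t Q0 Q R)"
proof -
  note p = assms(2-4)[THEN sym_pos_def_pos_op]
  have "0 < z \<bullet> primal_weight t Q0 Q R z" if nz: "z \<noteq> 0" for z
  proof -
    obtain a b c where z: "z = (a, b, c)" by (metis surj_pair)
    have nn: "0 \<le> (a \<bullet> (Q0 *v a)) / t" "0 \<le> b \<bullet> (Q *v b)" "0 \<le> c \<bullet> (R *v c)"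
      using pos_op_nonneg[OF p(1)] pos_op_nonneg[OF p(2)] pos_op_nonneg[OF p(3)] assms(1) by auto
    consider "a \<noteq> 0" | "b \<noteq> 0" | "c \<noteq> 0" using nz z by (auto simp: zero_prod_def)
    then show ?thesis
    proof cases
      case 1
      then have "0 < (a \<bullet> (Q0 *v a)) / t" using pos_op_pos[OF p(1)] assms(1) by simp
      then show ?thesis using nn by (simp add: inner_primal_weight z)
    next
      case 2
      from pos_op_pos[OF p(2) this] show ?thesis using nn by (simp add: inner_primal_weight z)
    next
      case 3
      from pos_op_pos[OF p(3) this] show ?thesis using nn by (simp add: inner_primal_weight z)
    qed
  qed
  moreover have "linear (primal_weight t Q0 Q R)"
    by (auto intro!: linearI simp: primal_weight_def matrix_vector_right_distrib
        matrix_vector_mult_scaleR algebra_simps)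
  moreover have "primal_weight t Q0 Q R w \<bullet> z = w \<bullet> primal_weight t Q0 Q R z" for w z
    by (simp add: primal_weight_def inner_prod_def pos_op_sym[OF p(1)] pos_op_sym[OF p(2)] pos_op_sym[OF p(3)])
  ultimately show ?thesis by (simp add: pos_op_def)
qed

text \<open>Test trajectories \<open>x(s) = x\<^sub>0 + \<integral>\<^sub>0\<^sup>s \<xi>\<close>, for which \<open>F x\<close> is absolutely continuous.\<close>

definition test_traj :: "real^'n \<Rightarrow> (real \<Rightarrow> real^'n) \<Rightarrow> real \<Rightarrow> real^'n" where
  "test_traj x0 \<xi> s = x0 + (LINT r|lebesgue_on {0..s}. \<xi> r)"

lemma test_traj_0: "test_traj x0 \<xi> 0 = x0"
  by (simp add: test_traj_def integral_lebesgue_on_singleton)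

lemma test_traj_lincomb:
  assumes "\<xi> \<in> L2_on {0..t}" "\<zeta> \<in> L2_on {0..t}" "s \<in> {0..t}"
  shows "test_traj (a *\<^sub>R x0 + b *\<^sub>R y0) (\<lambda>r. a *\<^sub>R \<xi> r + b *\<^sub>R \<zeta> r) s =
    a *\<^sub>R test_traj x0 \<xi> s + b *\<^sub>R test_traj y0 \<zeta> s"
proof -
  have "integrable (lebesgue_on {0..s}) \<xi>" "integrable (lebesgue_on {0..s}) \<zeta>"
    using assms by (auto intro!: integrable_lebesgue_on_subset[OF L2_on_integrable])
  then show ?thesis by (simp add: test_traj_def algebra_simps)
qed

lemma test_traj_increment:
  assumes "\<xi> \<in> L2_on {0..t}" "0 \<le> c" "c \<le> d" "d \<le> t"
  shows "test_traj x0 \<xi> d - test_traj x0 \<xi> c = (LINT r|lebesgue_on {c..d}. \<xi> r)"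
proof -
  have "integrable (lebesgue_on {0..d}) \<xi>"
    using assms by (intro integrable_lebesgue_on_subset[OF L2_on_integrable[OF assms(1)]]) auto
  then show ?thesis
    using integral_lebesgue_on_append[of 0 d \<xi> c] assms by (simp add: test_traj_def)
qed

lemma test_traj_L2:
  assumes \<xi>: "\<xi> \<in> L2_on {0..t}"
  shows "test_traj x0 \<xi> \<in> L2_on {0..t}"
proof -
  have "abs_cont_on {0..t} (test_traj x0 \<xi>)"
    using \<xi> by (rule abs_cont_on_indefinite_integral) (rule test_traj_increment[OF \<xi>])
  then have cont: "continuous_on {0..t} (test_traj x0 \<xi>)" by (rule abs_cont_on_imp_continuous_on)
  show ?thesis
  proof (rule L2_onI)
    show "test_traj x0 \<xi> \<in> borel_measurable (lebesgue_on {0..t})"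
      using cont by (intro continuous_imp_measurable_on_sets_lebesgue) auto
    have "continuous_on {0..t} (\<lambda>s. (norm (test_traj x0 \<xi> s))\<^sup>2)"
      using cont by (intro continuous_intros)
    then have "(\<lambda>s. (norm (test_traj x0 \<xi> s))\<^sup>2) absolutely_integrable_on {0..t}"
      by (rule absolutely_integrable_continuous_real)
    then show "integrable (lebesgue_on {0..t}) (\<lambda>s. (norm (test_traj x0 \<xi> s))\<^sup>2)"
      by (simp add: absolutely_integrable_imp_integrable)
  qed
qed

text \<open>
  The data \<open>(F x(0), f, \<eta>)\<close> of a test trajectory, together with the estimation error that it causes.
  Their values outside \<open>[0, t]\<close> are left free, so that linear combinations stay in the set.
\<close>

definition test_graph :: "real^'n^'m \<Rightarrow> real^'n^'m \<Rightarrow> real^'n^'p \<Rightarrow> real^'m \<Rightarrow> real \<Rightarrow> (real \<Rightarrow> real^'p) \<Rightarrow>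
    ((real \<Rightarrow> (real^'m) \<times> (real^'m) \<times> (real^'p)) \<times> real) set" where
  "test_graph F A H l t U = {(h, \<phi>). \<exists>x0 \<xi> \<eta>. \<xi> \<in> L2_on {0..t} \<and> \<eta> \<in> L2_on {0..t} \<and>
     (\<forall>s\<in>{0..t}. h s = (F *v x0, F *v \<xi> s - A *v test_traj x0 \<xi> s, \<eta> s)) \<and>
     \<phi> = l \<bullet> (F *v test_traj x0 \<xi> t) -
       (LINT s|lebesgue_on {0..t}. (H *v test_traj x0 \<xi> s + \<eta> s) \<bullet> U s)}"

context
  fixes F A :: "real^'n^'m" and H :: "real^'n^'p" and Q0 Q :: "real^'m^'m" and R :: "real^'p^'p"
    and l :: "real^'m" and t :: real and U :: "real \<Rightarrow> real^'p"
  assumes Q0: "sym_pos_def Q0" and Q: "sym_pos_def Q" and R: "sym_pos_def R"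
    and t: "0 < t" and U: "U \<in> L2_on {0..t}"
begin

abbreviation "K \<equiv> primal_weight t Q0 Q R"
abbreviation "\<Gamma> \<equiv> test_graph F A H l t U"

lemma pos_op_K: "pos_op K"
  by (rule pos_op_primal_weight[OF t Q0 Q R])

lemma test_graph_memI:
  assumes "\<xi> \<in> L2_on {0..t}" "\<eta> \<in> L2_on {0..t}"
  shows "(\<lambda>s. (F *v x0, F *v \<xi> s - A *v test_traj x0 \<xi> s, \<eta> s),
     l \<bullet> (F *v test_traj x0 \<xi> t) -
       (LINT s|lebesgue_on {0..t}. (H *v test_traj x0 \<xi> s + \<eta> s) \<bullet> U s)) \<in> \<Gamma>"
  using assms unfolding test_graph_def by blast

lemma test_force_L2:
  "\<xi> \<in> L2_on {0..t} \<Longrightarrow> (\<lambda>s. F *v \<xi> s - A *v test_traj x0 \<xi> s) \<in> L2_on {0..t}"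
  by (intro L2_on_diff L2_on_matrix test_traj_L2)

lemma test_output_integrable:
  "\<xi> \<in> L2_on {0..t} \<Longrightarrow> \<eta> \<in> L2_on {0..t} \<Longrightarrow>
    integrable (lebesgue_on {0..t}) (\<lambda>s. (H *v test_traj x0 \<xi> s + \<eta> s) \<bullet> U s)"
  by (intro L2_on_inner_integrable L2_on_add L2_on_matrix test_traj_L2 U)

lemma test_graph_L2: "(h, \<phi>) \<in> \<Gamma> \<Longrightarrow> h \<in> L2_on {0..t}"
proof -
  assume "(h, \<phi>) \<in> \<Gamma>"
  then obtain x0 \<xi> \<eta> where s: "\<xi> \<in> L2_on {0..t}" "\<eta> \<in> L2_on {0..t}"
     "\<forall>s\<in>{0..t}. h s = (F *v x0, F *v \<xi> s - A *v test_traj x0 \<xi> s, \<eta> s)"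
    unfolding test_graph_def by blast
  have "(\<lambda>s. (F *v x0, F *v \<xi> s - A *v test_traj x0 \<xi> s, \<eta> s)) \<in> L2_on {0..t}"
    by (intro L2_on_Pair L2_on_const test_force_L2 s)
  then show ?thesis by (rule L2_on_cong) (use s(3) in blast)
qed

lemma test_graph_lincomb:
  assumes "(h, \<phi>) \<in> \<Gamma>" "(k, \<psi>) \<in> \<Gamma>"
  shows "(\<lambda>s. a *\<^sub>R h s + b *\<^sub>R k s, a * \<phi> + b * \<psi>) \<in> \<Gamma>"
proof -
  obtain x0 \<xi> \<eta> where 1: "\<xi> \<in> L2_on {0..t}" "\<eta> \<in> L2_on {0..t}"
     "\<forall>s\<in>{0..t}. h s = (F *v x0, F *v \<xi> s - A *v test_traj x0 \<xi> s, \<eta> s)"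
     "\<phi> = l \<bullet> (F *v test_traj x0 \<xi> t) - (LINT s|lebesgue_on {0..t}. (H *v test_traj x0 \<xi> s + \<eta> s) \<bullet> U s)"
    using assms(1) unfolding test_graph_def by blast
  obtain y0 \<zeta> \<theta> where 2: "\<zeta> \<in> L2_on {0..t}" "\<theta> \<in> L2_on {0..t}"
     "\<forall>s\<in>{0..t}. k s = (F *v y0, F *v \<zeta> s - A *v test_traj y0 \<zeta> s, \<theta> s)"
     "\<psi> = l \<bullet> (F *v test_traj y0 \<zeta> t) - (LINT s|lebesgue_on {0..t}. (H *v test_traj y0 \<zeta> s + \<theta> s) \<bullet> U s)"
    using assms(2) unfolding test_graph_def by blast
  define z0 where "z0 = a *\<^sub>R x0 + b *\<^sub>R y0"
  define \<rho> where "\<rho> s = a *\<^sub>R \<xi> s + b *\<^sub>R \<zeta> s" for s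
  define \<omega> where "\<omega> s = a *\<^sub>R \<eta> s + b *\<^sub>R \<theta> s" for s
  have L2: "\<rho> \<in> L2_on {0..t}" "\<omega> \<in> L2_on {0..t}"
    unfolding \<rho>_def \<omega>_def using 1 2 by (auto intro!: L2_on_add L2_on_scaleR)
  have traj: "test_traj z0 \<rho> s = a *\<^sub>R test_traj x0 \<xi> s + b *\<^sub>R test_traj y0 \<zeta> s" if "s \<in> {0..t}" for s
    unfolding z0_def \<rho>_def by (rule test_traj_lincomb[OF 1(1) 2(1) that])
  have int: "integrable (lebesgue_on {0..t}) (\<lambda>s. (H *v test_traj x0 \<xi> s + \<eta> s) \<bullet> U s)"
    "integrable (lebesgue_on {0..t}) (\<lambda>s. (H *v test_traj y0 \<zeta> s + \<theta> s) \<bullet> U s)"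
    by (intro test_output_integrable 1 2)+
  have "(LINT s|lebesgue_on {0..t}. (H *v test_traj z0 \<rho> s + \<omega> s) \<bullet> U s) =
      (LINT s|lebesgue_on {0..t}. a * ((H *v test_traj x0 \<xi> s + \<eta> s) \<bullet> U s) +
         b * ((H *v test_traj y0 \<zeta> s + \<theta> s) \<bullet> U s))"
    by (intro Bochner_Integration.integral_cong)
      (auto simp: space_restrict_space traj \<omega>_def matrix_vector_right_distrib matrix_vector_mult_scaleR
        inner_add_left algebra_simps)
  also have "\<dots> = a * (LINT s|lebesgue_on {0..t}. (H *v test_traj x0 \<xi> s + \<eta> s) \<bullet> U s) +
      b * (LINT s|lebesgue_on {0..t}. (H *v test_traj y0 \<zeta> s + \<theta> s) \<bullet> U s)"
    using int by simp
  finally have \<phi>: "a * \<phi> + b * \<psi> = l \<bullet> (F *v test_traj z0 \<rho> t) -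
      (LINT s|lebesgue_on {0..t}. (H *v test_traj z0 \<rho> s + \<omega> s) \<bullet> U s)"
    using t by (simp add: 1(4) 2(4) traj matrix_vector_right_distrib matrix_vector_mult_scaleR
        inner_add_right algebra_simps)
  have Fz0: "F *v z0 = a *\<^sub>R (F *v x0) + b *\<^sub>R (F *v y0)"
    by (simp add: z0_def matrix_vector_right_distrib matrix_vector_mult_scaleR)
  have "\<forall>s\<in>{0..t}. a *\<^sub>R h s + b *\<^sub>R k s = (F *v z0, F *v \<rho> s - A *v test_traj z0 \<rho> s, \<omega> s)"
    using 1(3) 2(3) by (auto simp: traj \<rho>_def \<omega>_def Fz0 matrix_vector_right_distrib
        matrix_vector_mult_scaleR algebra_simps)
  then show ?thesis unfolding test_graph_def using L2 \<phi> by blast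
qed

lemma test_graph_admissible:
  assumes mem: "(h, \<phi>) \<in> \<Gamma>" and N: "cost K {0..t} h \<le> 1"
  shows "ereal (\<phi>\<^sup>2) \<le> sigma_fin F A H Q0 Q R U l t"
proof -
  obtain x0 \<xi> \<eta> where s: "\<xi> \<in> L2_on {0..t}" "\<eta> \<in> L2_on {0..t}"
     "\<forall>s\<in>{0..t}. h s = (F *v x0, F *v \<xi> s - A *v test_traj x0 \<xi> s, \<eta> s)"
     "\<phi> = l \<bullet> (F *v test_traj x0 \<xi> t) - (LINT s|lebesgue_on {0..t}. (H *v test_traj x0 \<xi> s + \<eta> s) \<bullet> U s)"
    using mem unfolding test_graph_def by blast
  define x where "x = test_traj x0 \<xi>"
  define f where "f s = F *v \<xi> s - A *v x s" for s
  define y where "y s = H *v x s + \<eta> s" for s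
  have x: "x \<in> L2_on {0..t}" unfolding x_def by (rule test_traj_L2[OF s(1)])
  have f: "f \<in> L2_on {0..t}" unfolding f_def x_def by (rule test_force_L2[OF s(1)])
  have y: "y \<in> L2_on {0..t}" unfolding y_def by (intro L2_on_add L2_on_matrix x s)
  have sol: "lin_sol (primal_state F) (primal_rate A) {0..t} (\<lambda>s. (x s, f s)) (\<lambda>s. F *v x s)"
    unfolding lin_sol_def
  proof (intro conjI ballI)
    show "(\<lambda>s. (x s, f s)) \<in> L2_loc {0..t}" using t x f by (simp add: L2_loc_Icc L2_on_Pair)
    show "AE s in lebesgue_on {0..t}. F *v x s = primal_state F (x s, f s)"
      by (simp add: primal_state_def)
    fix r assume r: "r \<in> {0..t}"
    have "integrable (lebesgue_on {0..r}) \<xi>"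
      using r by (intro integrable_lebesgue_on_subset[OF L2_on_integrable[OF s(1)]]) auto
    then have "(LINT s|lebesgue_on {0..r}. F *v \<xi> s) = F *v (LINT s|lebesgue_on {0..r}. \<xi> s)"
      by (intro integral_linear_lebesgue_on matrix_vector_mul_linear)
    also have "\<dots> = F *v x r - F *v x 0"
      using test_traj_0[of x0 \<xi>] by (simp add: x_def test_traj_def matrix_vector_right_distrib integral_lebesgue_on_singleton)
    finally show "F *v x r = F *v x 0 + (LINT s|lebesgue_on {0..r}. primal_rate A (x s, f s))"
      by (simp add: primal_rate_def f_def)
  qed
  have ver: "ac_version {0..t} (\<lambda>s. F *v x s) (\<lambda>s. F *v x s)"
    using lin_sol_ac_version[OF linear_primal_state linear_primal_rate sol] t by (simp add: primal_state_def)
  have val: "ac_value {0..t} (\<lambda>s. F *v x s) r = F *v x r" if "r \<in> {0..t}" for r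
    using lin_sol_ac_value[OF linear_primal_state linear_primal_rate sol _ that] t by (simp add: primal_state_def)
  have dae: "dae_solution F A H {0..t} x f y \<eta>"
    unfolding dae_solution_def
  proof (intro conjI ballI)
    show "\<exists>w. ac_version {0..t} (\<lambda>s. F *v x s) w" using ver by blast
    fix r assume r: "r \<in> {0..t}"
    have "0 \<in> {0..t}" using t by simp
    from val[OF r] val[OF this] lin_sol_eq[OF sol r]
    show "ac_value {0..t} (\<lambda>s. F *v x s) r = ac_value {0..t} (\<lambda>s. F *v x s) 0 +
        (LINT s|lebesgue_on {0..r}. A *v x s + f s)"
      by (simp add: primal_rate_def)
  qed (use x f y s t in \<open>auto simp: L2_loc_Icc y_def\<close>)
  note pw = sym_pos_def_pos_op[OF Q] sym_pos_def_pos_op[OF R]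
  have int: "integrable (lebesgue_on {0..t}) (\<lambda>s. f s \<bullet> (Q *v f s) + \<eta> s \<bullet> (R *v \<eta> s))"
    using cost_integrable[OF pw(1) f] cost_integrable[OF pw(2) s(2)] by simp
  have "cost K {0..t} h = (LINT r|lebesgue_on {0..t}. ((F *v x0) \<bullet> (Q0 *v (F *v x0))) / t +
      (f r \<bullet> (Q *v f r) + \<eta> r \<bullet> (R *v \<eta> r)))"
    unfolding cost_def
    by (intro Bochner_Integration.integral_cong)
      (auto simp: space_restrict_space s(3) inner_primal_weight f_def x_def)
  also have "\<dots> = (F *v x0) \<bullet> (Q0 *v (F *v x0)) +
      (LINT s|lebesgue_on {0..t}. f s \<bullet> (Q *v f s) + \<eta> s \<bullet> (R *v \<eta> s))"
    using t int by (subst Bochner_Integration.integral_add)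
      (auto simp: integrable_lebesgue_on_const measure_restrict_space space_restrict_space)
  finally have N': "(F *v x0) \<bullet> (Q0 *v (F *v x0)) +
      (LINT s|lebesgue_on {0..t}. f s \<bullet> (Q *v f s) + \<eta> s \<bullet> (R *v \<eta> s)) \<le> 1"
    using N by simp
  have x_0: "x 0 = x0" by (simp add: x_def test_traj_0)
  have "(x, f, y, \<eta>) \<in> admissible F A H Q0 Q R {0..t}"
    unfolding admissible_def
  proof (clarify, intro conjI ballI dae)
    fix \<tau> assume \<tau>: "\<tau> \<in> {0..t}"
    have "(LINT s|lebesgue_on {0..\<tau>}. f s \<bullet> (Q *v f s) + \<eta> s \<bullet> (R *v \<eta> s)) \<le>
      (LINT s|lebesgue_on {0..t}. f s \<bullet> (Q *v f s) + \<eta> s \<bullet> (R *v \<eta> s))"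
      using \<tau> pos_op_nonneg[OF pw(1)] pos_op_nonneg[OF pw(2)]
      by (intro integral_lebesgue_on_mono int add_nonneg_nonneg) auto
    then show "ac_value {0..t} (\<lambda>s. F *v x s) 0 \<bullet> (Q0 *v ac_value {0..t} (\<lambda>s. F *v x s) 0) +
      (LINT s|lebesgue_on {0..\<tau>}. f s \<bullet> (Q *v f s) + \<eta> s \<bullet> (R *v \<eta> s)) \<le> 1"
      using N' val[of 0] t by (simp add: x_0)
  qed
  then have "ereal ((l \<bullet> ac_value {0..t} (\<lambda>s. F *v x s) t - (LINT s|lebesgue_on {0..t}. y s \<bullet> U s))\<^sup>2) \<le>
      sigma_fin F A H Q0 Q R U l t"
    unfolding sigma_fin_def by (rule SUP_upper2) simp
  then show ?thesis using val[of t] t by (simp add: s(4) x_def y_def)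
qed

lemma test_graph_bounded:
  assumes mem: "(h, \<phi>) \<in> \<Gamma>" and fin: "sigma_fin F A H Q0 Q R U l t = ereal s"
  shows "\<phi>\<^sup>2 \<le> s * cost K {0..t} h"
proof -
  define N where "N = cost K {0..t} h"
  have N: "0 \<le> N" unfolding N_def by (rule cost_nonneg[OF pos_op_K])
  have h: "h \<in> L2_on {0..t}" by (rule test_graph_L2[OF mem])
  have scaled: "(c * \<phi>)\<^sup>2 \<le> s" if "c\<^sup>2 * N \<le> 1" for c
  proof -
    have mem': "(\<lambda>r. c *\<^sub>R h r + 0 *\<^sub>R h r, c * \<phi> + 0 * \<phi>) \<in> \<Gamma>"
      by (rule test_graph_lincomb[OF mem mem])
    have "cost K {0..t} (\<lambda>r. c *\<^sub>R h r + 0 *\<^sub>R h r) = c\<^sup>2 * N"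
      using cost_expand[OF pos_op_K L2_on_zero h, of c] by (simp add: N_def cost_def)
    then have "cost K {0..t} (\<lambda>r. c *\<^sub>R h r + 0 *\<^sub>R h r) \<le> 1" using that by simp
    from test_graph_admissible[OF mem' this] show ?thesis by (simp add: fin)
  qed
  show ?thesis
  proof (cases "N = 0")
    case True
    have s0: "0 \<le> s" using scaled[of 0] by simp
    have "\<phi> = 0"
    proof (rule ccontr)
      assume "\<phi> \<noteq> 0"
      then have "((s + 1) / \<phi> * \<phi>)\<^sup>2 \<le> s" using scaled[of "(s + 1) / \<phi>"] True by simp
      then have "(s + 1)\<^sup>2 \<le> s" using \<open>\<phi> \<noteq> 0\<close> by simp
      then show False using s0 zero_le_power2[of s] by (simp add: power2_sum)
    qed
    then show ?thesis using True by (simp add: N_def)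
  next
    case False
    then have N': "0 < N" using N by simp
    then have "(1 / sqrt N * \<phi>)\<^sup>2 \<le> s" by (intro scaled) (simp add: power_divide)
    then have "\<phi>\<^sup>2 / N \<le> s" using N' by (simp add: power_divide)
    then show ?thesis using N' by (simp add: N_def[symmetric] field_simps)
  qed
qed

lemma strong_duality:
  "(INF (q, u) \<in> dual_solutions F A H l {0..t}. ereal (J F Q0 Q R q u t)) \<le> sigma_fin F A H Q0 Q R U l t"
proof (cases "sigma_fin F A H Q0 Q R U l t")
  case MInf
  have "(\<lambda>s. (F *v 0, F *v 0 - A *v test_traj 0 (\<lambda>s. 0) s, 0), l \<bullet> (F *v test_traj 0 (\<lambda>s. 0) t) -
      (LINT s|lebesgue_on {0..t}. (H *v test_traj 0 (\<lambda>s. 0) s + 0) \<bullet> U s)) \<in> \<Gamma>"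
    by (intro test_graph_memI L2_on_zero)
  then have "(\<lambda>s. 0, 0) \<in> \<Gamma>" by (simp add: test_traj_def zero_prod_def)
  from test_graph_admissible[OF this] show ?thesis
    using MInf by (simp add: cost_def)
next
  case (real s)
  let ?M = "lebesgue_on {0..t}"
  have ne: "\<Gamma> \<noteq> {}" using test_graph_memI[OF L2_on_zero L2_on_zero] by blast
  have s0: "0 \<le> s"
  proof -
    obtain h \<phi> where "(h, \<phi>) \<in> \<Gamma>" using ne by auto
    from test_graph_lincomb[OF this this, of 0 0] have "(\<lambda>s. 0, 0) \<in> \<Gamma>" by simp
    from test_graph_admissible[OF this] show ?thesis using real by (simp add: cost_def)
  qed
  obtain g hs where g: "g \<in> L2_on {0..t}" and rep: "\<And>h \<phi>. (h, \<phi>) \<in> \<Gamma> \<Longrightarrow> \<phi> = (LINT r|?M. g r \<bullet> K (h r))"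
    and cost_g: "cost K {0..t} g \<le> s" and hs: "\<And>k::nat. hs k \<in> fst ` \<Gamma>"
    and lim: "AE r in ?M. (\<lambda>k. hs k r) \<longlonglongrightarrow> g r"
  proof (rule bounded_functional_representation[OF pos_op_K, of \<Gamma> "{0..t}" s])
    show "h \<in> L2_on {0..t}" if "(h, \<phi>) \<in> \<Gamma>" for h \<phi> by (rule test_graph_L2[OF that])
    show "(\<lambda>r. a *\<^sub>R h r + b *\<^sub>R k r, a * \<phi> + b * \<psi>) \<in> \<Gamma>"
      if "(h, \<phi>) \<in> \<Gamma>" "(k, \<psi>) \<in> \<Gamma>" for h \<phi> k \<psi> a b
      by (rule test_graph_lincomb[OF that])
    show "\<phi>\<^sup>2 \<le> s * cost K {0..t} h" if "(h, \<phi>) \<in> \<Gamma>" for h \<phi>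
      by (rule test_graph_bounded[OF that real])
  qed (rule ne s0 that; assumption?)+
  \<comment> \<open>the first component of the representing function is a constant \<open>z0\<close>\<close>
  have "\<exists>a. \<forall>r\<in>{0..t}. fst (hs k r) = F *v a" for k
    using hs[of k] unfolding test_graph_def by auto
  then obtain a where a: "\<And>k r. r \<in> {0..t} \<Longrightarrow> fst (hs k r) = F *v a k" by metis
  have "AE r in ?M. r \<in> {0..t}" by (rule AE_I2) (simp add: space_restrict_space)
  with lim have lim_a: "AE r in ?M. (\<lambda>k. F *v a k) \<longlonglongrightarrow> fst (g r)"
  proof eventually_elim
    case (elim r)
    from tendsto_fst[OF elim(1)] show ?case using a[OF elim(2)] by simp
  qed
  have nontriv: "ae_filter ?M \<noteq> bot"
    using t by (simp add: ae_filter_eq_bot_iff emeasure_restrict_space space_restrict_space)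
  obtain z0 where z0: "(\<lambda>k. F *v a k) \<longlonglongrightarrow> z0"
    using eventually_happens'[OF nontriv lim_a] by blast
  have g0: "AE r in ?M. fst (g r) = z0"
    using lim_a by eventually_elim (rule LIMSEQ_unique[OF _ z0])
  define g1 where "g1 r = fst (snd (g r))" for r
  define g2 where "g2 r = snd (snd (g r))" for r
  have L2g: "g1 \<in> L2_on {0..t}" "g2 \<in> L2_on {0..t}"
    using L2_on_fst[OF L2_on_snd[OF g]] L2_on_snd[OF L2_on_snd[OF g]]
    by (simp_all add: g1_def[abs_def] g2_def[abs_def])
  define p where "p r = Q *v g1 r" for r
  define z where "z = Q0 *v z0"
  have p: "p \<in> L2_on {0..t}" unfolding p_def by (rule L2_on_matrix[OF L2g(1)])
  note pQ = sym_pos_def_pos_op[OF Q] and pR = sym_pos_def_pos_op[OF R] and pQ0 = sym_pos_def_pos_op[OF Q0]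
  have const_int: "(LINT r|?M. c / t) = c" for c :: real
    using t by (simp add: measure_restrict_space space_restrict_space)
  have rep': "l \<bullet> (F *v test_traj x0 \<xi> t) - (LINT r|?M. (H *v test_traj x0 \<xi> r + \<eta> r) \<bullet> U r) =
      z \<bullet> (F *v x0) + (LINT r|?M. p r \<bullet> (F *v \<xi> r - A *v test_traj x0 \<xi> r)) + (LINT r|?M. (R *v g2 r) \<bullet> \<eta> r)"
    if \<xi>: "\<xi> \<in> L2_on {0..t}" and \<eta>: "\<eta> \<in> L2_on {0..t}" for x0 \<xi> \<eta>
  proof -
    define h where "h r = (F *v x0, F *v \<xi> r - A *v test_traj x0 \<xi> r, \<eta> r)" for r
    have mem: "(h, l \<bullet> (F *v test_traj x0 \<xi> t) - (LINT r|?M. (H *v test_traj x0 \<xi> r + \<eta> r) \<bullet> U r)) \<in> \<Gamma>"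
      unfolding h_def by (rule test_graph_memI[OF \<xi> \<eta>])
    have int1: "integrable ?M (\<lambda>r. p r \<bullet> (F *v \<xi> r - A *v test_traj x0 \<xi> r))"
      by (intro L2_on_inner_integrable p test_force_L2 \<xi>)
    have int2: "integrable ?M (\<lambda>r. (R *v g2 r) \<bullet> \<eta> r)"
      by (intro L2_on_inner_integrable L2_on_matrix L2g \<eta>)
    have int0: "integrable ?M (\<lambda>r. (z \<bullet> (F *v x0)) / t)" by (rule integrable_lebesgue_on_const)
    have "(LINT r|?M. g r \<bullet> K (h r)) =
       (LINT r|?M. (z \<bullet> (F *v x0)) / t + p r \<bullet> (F *v \<xi> r - A *v test_traj x0 \<xi> r) + (R *v g2 r) \<bullet> \<eta> r)"
    proof (rule integral_cong_AE)
      show "AE r in ?M. g r \<bullet> K (h r) =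
          (z \<bullet> (F *v x0)) / t + p r \<bullet> (F *v \<xi> r - A *v test_traj x0 \<xi> r) + (R *v g2 r) \<bullet> \<eta> r"
        using g0
      proof eventually_elim
        case (elim r)
        show ?case
          by (simp add: inner_primal_weight h_def elim z_def p_def pos_op_sym[OF pQ0] pos_op_sym[OF pQ]
              pos_op_sym[OF pR] flip: g1_def g2_def)
      qed
      show "(\<lambda>r. g r \<bullet> K (h r)) \<in> borel_measurable ?M"
        by (rule borel_measurable_integrable[OF L2_on_inner_integrable[OF g L2_on_pos_op[OF pos_op_K test_graph_L2[OF mem]]]])
    qed (use int0 int1 int2 in auto)
    also have "\<dots> = z \<bullet> (F *v x0) + (LINT r|?M. p r \<bullet> (F *v \<xi> r - A *v test_traj x0 \<xi> r)) + (LINT r|?M. (R *v g2 r) \<bullet> \<eta> r)"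
      using int0 int1 int2 const_int by (simp only: Bochner_Integration.integral_add Bochner_Integration.integrable_add)
    finally show ?thesis using rep[OF mem] by simp
  qed
  have zero_of_sq: "AE r in ?M. e r = 0" if e: "e \<in> L2_on {0..t}" and "(LINT r|?M. e r \<bullet> e r) = 0"
    for e :: "real \<Rightarrow> 'k::euclidean_space"
  proof -
    have "AE r in ?M. e r \<bullet> e r = 0"
      using that(2) L2_on_inner_integrable[OF e e] by (subst (asm) integral_nonneg_eq_0_iff_AE) auto
    then show ?thesis by eventually_elim simp
  qed
  \<comment> \<open>vary \<open>\<eta>\<close>\<close>
  have Ug: "AE r in ?M. U r + R *v g2 r = 0"
  proof (rule zero_of_sq)
    show e: "(\<lambda>r. U r + R *v g2 r) \<in> L2_on {0..t}" by (intro L2_on_add U L2_on_matrix L2g)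
    have "- (LINT r|?M. (U r + R *v g2 r) \<bullet> U r) = (LINT r|?M. (R *v g2 r) \<bullet> (U r + R *v g2 r))"
      using rep'[OF L2_on_zero e, of 0] by (simp add: test_traj_def)
    moreover have "(LINT r|?M. (U r + R *v g2 r) \<bullet> (U r + R *v g2 r)) =
        (LINT r|?M. (U r + R *v g2 r) \<bullet> U r) + (LINT r|?M. (R *v g2 r) \<bullet> (U r + R *v g2 r))"
      using L2_on_inner_integrable[OF e U] L2_on_inner_integrable[OF L2_on_matrix[OF L2g(2)] e]
      by (subst Bochner_Integration.integral_add[symmetric]) (auto simp: algebra_simps inner_commute)
    ultimately show "(LINT r|?M. (U r + R *v g2 r) \<bullet> (U r + R *v g2 r)) = 0" by simp
  qed
  define d where "d r = dual_rate A H (p r, U r)" for r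
  define \<Lambda> where "\<Lambda> = test_traj 0 d"
  have d: "d \<in> L2_on {0..t}" unfolding d_def by (intro L2_on_linear[OF linear_dual_rate] L2_on_Pair p U)
  have \<Lambda>: "\<Lambda> \<in> L2_on {0..t}" unfolding \<Lambda>_def by (rule test_traj_L2[OF d])
  have \<Lambda>0: "\<Lambda> 0 = 0" by (simp add: \<Lambda>_def test_traj_0)
  have key: "(transpose F *v l + \<Lambda> t) \<bullet> test_traj x0 \<xi> t =
      (transpose F *v z) \<bullet> x0 + (LINT r|?M. (transpose F *v p r + \<Lambda> r) \<bullet> \<xi> r)"
    if \<xi>: "\<xi> \<in> L2_on {0..t}" for x0 \<xi>
  proof -
    let ?x = "test_traj x0 \<xi>"
    have x: "?x \<in> L2_on {0..t}" by (rule test_traj_L2[OF \<xi>])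
    have ibp: "(LINT r|?M. d r \<bullet> ?x r) + (LINT r|?M. \<Lambda> r \<bullet> \<xi> r) = \<Lambda> t \<bullet> ?x t - \<Lambda> 0 \<bullet> ?x 0"
    proof (rule integral_by_parts_inner(2))
      show "\<Lambda> r = \<Lambda> 0 + (LINT p|lebesgue_on {0..r}. d p)" for r
        unfolding \<Lambda>0 by (simp add: \<Lambda>_def test_traj_def)
      show "?x r = ?x 0 + (LINT p|lebesgue_on {0..r}. \<xi> p)" for r
        unfolding test_traj_0 by (simp add: test_traj_def)
    qed (use t d \<xi> in \<open>auto intro: L2_on_integrable\<close>)
    have int: "integrable ?M (\<lambda>r. (transpose F *v p r) \<bullet> \<xi> r)" "integrable ?M (\<lambda>r. d r \<bullet> ?x r)"
        "integrable ?M (\<lambda>r. (H *v ?x r) \<bullet> U r)" "integrable ?M (\<lambda>r. \<Lambda> r \<bullet> \<xi> r)"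
      by (intro L2_on_inner_integrable L2_on_matrix p d x \<xi> U \<Lambda>)+
    have "(LINT r|?M. p r \<bullet> (F *v \<xi> r - A *v ?x r)) =
        (LINT r|?M. (transpose F *v p r) \<bullet> \<xi> r - d r \<bullet> ?x r - (H *v ?x r) \<bullet> U r)"
      by (intro Bochner_Integration.integral_cong)
        (simp_all add: d_def dual_rate_def inner_transpose_matrix inner_diff_left inner_diff_right
          inner_commute[of "U _"])
    also have "\<dots> = (LINT r|?M. (transpose F *v p r) \<bullet> \<xi> r) - (LINT r|?M. d r \<bullet> ?x r) - (LINT r|?M. (H *v ?x r) \<bullet> U r)"
      using int by simp
    finally have "l \<bullet> (F *v ?x t) = z \<bullet> (F *v x0) + (LINT r|?M. (transpose F *v p r) \<bullet> \<xi> r) - (LINT r|?M. d r \<bullet> ?x r)"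
      using rep'[OF \<xi> L2_on_zero, of x0] by simp
    moreover have "(LINT r|?M. (transpose F *v p r + \<Lambda> r) \<bullet> \<xi> r) =
        (LINT r|?M. (transpose F *v p r) \<bullet> \<xi> r) + (LINT r|?M. \<Lambda> r \<bullet> \<xi> r)"
      using int by (simp add: inner_add_left)
    ultimately show ?thesis
      using ibp \<Lambda>0 by (simp add: inner_add_left inner_matrix_transpose)
  qed
  \<comment> \<open>vary the initial value\<close>
  have end_state: "transpose F *v l + \<Lambda> t = transpose F *v z"
  proof -
    have "(transpose F *v l + \<Lambda> t - transpose F *v z) \<bullet> x0 = 0" for x0
      using key[OF L2_on_zero, of x0] by (simp add: test_traj_def inner_diff_left)
    then show ?thesis by (metis inner_eq_zero_iff right_minus_eq)
  qed
  \<comment> \<open>vary the derivative of the trajectory\<close>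
  have state: "AE r in ?M. transpose F *v p r + \<Lambda> r - (transpose F *v l + \<Lambda> t) = 0"
  proof (rule zero_of_sq)
    let ?c = "transpose F *v l + \<Lambda> t"
    let ?b = "\<lambda>r. transpose F *v p r + \<Lambda> r"
    have b: "?b \<in> L2_on {0..t}" by (intro L2_on_add L2_on_matrix p \<Lambda>)
    show e: "(\<lambda>r. ?b r - ?c) \<in> L2_on {0..t}" by (intro L2_on_diff b L2_on_const)
    have "?c \<bullet> (LINT r|?M. ?b r - ?c) = (LINT r|?M. ?b r \<bullet> (?b r - ?c))"
      using key[OF e, of 0] by (simp add: test_traj_def)
    moreover have "?c \<bullet> (LINT r|?M. ?b r - ?c) = (LINT r|?M. ?c \<bullet> (?b r - ?c))"
      using L2_on_integrable[OF e] by simp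
    moreover have "(LINT r|?M. (?b r - ?c) \<bullet> (?b r - ?c)) =
        (LINT r|?M. ?b r \<bullet> (?b r - ?c)) - (LINT r|?M. ?c \<bullet> (?b r - ?c))"
      using L2_on_inner_integrable[OF b e] L2_on_inner_integrable[OF L2_on_const e]
      by (subst Bochner_Integration.integral_diff[symmetric]) (auto simp: inner_diff_left)
    ultimately show "(LINT r|?M. (?b r - ?c) \<bullet> (?b r - ?c)) = 0" by simp
  qed
  define q where "q r = p (t - r)" for r
  define u where "u r = U (t - r)" for r
  define W where "W r = transpose F *v l + \<Lambda> t - \<Lambda> (t - r)" for r
  have rev: "{0..t} = (\<lambda>r. t + - 1 * r) -` {0..t}" by auto
  have qu: "q \<in> L2_on {0..t}" "u \<in> L2_on {0..t}"
    using L2_on_affine[OF _ _ rev p] L2_on_affine[OF _ _ rev U]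
    by (simp_all add: q_def[abs_def] u_def[abs_def])
  have W0: "W 0 = transpose F *v l" by (simp add: W_def)
  have Wt: "W t = transpose F *v z" by (simp add: W_def \<Lambda>0 end_state)
  have sol: "dual_sol F A H {0..t} (\<lambda>r. (q r, u r)) W"
    unfolding lin_sol_def
  proof (intro conjI ballI)
    show "(\<lambda>r. (q r, u r)) \<in> L2_loc {0..t}" using t qu by (simp add: L2_loc_Icc L2_on_Pair)
    show "AE r in ?M. W r = dual_state F (q r, u r)"
      using AE_affine[OF _ _ rev state, simplified]
      by eventually_elim (simp add: W_def dual_state_def q_def algebra_simps)
    fix r assume r: "r \<in> {0..t}"
    have T: "{0..r} = (\<lambda>s. t + - 1 * s) -` {t - r..t}" by auto
    have int: "integrable (lebesgue_on {t - r..t}) d"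
      using r by (intro integrable_lebesgue_on_subset[OF L2_on_integrable[OF d]]) auto
    have "(LINT s|lebesgue_on {0..r}. dual_rate A H (q s, u s)) = (LINT s|lebesgue_on {t - r..t}. d s)"
      using integrable_affine(2)[OF _ _ T int] by (simp add: d_def q_def u_def)
    also have "\<dots> = \<Lambda> t - \<Lambda> (t - r)"
      unfolding \<Lambda>_def using r by (intro test_traj_increment[OF d, symmetric]) auto
    finally show "W r = W 0 + (LINT s|lebesgue_on {0..r}. dual_rate A H (q s, u s))"
      by (simp add: W_def)
  qed
  have mem: "(q, u) \<in> dual_solutions F A H l {0..t}"
    using sol W0 t by (subst dual_solutions_iff) auto
  have g_cost: "(LINT r|?M. g1 r \<bullet> (Q *v g1 r) + g2 r \<bullet> (R *v g2 r)) = cost (dual_weight Q R) {0..t} (\<lambda>r. (q r, u r))"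
  proof -
    have pU: "(\<lambda>r. (p r, U r)) \<in> L2_on {0..t}" by (intro L2_on_Pair p U)
    note ci = cost_integrable[OF pos_op_dual_weight[OF Q R] pU]
    have "cost (dual_weight Q R) {0..t} (\<lambda>r. (q r, u r)) = cost (dual_weight Q R) {0..t} (\<lambda>r. (p r, U r))"
      using integrable_affine(2)[OF _ _ rev ci] by (simp add: cost_def q_def u_def)
    also have "\<dots> = (LINT r|?M. g1 r \<bullet> (Q *v g1 r) + g2 r \<bullet> (R *v g2 r))"
      unfolding cost_def
    proof (rule integral_cong_AE)
      show "AE r in ?M. (p r, U r) \<bullet> dual_weight Q R (p r, U r) = g1 r \<bullet> (Q *v g1 r) + g2 r \<bullet> (R *v g2 r)"
        using Ug
      proof eventually_elim
        case (elim r)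
        then have "U r = R *v (- g2 r)" by (simp add: linear_neg[OF matrix_vector_mul_linear] eq_neg_iff_add_eq_0)
        then show ?case
          by (simp add: dual_weight_def inner_prod_def p_def sym_pos_def_inverse[OF Q] sym_pos_def_inverse[OF R]
              inner_commute linear_neg[OF matrix_vector_mul_linear])
      qed
    qed (use ci cost_integrable[OF pQ L2g(1)] cost_integrable[OF pR L2g(2)] in auto)
    finally show ?thesis by simp
  qed
  have "J F Q0 Q R q u t = terminal_cost F Q0 (W t) + cost (dual_weight Q R) {0..t} (\<lambda>r. (q r, u r))"
    using t by (intro J_lin_sol[OF sol]) auto
  also have "\<dots> \<le> z \<bullet> (matrix_inv Q0 *v z) + (LINT r|?M. g1 r \<bullet> (Q *v g1 r) + g2 r \<bullet> (R *v g2 r))"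
    using terminal_cost_le[OF Q0 Wt[symmetric]] by (simp add: g_cost)
  also have "\<dots> = (LINT r|?M. (z0 \<bullet> (Q0 *v z0)) / t) + (LINT r|?M. g1 r \<bullet> (Q *v g1 r) + g2 r \<bullet> (R *v g2 r))"
    unfolding const_int by (simp add: z_def sym_pos_def_inverse[OF Q0] inner_commute)
  also have "\<dots> = (LINT r|?M. (z0 \<bullet> (Q0 *v z0)) / t + (g1 r \<bullet> (Q *v g1 r) + g2 r \<bullet> (R *v g2 r)))"
    using cost_integrable[OF pQ L2g(1)] cost_integrable[OF pR L2g(2)]
    by (subst Bochner_Integration.integral_add) (auto simp: integrable_lebesgue_on_const)
  also have "\<dots> = cost K {0..t} g"
    unfolding cost_def
  proof (rule integral_cong_AE)
    show "AE r in ?M. (z0 \<bullet> (Q0 *v z0)) / t + (g1 r \<bullet> (Q *v g1 r) + g2 r \<bullet> (R *v g2 r)) = g r \<bullet> K (g r)"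
      using g0 by eventually_elim (simp add: inner_primal_weight g1_def g2_def)
  qed (use cost_integrable[OF pos_op_K g] cost_integrable[OF pQ L2g(1)] cost_integrable[OF pR L2g(2)] in auto)
  also note cost_g
  finally have "ereal (J F Q0 Q R q u t) \<le> ereal s" by simp
  then show ?thesis
    unfolding real using mem by (intro INF_lower2[of "(q, u)"]) auto
qed simp

end

section \<open>The minimax observer\<close>

context
  fixes F A :: "real^'n^'m" and H :: "real^'n^'p" and Q0 Q :: "real^'m^'m" and R :: "real^'p^'p"
    and l :: "real^'m"
  assumes Q0: "sym_pos_def Q0" and Q: "sym_pos_def Q" and R: "sym_pos_def R"
begin

lemma dual_cost_tendsto_zero:
  assumes sol: "dual_sol F A H {0..} \<xi> W"
    and bound: "\<And>T. 0 \<le> T \<Longrightarrow> cost (dual_weight Q R) {0..T} \<xi> \<le> C"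
  shows "(W \<longlongrightarrow> 0) at_top"
proof -
  note pK = pos_op_dual_weight[OF Q R]
  obtain c where c: "0 < c" "\<And>x. c * (norm x)\<^sup>2 \<le> x \<bullet> dual_weight Q R x"
    using pos_op_coercive[OF pK] by blast
  show ?thesis
  proof (rule lin_sol_tendsto_zero[OF linear_dual_state linear_dual_rate sol])
    fix T :: real assume T: "0 \<le> T"
    then have xi: "\<xi> \<in> L2_on {0..T}" using lin_sol_L2[OF sol] by (simp add: L2_loc_atLeast)
    have "c * (LINT t|lebesgue_on {0..T}. (norm (\<xi> t))\<^sup>2) = (LINT t|lebesgue_on {0..T}. c * (norm (\<xi> t))\<^sup>2)"
      by simp
    also have "\<dots> \<le> cost (dual_weight Q R) {0..T} \<xi>"
      unfolding cost_def using L2_on_integrable_sq[OF xi] cost_integrable[OF pK xi] c(2)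
      by (intro integral_mono) auto
    also have "\<dots> \<le> C" by (rule bound[OF T])
    finally show "(LINT t|lebesgue_on {0..T}. (norm (\<xi> t))\<^sup>2) \<le> C / c"
      using c(1) by (simp add: field_simps)
  qed
qed

lemma detectableI:
  assumes "dual_sol F A H {0..} (\<lambda>t. (q t, u t)) W"
    and "W 0 = transpose F *v l" "(W \<longlongrightarrow> 0) at_top"
  shows "detectable F A H l"
proof -
  have "(q, u) \<in> dual_solutions F A H l {0..}" using assms by (subst dual_solutions_iff) auto
  moreover have "\<forall>\<^sub>F t in at_top. W t = ac_value {0..} (\<lambda>s. transpose F *v q s) t"
    using eventually_ge_at_top[of 0]
    by eventually_elim
      (use lin_sol_ac_value[OF linear_dual_state linear_dual_rate assms(1)] in \<open>simp add: dual_state_def\<close>)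
  then have "(ac_value {0..} (\<lambda>s. transpose F *v q s) \<longlongrightarrow> 0) at_top"
    using assms(3) by (rule Lim_transform_eventually[rotated])
  ultimately show ?thesis unfolding detectable_def by blast
qed

lemma detectable_of_finite_cost:
  assumes mem: "(q, u) \<in> dual_solutions F A H l {0..}"
    and fin: "Limsup at_top (\<lambda>\<tau>. ereal (J F Q0 Q R q u \<tau>)) < \<infinity>"
  shows "detectable F A H l"
proof -
  obtain W where W: "dual_sol F A H {0..} (\<lambda>t. (q t, u t)) W" "W 0 = transpose F *v l"
    using mem by (subst (asm) dual_solutions_iff) auto
  obtain n :: nat where "Limsup at_top (\<lambda>\<tau>. ereal (J F Q0 Q R q u \<tau>)) < ereal (real n)"
    using fin less_PInf_Ex_of_nat by auto
  from Limsup_lessD[OF this] obtain T where T: "\<And>\<tau>. T \<le> \<tau> \<Longrightarrow> J F Q0 Q R q u \<tau> < real n"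
    unfolding eventually_at_top_linorder by auto
  show ?thesis
  proof (rule detectableI[OF W], rule dual_cost_tendsto_zero[OF W(1)])
    fix \<tau> :: real assume \<tau>: "0 \<le> \<tau>"
    define r where "r = max (max \<tau> T) 1"
    have r: "\<tau> \<le> r" "T \<le> r" "0 < r" by (auto simp: r_def)
    have "(\<lambda>t. (q t, u t)) \<in> L2_on {0..r}" using lin_sol_L2[OF W(1)] r by (simp add: L2_loc_atLeast)
    then have "cost (dual_weight Q R) {0..\<tau>} (\<lambda>t. (q t, u t)) \<le> cost (dual_weight Q R) {0..r} (\<lambda>t. (q t, u t))"
      using r by (intro cost_mono[OF pos_op_dual_weight[OF Q R]]) auto
    also have "\<dots> \<le> J F Q0 Q R q u r"
      using J_lin_sol[OF W(1), of r Q0 Q R] terminal_cost_nonneg[OF Q0 dual_lin_sol_range[OF W(1), of r]] r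
      by simp
    also have "\<dots> \<le> real n" using T[OF r(2)] by simp
    finally show "cost (dual_weight Q R) {0..\<tau>} (\<lambda>t. (q t, u t)) \<le> real n" .
  qed
qed

lemma infinite_horizon_optimum:
  assumes det: "detectable F A H l"
  obtains q u v where "(q, u) \<in> dual_solutions F A H l {0..}"
    "((\<lambda>\<tau>. ereal (J F Q0 Q R q u \<tau>)) \<longlongrightarrow> ereal v) at_top"
    "((\<lambda>\<tau>. INF (q', u') \<in> dual_solutions F A H l {0..\<tau>}. ereal (J F Q0 Q R q' u' \<tau>)) \<longlongrightarrow> ereal v) at_top"
proof -
  note pK = pos_op_dual_weight[OF Q R]
  let ?K = "dual_weight Q R"
  obtain q0 u0 where qu0: "(q0, u0) \<in> dual_solutions F A H l {0..}"
      "(ac_value {0..} (\<lambda>s. transpose F *v q0 s) \<longlongrightarrow> 0) at_top"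
    using det unfolding detectable_def by blast
  obtain W0 where W0: "dual_sol F A H {0..} (\<lambda>t. (q0 t, u0 t)) W0" "W0 0 = transpose F *v l"
    using qu0(1) by (subst (asm) dual_solutions_iff) auto
  have "\<forall>\<^sub>F t in at_top. ac_value {0..} (\<lambda>s. transpose F *v q0 s) t = W0 t"
    using eventually_ge_at_top[of 0]
    by eventually_elim
      (use lin_sol_ac_value[OF linear_dual_state linear_dual_rate W0(1)] in \<open>simp add: dual_state_def\<close>)
  then have W0_lim: "(W0 \<longlongrightarrow> 0) at_top" using qu0(2) by (rule Lim_transform_eventually[rotated])
  obtain B where B: "\<And>n::nat. \<exists>\<xi> W. dual_sol F A H {0..real n} \<xi> W \<and> W 0 = W0 0 \<and>
      (LINT t|lebesgue_on {0..real n}. (norm (\<xi> t))\<^sup>2) \<le> B"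
    using lin_sol_bounded_energy[OF linear_dual_state linear_dual_rate W0(1) W0_lim] by blast
  obtain C where C: "0 \<le> C" "\<And>x. x \<bullet> ?K x \<le> C * (norm x)\<^sup>2" using pos_op_bounded[OF pK] by blast
  have bounded: "\<exists>\<xi> W. dual_sol F A H {0..real n} \<xi> W \<and> W 0 = transpose F *v l \<and>
      cost ?K {0..real n} \<xi> \<le> C * B" for n :: nat
  proof -
    obtain \<xi> W where s: "dual_sol F A H {0..real n} \<xi> W" "W 0 = W0 0"
      "(LINT t|lebesgue_on {0..real n}. (norm (\<xi> t))\<^sup>2) \<le> B" using B[of n] by blast
    have xi: "\<xi> \<in> L2_on {0..real n}" using lin_sol_L2[OF s(1)] by (simp add: L2_loc_Icc)
    have "cost ?K {0..real n} \<xi> \<le> (LINT t|lebesgue_on {0..real n}. C * (norm (\<xi> t))\<^sup>2)"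
      unfolding cost_def using L2_on_integrable_sq[OF xi] cost_integrable[OF pK xi] C(2)
      by (intro integral_mono) auto
    also have "\<dots> \<le> C * B" using s(3) C(1) by (simp add: mult_left_mono)
    finally show ?thesis using s W0(2) by auto
  qed
  obtain \<xi> W v where \<xi>: "dual_sol F A H {0..} \<xi> W" "W 0 = transpose F *v l"
    and cost_le: "\<And>T. 0 \<le> T \<Longrightarrow> cost ?K {0..T} \<xi> \<le> v"
    and opt: "\<And>\<epsilon>. 0 < \<epsilon> \<Longrightarrow> \<exists>n::nat. \<forall>\<zeta> Z. dual_sol F A H {0..real n} \<zeta> Z \<longrightarrow>
       Z 0 = transpose F *v l \<longrightarrow> v - \<epsilon> < cost ?K {0..real n} \<zeta>"
    using lin_sol_optimal[OF linear_dual_state linear_dual_rate pK bounded] by blast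
  define q where "q t = fst (\<xi> t)" for t
  define u where "u t = snd (\<xi> t)" for t
  have qu: "(\<lambda>t. (q t, u t)) = \<xi>" by (simp add: q_def u_def)
  have sol: "dual_sol F A H {0..} (\<lambda>t. (q t, u t)) W" unfolding qu by (rule \<xi>(1))
  have mem: "(q, u) \<in> dual_solutions F A H l {0..}" using sol \<xi>(2) by (subst dual_solutions_iff) auto
  have Jq: "J F Q0 Q R q u \<tau> = terminal_cost F Q0 (W \<tau>) + cost ?K {0..\<tau>} \<xi>" if "0 < \<tau>" for \<tau>
    using J_lin_sol[OF sol, of \<tau>] that unfolding qu by simp
  have tc: "((\<lambda>\<tau>. terminal_cost F Q0 (W \<tau>)) \<longlongrightarrow> 0) at_top"
    by (intro terminal_cost_tendsto_zero[OF Q0] dual_lin_sol_range[OF sol]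
        dual_cost_tendsto_zero[OF \<xi>(1) cost_le]) auto
  have lower: "v - \<epsilon> < cost ?K {0..\<tau>} \<zeta>"
    if n: "\<forall>\<zeta> Z. dual_sol F A H {0..real n} \<zeta> Z \<longrightarrow>
       Z 0 = transpose F *v l \<longrightarrow> v - \<epsilon> < cost ?K {0..real n} \<zeta>"
      and \<tau>: "real n \<le> \<tau>" and \<zeta>: "dual_sol F A H {0..\<tau>} \<zeta> Z" "Z 0 = transpose F *v l"
    for n \<tau> \<zeta> Z \<epsilon>
  proof -
    have "dual_sol F A H {0..real n} \<zeta> Z"
      using \<tau> by (intro lin_sol_restrict[OF linear_dual_state linear_dual_rate \<zeta>(1)]) auto
    then have "v - \<epsilon> < cost ?K {0..real n} \<zeta>" using n \<zeta>(2) by blast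
    also have "\<dots> \<le> cost ?K {0..\<tau>} \<zeta>"
      using \<tau> lin_sol_L2[OF \<zeta>(1)] by (intro cost_mono[OF pK]) (auto simp: L2_loc_Icc)
    finally show ?thesis .
  qed
  have J_upper: "\<forall>\<^sub>F \<tau> in at_top. J F Q0 Q R q u \<tau> < v + \<epsilon>" if "0 < \<epsilon>" for \<epsilon>
    using order_tendstoD(2)[OF tc that] eventually_gt_at_top[of 0]
  proof eventually_elim
    case (elim \<tau>)
    then show ?case using Jq[of \<tau>] cost_le[of \<tau>] by simp
  qed
  define I where "I \<tau> = (INF (q', u') \<in> dual_solutions F A H l {0..\<tau>}. ereal (J F Q0 Q R q' u' \<tau>))" for \<tau>
  have I_le_J: "I \<tau> \<le> ereal (J F Q0 Q R q u \<tau>)" if "0 < \<tau>" for \<tau>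
  proof -
    have "dual_sol F A H {0..\<tau>} (\<lambda>t. (q t, u t)) W"
      using that by (intro lin_sol_restrict[OF linear_dual_state linear_dual_rate sol]) auto
    then have "(q, u) \<in> dual_solutions F A H l {0..\<tau>}"
      using that \<xi>(2) by (subst dual_solutions_iff) auto
    then show ?thesis unfolding I_def by (intro INF_lower2[of "(q, u)"]) auto
  qed
  have I_lower: "\<forall>\<^sub>F \<tau> in at_top. ereal (v - \<epsilon>) \<le> I \<tau>" if \<epsilon>: "0 < \<epsilon>" for \<epsilon>
  proof -
    obtain n :: nat where n: "\<forall>\<zeta> Z. dual_sol F A H {0..real n} \<zeta> Z \<longrightarrow>
       Z 0 = transpose F *v l \<longrightarrow> v - \<epsilon> < cost ?K {0..real n} \<zeta>" using opt[OF \<epsilon>] by blast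
    show ?thesis
      using eventually_ge_at_top[of "real n"] eventually_gt_at_top[of 0]
    proof eventually_elim
      case (elim \<tau>)
      show ?case
        unfolding I_def
      proof (rule INF_greatest, clarify)
        fix q' u' assume "(q', u') \<in> dual_solutions F A H l {0..\<tau>}"
        then obtain Z where Z: "dual_sol F A H {0..\<tau>} (\<lambda>t. (q' t, u' t)) Z"
          "Z 0 = transpose F *v l" using elim(2) by (subst (asm) dual_solutions_iff) auto
        have "v - \<epsilon> < cost ?K {0..\<tau>} (\<lambda>t. (q' t, u' t))" by (rule lower[OF n elim(1) Z])
        also have "\<dots> \<le> J F Q0 Q R q' u' \<tau>"
          using J_lin_sol[OF Z(1), of \<tau> Q0 Q R] terminal_cost_nonneg[OF Q0 dual_lin_sol_range[OF Z(1), of \<tau>]] elim(2)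
          by simp
        finally show "ereal (v - \<epsilon>) \<le> ereal (J F Q0 Q R q' u' \<tau>)" by simp
      qed
    qed
  qed
  have squeeze: "(f \<longlongrightarrow> ereal v) at_top"
    if f: "\<And>\<tau>. 0 < \<tau> \<Longrightarrow> I \<tau> \<le> f \<tau>" "\<And>\<tau>. 0 < \<tau> \<Longrightarrow> f \<tau> \<le> ereal (J F Q0 Q R q u \<tau>)" for f :: "real \<Rightarrow> ereal"
  proof (rule order_tendstoI)
    fix y assume "y < ereal v"
    then obtain r where r: "y < ereal r" "r < v" by (metis ereal_dense2 less_ereal.simps(1))
    then have "\<forall>\<^sub>F \<tau> in at_top. ereal (v - (v - r)) \<le> I \<tau>" by (intro I_lower) simp
    then show "\<forall>\<^sub>F \<tau> in at_top. y < f \<tau>"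
      using eventually_gt_at_top[of 0]
    proof eventually_elim
      case (elim \<tau>)
      then have "ereal r \<le> f \<tau>" using f(1)[of \<tau>] by (simp add: order_trans)
      then show ?case using r(1) by (rule less_le_trans[rotated])
    qed
  next
    fix y assume "ereal v < y"
    then obtain r where r: "ereal r < y" "v < r" by (metis ereal_dense2 less_ereal.simps(1))
    then have "\<forall>\<^sub>F \<tau> in at_top. J F Q0 Q R q u \<tau> < v + (r - v)" by (intro J_upper) simp
    then show "\<forall>\<^sub>F \<tau> in at_top. f \<tau> < y"
      using eventually_gt_at_top[of 0]
    proof eventually_elim
      case (elim \<tau>)
      then have "ereal (J F Q0 Q R q u \<tau>) < ereal r" by simp
      then show ?case using f(2)[of \<tau>] elim r(1) by (meson le_less_trans less_trans)
    qed
  qed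
  show ?thesis
  proof (rule that[OF mem])
    show "((\<lambda>\<tau>. ereal (J F Q0 Q R q u \<tau>)) \<longlongrightarrow> ereal v) at_top" by (intro squeeze I_le_J) auto
    show "((\<lambda>\<tau>. INF (q', u') \<in> dual_solutions F A H l {0..\<tau>}. ereal (J F Q0 Q R q' u' \<tau>)) \<longlongrightarrow> ereal v) at_top"
      using squeeze[of I] I_le_J unfolding I_def by simp
  qed
qed

lemma sigma_fin_reversed_control:
  assumes mem: "(q, u) \<in> dual_solutions F A H l {0..}" and t: "0 < t"
  shows "(\<lambda>s. u (t - s)) \<in> L2_on {0..t}"
    and "sigma_fin F A H Q0 Q R (\<lambda>s. u (t - s)) l t \<le> ereal (J F Q0 Q R q u t)"
proof -
  obtain W where W: "dual_sol F A H {0..} (\<lambda>t. (q t, u t)) W" "W 0 = transpose F *v l"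
    using mem by (subst (asm) dual_solutions_iff) auto
  have rev: "{0..t} = (\<lambda>s. t + - 1 * s) -` {0..t}" by auto
  have "u \<in> L2_on {0..t}" using lin_sol_L2[OF W(1)] t unfolding L2_loc_Pair_iff by (simp add: L2_loc_atLeast)
  from L2_on_affine[OF _ _ rev this] show "(\<lambda>s. u (t - s)) \<in> L2_on {0..t}" by simp
  have sol: "dual_sol F A H {0..t} (\<lambda>t. (q t, u t)) W"
    using t by (intro lin_sol_restrict[OF linear_dual_state linear_dual_rate W(1)]) auto
  show "sigma_fin F A H Q0 Q R (\<lambda>s. u (t - s)) l t \<le> ereal (J F Q0 Q R q u t)"
    unfolding sigma_fin_def
  proof (rule SUP_least, clarify)
    fix x f y \<eta> assume "(x, f, y, \<eta>) \<in> admissible F A H Q0 Q R {0..t}"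
    from weak_duality[OF Q0 Q R t sol W(2) this] J_lin_sol[OF sol, of t Q0 Q R] t
    show "ereal ((l \<bullet> ac_value {0..t} (\<lambda>s. F *v x s) t - (LINT s|lebesgue_on {0..t}. y s \<bullet> u (t - s)))\<^sup>2) \<le>
        ereal (J F Q0 Q R q u t)"
      by simp
  qed
qed

end

theorem theorem2:
  fixes F A :: "real^'n^'m" and H :: "real^'n^'p"
    and Q0 Q :: "real^'m^'m" and R :: "real^'p^'p"
    and l :: "real^'m"
  assumes "sym_pos_def Q0" and "sym_pos_def Q" and "sym_pos_def R"
  shows "detectable F A H l \<longleftrightarrow>
    (\<exists>V q u.
       minimax_observer F A H Q0 Q R l V \<and>
       (q, u) \<in> dual_solutions F A H l {0..} \<and>
       (\<forall>t1>0. \<forall>s\<in>{0..t1}. V t1 s = u (t1 - s)) \<and>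
       sigma_lim F A H Q0 Q R V l = Limsup at_top (\<lambda>\<tau>. ereal (J F Q0 Q R q u \<tau>)) \<and>
       Limsup at_top (\<lambda>\<tau>. ereal (J F Q0 Q R q u \<tau>)) =
         Limsup at_top (\<lambda>\<tau>. INF (q', u') \<in> dual_solutions F A H l {0..\<tau>}.
                                ereal (J F Q0 Q R q' u' \<tau>)) \<and>
       Limsup at_top (\<lambda>\<tau>. ereal (J F Q0 Q R q u \<tau>)) < \<infinity>)"
proof
  assume "detectable F A H l"
  from infinite_horizon_optimum[OF assms this] obtain q u v where
    mem: "(q, u) \<in> dual_solutions F A H l {0..}"
    and J_lim: "((\<lambda>\<tau>. ereal (J F Q0 Q R q u \<tau>)) \<longlongrightarrow> ereal v) at_top"
    and I_lim: "((\<lambda>\<tau>. INF (q', u') \<in> dual_solutions F A H l {0..\<tau>}. ereal (J F Q0 Q R q' u' \<tau>)) \<longlongrightarrow> ereal v) at_top"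
    by blast
  have J_v: "Limsup at_top (\<lambda>\<tau>. ereal (J F Q0 Q R q u \<tau>)) = ereal v"
    by (rule lim_imp_Limsup[OF _ J_lim]) simp
  have I_v: "Limsup at_top (\<lambda>\<tau>. INF (q', u') \<in> dual_solutions F A H l {0..\<tau>}. ereal (J F Q0 Q R q' u' \<tau>)) = ereal v"
    by (rule lim_imp_Limsup[OF _ I_lim]) simp
  define V where "V t s = u (t - s)" for t s
  have V: "V \<in> observers"
    using sigma_fin_reversed_control(1)[OF assms mem] by (simp add: observers_def V_def[abs_def])
  have upper: "sigma_lim F A H Q0 Q R V l \<le> ereal v"
    unfolding sigma_lim_def J_v[symmetric]
  proof (rule Limsup_mono)
    show "\<forall>\<^sub>F t in at_top. sigma_fin F A H Q0 Q R (V t) l t \<le> ereal (J F Q0 Q R q u t)"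
      using eventually_gt_at_top[of 0]
      by eventually_elim (use sigma_fin_reversed_control(2)[OF assms mem] in \<open>simp add: V_def[abs_def]\<close>)
  qed
  have lower: "ereal v \<le> sigma_lim F A H Q0 Q R U l" if "U \<in> observers" for U
    unfolding sigma_lim_def I_v[symmetric]
  proof (rule Limsup_mono)
    show "\<forall>\<^sub>F t in at_top. (INF (q', u') \<in> dual_solutions F A H l {0..t}. ereal (J F Q0 Q R q' u' t)) \<le>
        sigma_fin F A H Q0 Q R (U t) l t"
      using eventually_gt_at_top[of 0]
      by eventually_elim (use that in \<open>auto simp: observers_def intro!: strong_duality[OF assms]\<close>)
  qed
  have eq: "sigma_lim F A H Q0 Q R V l = ereal v" by (rule antisym[OF upper lower[OF V]])
  have "sigma_lim F A H Q0 Q R V l = (INF U \<in> observers. sigma_lim F A H Q0 Q R U l)"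
  proof (rule antisym)
    show "sigma_lim F A H Q0 Q R V l \<le> (INF U \<in> observers. sigma_lim F A H Q0 Q R U l)"
      unfolding eq by (intro INF_greatest lower)
  qed (rule INF_lower[OF V])
  moreover have "sigma_lim F A H Q0 Q R V l < \<infinity>" unfolding eq by simp
  ultimately have "minimax_observer F A H Q0 Q R l V"
    unfolding minimax_observer_def using V by blast
  then show "\<exists>V q u.
       minimax_observer F A H Q0 Q R l V \<and>
       (q, u) \<in> dual_solutions F A H l {0..} \<and>
       (\<forall>t1>0. \<forall>s\<in>{0..t1}. V t1 s = u (t1 - s)) \<and>
       sigma_lim F A H Q0 Q R V l = Limsup at_top (\<lambda>\<tau>. ereal (J F Q0 Q R q u \<tau>)) \<and>
       Limsup at_top (\<lambda>\<tau>. ereal (J F Q0 Q R q u \<tau>)) =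
         Limsup at_top (\<lambda>\<tau>. INF (q', u') \<in> dual_solutions F A H l {0..\<tau>}.
                                ereal (J F Q0 Q R q' u' \<tau>)) \<and>
       Limsup at_top (\<lambda>\<tau>. ereal (J F Q0 Q R q u \<tau>)) < \<infinity>"
    using mem eq by (intro exI[of _ V] exI[of _ q] exI[of _ u]) (simp add: J_v I_v V_def)
next
  assume "\<exists>V q u.
       minimax_observer F A H Q0 Q R l V \<and>
       (q, u) \<in> dual_solutions F A H l {0..} \<and>
       (\<forall>t1>0. \<forall>s\<in>{0..t1}. V t1 s = u (t1 - s)) \<and>
       sigma_lim F A H Q0 Q R V l = Limsup at_top (\<lambda>\<tau>. ereal (J F Q0 Q R q u \<tau>)) \<and>
       Limsup at_top (\<lambda>\<tau>. ereal (J F Q0 Q R q u \<tau>)) =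
         Limsup at_top (\<lambda>\<tau>. INF (q', u') \<in> dual_solutions F A H l {0..\<tau>}.
                                ereal (J F Q0 Q R q' u' \<tau>)) \<and>
       Limsup at_top (\<lambda>\<tau>. ereal (J F Q0 Q R q u \<tau>)) < \<infinity>"
  then show "detectable F A H l" using detectable_of_finite_cost[OF assms] by blast
qed

end
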